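(* Let $\Lambda$ be a lattice of determinant $1$ in $\mathbb R^n$, let $k$ be a natural number (with $k\ge 2$ if $n=1$), and let $V$ be the set of $k$-free points of $\Lambda$. The diffraction measure $\widehat\gamma$ of the (natural) autocorrelation $\gamma$ of $V$ exists and is a positive, pure-point, translation-bounded measure which is concentrated on the set of points of $\mathbb Q\Lambda^*$ with $(k+1)$-free denominator, and whose intensity at a point with such a denominator $q$ is $$\frac{1}{\zeta^2(nk)}\prod_{p\mid q}\frac{1}{(p^{nk}-1)^2}.$$ Moreover, $$\widehat\gamma=\xi(nk)\sum_{\substack{d=1\\ d\ \text{squarefree}}}^{\infty}\Bigl(\prod_{p\mid d}\frac{1}{p^{2nk}-2p^{nk}}\Bigr)\,\omega_{\Lambda^*/d^k},$$ a weak*-convergent sum (in fact, even a $\|\cdot\|_{\rm loc}$-convergent sum) of Dirac combs. (For lattices $\Lambda$ with determinant $\ne1$, both formulas must be divided by the square of $\det(\Lambda)$.)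
   Context: For a nonzero $l\in\Lambda$, the $k$-content $c_k(l)$ is the largest integer $c$ such that $l\in c^k\Lambda$; $c_k(0)=\infty$. $V=\{l\in\Lambda:c_k(l)=1\}$. Products over $p$ run over primes. $B_R(0)$ is the open Euclidean ball and $v_n$ the volume of the unit ball in $\mathbb R^n$. For a locally finite set $S\subset\mathbb R^n$ the Dirac comb is $\omega_S:=\sum_{x\in S}\delta_x$. The natural autocorrelation $\gamma$ of $V$ is the vague limit, as $R\to\infty$, of $\frac{1}{R^nv_n}\sum_{x,y\in V\cap B_R(0)}\delta_{x-y}$. The diffraction measure $\widehat\gamma$ is the Fourier transform of $\gamma$ as a tempered distribution/measure, with the convention $\widehat f(y)=\int e^{-2\pi i x\cdot y}f(x)\,dx$. The intensity at a point $y$ is $\widehat\gamma(\{y\})$. For a measure $\mu$, $\|\mu\|_{\rm loc}:=\sup_{x\in\mathbb R^n}|\mu|(B_1(x))$, and $\mu$ is translation bounded if this is finite. Weak*-convergence is in the space of tempered distributions. $\Lambda^*=\{y\in\mathbb R^n: y\cdot x\in\mathbb Z\ \forall x\in\Lambda\}$ is the dual lattice. The denominator of $y\in\mathbb Q\Lambda^*$ is the smallest $a\in\mathbb N$ with $ay\in\Lambda^*$. A natural number is $(k+1)$-free if it is not divisible by $p^{k+1}$ for any prime $p$. For $\Re(s)>1$, $\xi(s):=\prod_p\bigl(1-\frac{2}{p^s}\bigr)$, and $\zeta$ is the Riemann zeta function. *)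

theory Defs
  imports
    "HOL-Analysis.Analysis"
    "HOL-Library.Extended_Nat"
    "HOL-Computational_Algebra.Primes"
    "HOL-Computational_Algebra.Squarefree"
begin

section \<open>Lattices\<close>

definition lattice_basis :: "real^'n^'n \<Rightarrow> (real^'n) set \<Rightarrow> bool" where
  "lattice_basis A L \<longleftrightarrow> invertible A \<and> L = range (\<lambda>z :: int^'n. A *v (\<chi> i. of_int (z $ i)))"

definition is_lattice :: "(real^'n) set \<Rightarrow> bool" where
  "is_lattice L \<longleftrightarrow> (\<exists>A. lattice_basis A L)"

text \<open>Any two basis matrices differ by a unimodular integer matrix, so the choice is immaterial.\<close>
definition lattice_det :: "(real^'n) set \<Rightarrow> real" where
  "lattice_det L = \<bar>det (SOME A. lattice_basis A L)\<bar>"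

definition dual_lattice :: "(real^'n) set \<Rightarrow> (real^'n) set" where
  "dual_lattice L = {y. \<forall>x\<in>L. y \<bullet> x \<in> \<int>}"

definition rational_multiples :: "(real^'n) set \<Rightarrow> (real^'n) set" where
  "rational_multiples L = {of_rat r *\<^sub>R y | r y. y \<in> L}"

definition denominator :: "(real^'n) set \<Rightarrow> real^'n \<Rightarrow> nat" where
  "denominator L y = (LEAST a. a \<ge> 1 \<and> of_nat a *\<^sub>R y \<in> dual_lattice L)"

definition k_content :: "nat \<Rightarrow> (real^'n) set \<Rightarrow> real^'n \<Rightarrow> enat" where
  "k_content k L l =
     (if l = 0 then \<infinity> else enat (GREATEST c. l \<in> (\<lambda>x. of_nat (c ^ k) *\<^sub>R x) ` L))"

definition k_free_points :: "nat \<Rightarrow> (real^'n) set \<Rightarrow> (real^'n) set" where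
  "k_free_points k L = {l \<in> L. k_content k L l = 1}"

definition power_free :: "nat \<Rightarrow> nat \<Rightarrow> bool" where
  "power_free m q \<longleftrightarrow> (\<forall>p. prime p \<longrightarrow> \<not> p ^ m dvd q)"


section \<open>Zeta function and Euler product\<close>

text \<open>Both are meant only for (real parts of) arguments greater than 1.\<close>

definition zeta :: "'a :: {real_normed_field, banach, ln} \<Rightarrow> 'a" where
  "zeta s = (\<Sum>m. 1 / of_nat (Suc m) powr s)"

definition xi :: "'a :: {real_normed_field, banach, ln} \<Rightarrow> 'a" where
  "xi s = (\<Prod>p. if prime p then 1 - 2 / of_nat p powr s else 1)"


section \<open>Schwartz functions and tempered distributions\<close>

definition partial_deriv :: "'n \<Rightarrow> (real^'n \<Rightarrow> complex) \<Rightarrow> real^'n \<Rightarrow> complex" where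
  "partial_deriv i f x = vector_derivative (\<lambda>t. f (x + t *\<^sub>R axis i 1)) (at 0)"

text \<open>Lists of directions play the role of multi-indices.\<close>
definition partial_derivs :: "'n list \<Rightarrow> (real^'n \<Rightarrow> complex) \<Rightarrow> real^'n \<Rightarrow> complex" where
  "partial_derivs is f = foldr partial_deriv is f"

text \<open>If all iterated partial derivatives exist and are (totally) differentiable, then they are
  also continuous, so the first conjunct says that the function is smooth.\<close>
definition schwartz :: "(real^'n \<Rightarrow> complex) \<Rightarrow> bool" where
  "schwartz f \<longleftrightarrow> (\<forall>is.
     (\<forall>x. partial_derivs is f differentiable (at x)) \<and>
     (\<forall>N::nat. bounded (range (\<lambda>x. (1 + norm x) ^ N *\<^sub>R partial_derivs is f x))))"

definition schwartz_norm :: "nat \<Rightarrow> (real^'n \<Rightarrow> complex) \<Rightarrow> real" where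
  "schwartz_norm N f =
     (SUP (is, x) \<in> {is. length is \<le> N} \<times> UNIV. (1 + norm x) ^ N * norm (partial_derivs is f x))"

text \<open>Distributions are represented by functionals on all functions, of which only the values at
  Schwartz functions matter.\<close>
definition tempered_distribution :: "((real^'n \<Rightarrow> complex) \<Rightarrow> complex) \<Rightarrow> bool" where
  "tempered_distribution T \<longleftrightarrow>
     (\<forall>f g a b. schwartz f \<longrightarrow> schwartz g \<longrightarrow> T (\<lambda>x. a * f x + b * g x) = a * T f + b * T g) \<and>
     (\<exists>N C. \<forall>f. schwartz f \<longrightarrow> norm (T f) \<le> C * schwartz_norm N f)"

definition weak_star_lim ::
  "(nat \<Rightarrow> (real^'n \<Rightarrow> complex) \<Rightarrow> complex) \<Rightarrow> ((real^'n \<Rightarrow> complex) \<Rightarrow> complex) \<Rightarrow> bool" where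
  "weak_star_lim T T0 \<longleftrightarrow>
     (\<forall>N. tempered_distribution (T N)) \<and> tempered_distribution T0 \<and>
     (\<forall>f. schwartz f \<longrightarrow> (\<lambda>N. T N f) \<longlonglongrightarrow> T0 f)"

definition fourier :: "(real^'n \<Rightarrow> complex) \<Rightarrow> real^'n \<Rightarrow> complex" where
  "fourier f y = (LINT x|lborel. exp (- 2 * pi * \<i> * complex_of_real (x \<bullet> y)) * f x)"

definition fourier_distribution ::
  "((real^'n \<Rightarrow> complex) \<Rightarrow> complex) \<Rightarrow> (real^'n \<Rightarrow> complex) \<Rightarrow> complex" where
  "fourier_distribution T f = T (fourier f)"


section \<open>Measures\<close>

text \<open>The type of measures comprises positive measures only, so that any statement about
  \<open>\<mu> :: (real^'n) measure\<close> includes positivity of \<open>\<mu>\<close>.\<close>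

definition locally_finite_borel :: "(real^'n) measure \<Rightarrow> bool" where
  "locally_finite_borel \<mu> \<longleftrightarrow>
     sets \<mu> = sets borel \<and> (\<forall>K. compact K \<longrightarrow> emeasure \<mu> K < \<infinity>)"

definition distribution_of :: "(real^'n) measure \<Rightarrow> (real^'n \<Rightarrow> complex) \<Rightarrow> complex" where
  "distribution_of \<mu> f = (LINT x|\<mu>. f x)"

definition tempered_measure :: "(real^'n) measure \<Rightarrow> bool" where
  "tempered_measure \<mu> \<longleftrightarrow> locally_finite_borel \<mu> \<and> (\<forall>f. schwartz f \<longrightarrow> integrable \<mu> f) \<and>
     tempered_distribution (distribution_of \<mu>)"

definition is_fourier_transform :: "(real^'n) measure \<Rightarrow> (real^'n) measure \<Rightarrow> bool" where
  "is_fourier_transform \<gamma> \<mu> \<longleftrightarrow> tempered_measure \<gamma> \<and> tempered_measure \<mu> \<and>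
     (\<forall>f. schwartz f \<longrightarrow> distribution_of \<mu> f = fourier_distribution (distribution_of \<gamma>) f)"

definition pure_point :: "(real^'n) measure \<Rightarrow> bool" where
  "pure_point \<mu> \<longleftrightarrow>
     (\<forall>A\<in>sets \<mu>. emeasure \<mu> A = (\<integral>\<^sup>+ x. emeasure \<mu> {x} \<partial>count_space A))"

text \<open>Signed measures need not be defined on unbounded sets. They are therefore represented by
  set functions, of which only the values at bounded Borel sets matter.\<close>

definition total_variation :: "((real^'n) set \<Rightarrow> real) \<Rightarrow> (real^'n) set \<Rightarrow> ennreal" where
  "total_variation m A =
     (SUP P \<in> {P :: nat \<Rightarrow> (real^'n) set. range P \<subseteq> sets borel \<and> disjoint_family P \<and> (\<Union>i. P i) = A}.
        \<Sum>i. ennreal \<bar>m (P i)\<bar>)"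

definition loc_norm :: "((real^'n) set \<Rightarrow> real) \<Rightarrow> ennreal" where
  "loc_norm m = (SUP x. total_variation m (ball x 1))"

definition translation_bounded :: "(real^'n) measure \<Rightarrow> bool" where
  "translation_bounded \<mu> \<longleftrightarrow> locally_finite_borel \<mu> \<and> loc_norm (measure \<mu>) < \<infinity>"

text \<open>Counting the points of a set; integrating against it means summing over the set.\<close>
definition dirac_comb :: "(real^'n) set \<Rightarrow> (real^'n) measure" where
  "dirac_comb S = distr (count_space S) borel (\<lambda>x. x)"


section \<open>Autocorrelation\<close>

definition vague_lim ::
  "('b \<Rightarrow> (real^'n) measure) \<Rightarrow> (real^'n) measure \<Rightarrow> 'b filter \<Rightarrow> bool" where
  "vague_lim M \<gamma> F \<longleftrightarrow> locally_finite_borel \<gamma> \<and>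
     (\<forall>f :: real^'n \<Rightarrow> complex. continuous_on UNIV f \<longrightarrow> compact (closure {x. f x \<noteq> 0}) \<longrightarrow>
        ((\<lambda>R. LINT x|M R. f x) \<longlongrightarrow> (LINT x|\<gamma>. f x)) F)"

definition finite_autocorrelation :: "(real^'n) set \<Rightarrow> real \<Rightarrow> (real^'n) measure" where
  "finite_autocorrelation V R =
     scale_measure (ennreal (1 / (R ^ CARD('n) * unit_ball_vol (real CARD('n)))))
       (distr (count_space ((V \<inter> ball 0 R) \<times> (V \<inter> ball 0 R))) borel (\<lambda>(x, y). x - y))"

definition natural_autocorrelation :: "(real^'n) set \<Rightarrow> (real^'n) measure \<Rightarrow> bool" where
  "natural_autocorrelation V \<gamma> \<longleftrightarrow> vague_lim (finite_autocorrelation V) \<gamma> at_top"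

end

theory Submission
  imports Defs
begin

text \<open>
  A point of the lattice \<open>\<Lambda>\<close> is \<open>k\<close>-free iff it avoids \<open>p^k \<Lambda>\<close> for every prime \<open>p\<close>.  By the Chinese
  remainder theorem, sieving \<open>x\<close> and \<open>x - l\<close> by the primes up to \<open>T\<close> leaves a set of density
  \<open>det(\<Lambda>)^-1\<close> times the product over \<open>p \<le> T\<close> of \<open>1 - 1/p^(nk)\<close> if \<open>l \<in> p^k \<Lambda>\<close>, and of
  \<open>1 - 2/p^(nk)\<close> otherwise; the larger primes affect at most a fraction of order
  \<open>\<Sum>p>T. p^(-nk)\<close> of the points, so the autocorrelation coefficient of \<open>l\<close> is the limit of these
  products.  Factoring out \<open>\<xi>(nk)\<close> and expanding what remains over squarefree \<open>d\<close> exhibits the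
  autocorrelation as an absolutely convergent series of the combs of the lattices \<open>d^k \<Lambda>\<close>.  The
  Poisson summation formula, applied to each comb, turns it into the series for the diffraction
  measure.  Its point masses are again squarefree sums, with Euler products that combine with
  \<open>\<xi>(nk)\<close> to \<open>1 / \<zeta>(nk)^2\<close> times a finite product.

  Poisson summation is proved with Fejer kernels: testing the Schwartz function against the
  \<open>n\<close>-dimensional Fejer kernel gives Cesaro means of the sum over its Fourier transform on one
  side, and an approximate identity near each integer point on the other.
\<close>

section \<open>Lebesgue measure under linear maps\<close>

text \<open>Put \<open>P = p^(nk)\<close>. The factor \<open>xi\<close> is split off because
  \<open>1 - 1/P = (1 - 2/P) * (1 + 1/(P - 2))\<close>: what remains is a product of terms
  \<open>1 + a\<close> with \<open>a \<ge> 0\<close>, so all weights on both sides are nonnegative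
  and sums may be exchanged freely. The delicate series is that of the diffraction, whose combs have
  density of order \<open>d^(nk)\<close>. Poisson summation for \<open>d^k L\<close> divides by its
  determinant, so the diffraction weight times \<open>d^(nk)\<close> is the autocorrelation weight
  up to a constant. Summability of the latter therefore yields temperedness, translation boundedness
  and local norm convergence together; the error of a partial sum is a positive measure, so its
  local norm is its largest mass on a unit ball. For the density the obstacle is uniformity in the
  radius \<open>R\<close>, since primes with \<open>p^k\<close> far above \<open>R\<close> occur
  too. Once the origin is removed, \<open>p^k L\<close> has at most \<open>C (R/p^k)^n\<close>
  points in the ball at every scale. Poisson summation over the integers is proved for continuous
  functions with decay of order \<open>n + 2\<close>. A Schwartz function may then be composed with
  a basis matrix, and its Fourier transform is only estimated.\<close>

lemma shear_matrix:
  fixes m n :: "'n::finite"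
  assumes "m \<noteq> n"
  defines "T \<equiv> (\<chi> i j. of_bool (i = m \<and> j = n \<or> i = j)) :: real^'n^'n"
  shows "T *v x = (\<chi> i. if i = m then x $ m + x $ n else x $ i)" "det T = 1"
proof -
  have "(\<Sum>j\<in>UNIV. of_bool (m = n \<or> m = j \<or> j = n) * x $ j) = x $ m + x $ n"
  proof -
    have "(\<Sum>j\<in>UNIV. of_bool (m = n \<or> m = j \<or> j = n) * x $ j) = (\<Sum>j\<in>{m, n}. x $ j)"
      using assms by (intro sum.mono_neutral_cong_right) auto
    then show ?thesis using assms by simp
  qed
  moreover have "(\<Sum>j\<in>UNIV. of_bool (i = j) * x $ j) = x $ i" for i
    by (simp add: of_bool_def if_distrib[of "\<lambda>c. c * _"] cong: if_cong)
  ultimately show "T *v x = (\<chi> i. if i = m then x $ m + x $ n else x $ i)"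
    using assms by (auto simp: T_def matrix_vector_mult_def vec_eq_iff max.commute cong: if_cong)
  have "T = (\<chi> k. if k = m then row m (mat 1) + 1 *s row n (mat 1) else row k (mat 1))"
    using assms by (auto simp: T_def vec_eq_iff row_def mat_def)
  then show "det T = 1" using det_row_operation[OF assms(1), where c = 1 and A = "mat 1 :: real^'n^'n"] by simp
qed

lemma measure_shear_cbox:
  fixes m n :: "'n::finite" and a b :: "real^'n"
  assumes "m \<noteq> n"
  defines "h \<equiv> \<lambda>x :: real^'n. \<chi> i. if i = m then x $ m + x $ n else x $ i"
  shows "measure lebesgue (h ` cbox a b) = measure lebesgue (cbox a b)"
proof (cases "cbox a b = {}")
  case False
  \<comment> \<open>\<open>measure_shear_interval\<close> wants the \<open>n\<close>-th coordinate
    of the lower corner to be nonnegative. Moving that corner to 0 achieves this, and by linearity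
    of the shear the image is merely translated.\<close>
  define v :: "real^'n" where "v = (\<chi> i. - a $ i)"
  have eq: "h ` cbox a b = (+) (- h v) ` h ` cbox (v + a) (v + b)"
    unfolding cbox_translation image_image
    by (intro image_cong refl) (auto simp: h_def vec_eq_iff)
  have "cbox (v + a) (v + b) \<noteq> {}" using False by (simp add: cbox_translation)
  moreover have "0 \<le> (v + a) $ n" by (simp add: v_def)
  ultimately have "measure lebesgue (h ` cbox (v + a) (v + b)) = measure lebesgue (cbox (v + a) (v + b))"
    unfolding h_def by (intro measure_shear_interval assms) auto
  also have "\<dots> = measure lebesgue ((+) v ` cbox a b)" by (simp only: cbox_translation)
  finally show ?thesis unfolding eq by (simp only: measure_translation)
qed simp

text \<open>The library proves this only over well-ordered index types; Gaussian elimination avoids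
  the order.\<close>
lemma lebesgue_matrix_image:
  fixes A :: "real^'n^'n"
  shows "\<forall>S\<in>lmeasurable. (*v) A ` S \<in> lmeasurable \<and>
           measure lebesgue ((*v) A ` S) = \<bar>det A\<bar> * measure lebesgue S"
    (is "?P A")
proof (induction A rule: induct_matrix_elementary_alt)
  case (1 A B)
  moreover have "(*v) (A ** B) ` S = (*v) A ` (*v) B ` S" for S
    by (simp add: image_image matrix_vector_mul_assoc)
  ultimately show ?case by (simp add: det_mul abs_mult)
next
  case (2 A i)
  have lin: "linear ((*v) A)" by (rule matrix_vector_mul_linear)
  \<comment> \<open>A zero row makes the matrix singular, so the image is negligible and both sides
    are 0.\<close>
  have "det A = 0" using 2 by (rule det_zero_row)
  then have "\<not> inj ((*v) A)"
    using det_nz_iff_inj[OF lin] by (simp add: matrix_of_matrix_vector_mul)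
  then have "negligible ((*v) A ` S)" for S
    using negligible_linear_singular_image[OF lin] by blast
  then show ?case
    using \<open>det A = 0\<close> negligible_imp_measure0 negligible_iff_measure by auto
next
  case (3 A)
  have "A *v x = (\<chi> i. A $ i $ i * x $ i)" for x
  proof -
    have "(\<Sum>j\<in>UNIV. A $ i $ j * x $ j) = (\<Sum>j\<in>{i}. A $ i $ j * x $ j)" for i
      using 3 by (intro sum.mono_neutral_right) auto
    then show ?thesis by (simp add: matrix_vector_mult_def vec_eq_iff)
  qed
  then have "(*v) A = (\<lambda>x. \<chi> i. A $ i $ i * x $ i)" by auto
  then show ?case
    using measurable_stretch[where m = "\<lambda>i. A $ i $ i"] measure_stretch[where m = "\<lambda>i. A $ i $ i"]
      det_diagonal[of A] 3 by auto
next
  case (4 m n)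
  let ?T = "(\<chi> i j. mat 1 $ i $ Transposition.transpose m n j) :: real^'n^'n"
  let ?h = "\<lambda>x :: real^'n. \<chi> i. x $ Transposition.transpose m n i"
  have T: "(*v) ?T = ?h"
  proof
    fix x :: "real^'n"
    have "(\<Sum>j\<in>UNIV. mat 1 $ i $ Transposition.transpose m n j * x $ j) =
       (\<Sum>j\<in>{Transposition.transpose m n i}. x $ j)" for i
      by (intro sum.mono_neutral_cong_right) (auto simp: mat_def)
    then show "?T *v x = ?h x" by (simp add: matrix_vector_mult_def vec_eq_iff)
  qed
  have det: "\<bar>det ?T\<bar> = 1"
    by (simp add: det_permute_columns permutes_swap_id sign_swap_id abs_mult)
  have box: "measure lebesgue (?h ` cbox a b) = measure lebesgue (cbox a b)" for a b
  proof (cases "cbox a b = {}")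
    case False
    have eq: "?h ` cbox a b = cbox (?h a) (?h b)"
    proof (intro equalityI subsetI)
      fix y assume "y \<in> cbox (?h a) (?h b)"
      then have *: "a $ Transposition.transpose m n i \<le> y $ i \<and> y $ i \<le> b $ Transposition.transpose m n i" for i
        by (simp add: mem_box_cart)
      have "a $ i \<le> ?h y $ i \<and> ?h y $ i \<le> b $ i" for i
        using *[of "Transposition.transpose m n i"] by simp
      then have "?h y \<in> cbox a b" by (simp add: mem_box_cart)
      moreover have "y = ?h (?h y)" by (simp add: vec_eq_iff)
      ultimately show "y \<in> ?h ` cbox a b" by blast
    qed (auto simp: mem_box_cart)
    have "?h ` cbox a b \<noteq> {}" using False by blast
    then show ?thesis
      using prod.permute[OF permutes_swap_id, of m UNIV n "\<lambda>i. b $ i - a $ i"]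
      by (simp add: eq content_cbox_cart False o_def)
  qed (simp only: image_empty)
  have lin: "linear ?h" using matrix_vector_mul_linear[of ?T] unfolding T .
  show ?case unfolding T
  proof
    fix S :: "(real^'n) set" assume S: "S \<in> lmeasurable"
    have "?h ` S \<in> lmeasurable \<and> 1 * measure lebesgue S = measure lebesgue (?h ` S)"
      by (rule measure_linear_sufficient[OF lin S]) (simp only: box mult_1)
    then show "?h ` S \<in> lmeasurable \<and> measure lebesgue (?h ` S) = \<bar>det ?T\<bar> * measure lebesgue S"
      by (simp only: det mult_1)
  qed
next
  case (5 m n)
  let ?T = "(\<chi> i j. of_bool (i = m \<and> j = n \<or> i = j)) :: real^'n^'n"
  let ?h = "\<lambda>x :: real^'n. \<chi> i. if i = m then x $ m + x $ n else x $ i"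
  have T: "(*v) ?T = ?h"
    using shear_matrix(1)[OF 5] by blast
  have lin: "linear ?h" using matrix_vector_mul_linear[of ?T] unfolding T .
  show ?case unfolding T
  proof
    fix S :: "(real^'n) set" assume S: "S \<in> lmeasurable"
    have "?h ` S \<in> lmeasurable \<and> 1 * measure lebesgue S = measure lebesgue (?h ` S)"
      by (rule measure_linear_sufficient[OF lin S]) (simp only: measure_shear_cbox[OF 5] mult_1)
    then show "?h ` S \<in> lmeasurable \<and> measure lebesgue (?h ` S) = \<bar>det ?T\<bar> * measure lebesgue S"
      by (simp only: shear_matrix(2)[OF 5] abs_one mult_1)
  qed
qed

lemma matrix_inv_mult:
  assumes "invertible (A :: real^'n^'n)"
  shows "A ** matrix_inv A = mat 1" "matrix_inv A ** A = mat 1"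
  using someI_ex[OF assms[unfolded invertible_def]] by (auto simp: matrix_inv_def)

lemma matrix_inv_mult_vec:
  assumes "invertible (A :: real^'n^'n)"
  shows "matrix_inv A *v (A *v x) = x" "A *v (matrix_inv A *v x) = x"
  using assms by (simp_all add: matrix_vector_mul_assoc matrix_inv_mult)

lemma det_matrix_inv:
  assumes "invertible (A :: real^'n^'n)"
  shows "det (matrix_inv A) = 1 / det A"
proof -
  have "det A * det (matrix_inv A) = 1"
    using matrix_inv_mult(1)[OF assms] by (metis det_mul det_I)
  then show ?thesis using assms by (simp add: invertible_det_nz field_simps)
qed

text \<open>Uniqueness of Lebesgue measure leaves only open boxes to check. The preimage of a box is
  its image under the inverse matrix, whose volume factor \<open>1 / |det A|\<close> the density
  cancels.\<close>

lemma lborel_matrix: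
  fixes A :: "real^'n^'n"
  assumes "invertible A"
  shows "lborel = density (distr lborel borel ((*v) A)) (\<lambda>_. ennreal \<bar>det A\<bar>)"
proof (rule lborel_eqI)
  fix l u :: "real^'n" assume le: "\<And>b. b \<in> Basis \<Longrightarrow> l \<bullet> b \<le> u \<bullet> b"
  have [measurable]: "(*v) A \<in> borel \<rightarrow>\<^sub>M borel"
    by (intro borel_measurable_continuous_onI linear_continuous_on matrix_vector_mul_bounded_linear)
  have pre: "(*v) A -` box l u = (*v) (matrix_inv A) ` box l u"
    using matrix_inv_mult_vec[OF assms] by (auto simp: image_iff) metis
  have det: "\<bar>det A\<bar> > 0" using assms by (simp add: invertible_det_nz)
  have "measure lebesgue ((*v) (matrix_inv A) ` box l u) = \<bar>det (matrix_inv A)\<bar> * measure lebesgue (box l u)"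
    and lm: "(*v) (matrix_inv A) ` box l u \<in> lmeasurable"
    using lebesgue_matrix_image[of "matrix_inv A"] by auto
  moreover have "(*v) A -` box l u \<in> sets borel"
    using measurable_sets[of "(*v) A" borel borel "box l u"] by simp
  moreover have "(*v) (matrix_inv A) ` box l u \<in> sets borel" using calculation pre by simp
  ultimately have "emeasure lborel ((*v) A -` box l u) = ennreal (\<bar>det (matrix_inv A)\<bar> * measure lborel (box l u))"
    unfolding pre using emeasure_eq_measure2[OF lm] by (simp add: emeasure_completion measure_completion)
  then have "emeasure (density (distr lborel borel ((*v) A)) (\<lambda>_. ennreal \<bar>det A\<bar>)) (box l u) =
      ennreal \<bar>det A\<bar> * ennreal (\<bar>det (matrix_inv A)\<bar> * measure lborel (box l u))"
    by (simp add: emeasure_density emeasure_distr nn_integral_cmult_indicator)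
  also have "\<dots> = ennreal (measure lborel (box l u))"
    using det by (simp add: ennreal_mult'[symmetric] det_matrix_inv[OF assms] divide_simps)
  also have "\<dots> = ennreal (prod ((\<bullet>) (u - l)) Basis)"
    using le by (simp add: measure_lborel_box_eq)
  finally show "emeasure (density (distr lborel borel ((*v) A)) (\<lambda>_. ennreal \<bar>det A\<bar>)) (box l u) =
      ennreal (prod ((\<bullet>) (u - l)) Basis)" .
qed simp

lemma lborel_integral_matrix:
  fixes f :: "real^'n \<Rightarrow> complex" and A :: "real^'n^'n"
  assumes "invertible A" "f \<in> borel_measurable borel"
  shows "(LINT x|lborel. f x) = \<bar>det A\<bar> *\<^sub>R (LINT x|lborel. f (A *v x))"
proof -
  have [measurable]: "(*v) A \<in> borel \<rightarrow>\<^sub>M borel"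
    by (intro borel_measurable_continuous_onI linear_continuous_on matrix_vector_mul_bounded_linear)
  note [measurable] = assms(2)
  show "(LINT x|lborel. f x) = \<bar>det A\<bar> *\<^sub>R (LINT x|lborel. f (A *v x))"
    by (subst lborel_matrix[OF assms(1)]) (simp add: integral_density integral_distr)
qed

section \<open>Euler products\<close>

abbreviation primes_upto :: "nat \<Rightarrow> nat set" where
  "primes_upto N \<equiv> {p. prime p \<and> p \<le> N}"

lemma finite_primes_upto [simp]: "finite (primes_upto N)"
  by (rule finite_subset[of _ "{..N}"]) auto

lemma prime_factors_prod_primes:
  assumes "finite X" "\<And>p. p \<in> X \<Longrightarrow> prime (p::nat)"
  shows "prime_factors (\<Prod>X) = X"
proof -
  have "prime_factors (\<Prod>X) = (\<Union>p\<in>X. prime_factors p)"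
    using assms by (subst prime_factors_prod) (auto dest: assms(2))
  also have "\<dots> = (\<Union>p\<in>X. {p})"
    by (intro SUP_cong refl) (auto simp: assms prime_prime_factors)
  finally show ?thesis by simp
qed

lemma squarefree_prod_primes:
  assumes "\<And>p. p \<in> X \<Longrightarrow> prime (p::nat)"
  shows "squarefree (\<Prod>X)"
  by (rule squarefree_prod_coprime) (auto simp: assms primes_coprime squarefree_prime)

lemma squarefree_eq_prod_primes:
  assumes "squarefree (d::nat)"
  shows "\<Prod>(prime_factors d) = d"
proof -
  have "d \<noteq> 0" using assms not_squarefree_0 by metis
  then have "d = (\<Prod>p\<in>prime_factors d. p ^ multiplicity p d)"
    by (intro prime_factorization_nat) simp
  also have "\<dots> = (\<Prod>p\<in>prime_factors d. p)"
    using assms \<open>d \<noteq> 0\<close> by (intro prod.cong refl) (auto simp: squarefree_factorial_semiring')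
  finally show ?thesis by simp
qed

text \<open>A squarefree number is the product of its set of prime factors, so a product expanded
  over subsets of primes can be read as a sum over squarefree numbers.\<close>

lemma sum_squarefree_prime_factors:
  fixes h :: "nat set \<Rightarrow> 'a::comm_monoid_add"
  assumes "finite S" "\<And>p. p \<in> S \<Longrightarrow> prime p"
  shows "(\<Sum>X\<in>Pow S. h X) = (\<Sum>d | squarefree d \<and> prime_factors d \<subseteq> S. h (prime_factors d))"
proof (rule sum.reindex_bij_witness[of _ "prime_factors" "\<lambda>X. \<Prod>X"])
  fix X assume "X \<in> Pow S"
  then have X: "finite X" "\<And>p. p \<in> X \<Longrightarrow> prime p" using assms finite_subset by auto
  show "prime_factors (\<Prod>X) = X" using X by (rule prime_factors_prod_primes)
  then show "h (prime_factors (\<Prod>X)) = h X" by simp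
  show "\<Prod>X \<in> {d. squarefree d \<and> prime_factors d \<subseteq> S}"
    using prime_factors_prod_primes[OF X] squarefree_prod_primes[OF X(2)] \<open>X \<in> Pow S\<close> by auto
qed (auto simp: squarefree_eq_prod_primes)

lemma finite_squarefree_prime_factors:
  assumes "finite S"
  shows "finite {d::nat. squarefree d \<and> prime_factors d \<subseteq> S}"
proof (rule finite_subset)
  show "{d::nat. squarefree d \<and> prime_factors d \<subseteq> S} \<subseteq> (\<lambda>X. \<Prod>X) ` Pow S"
    using squarefree_eq_prod_primes by (force intro: image_eqI[OF sym])
qed (use assms in auto)

text \<open>Expanding the product over subsets of the primes up to \<open>N\<close> gives the
  squarefree \<open>d\<close> built from these primes; as \<open>a \<ge> 0\<close>, this lies
  between the sum over \<open>d < N\<close> and the full series. Deleting the summand 1 at the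
  primes of \<open>Q\<close> keeps only the subsets containing \<open>Q\<close>. The empty
  \<open>Q\<close> serves the autocorrelation, the prime factors of a denominator serve the
  intensities.\<close>

lemma euler_product_squarefree:
  fixes a :: "nat \<Rightarrow> real" and Q :: "nat set"
  assumes a: "\<And>p. prime p \<Longrightarrow> a p \<ge> 0"
    and sm: "summable (\<lambda>p. if prime p then a p else 0)"
    and Q: "finite Q" "\<And>p. p \<in> Q \<Longrightarrow> prime p"
  defines "w \<equiv> \<lambda>d. if squarefree d \<and> Q \<subseteq> prime_factors d then \<Prod>p\<in>prime_factors d. a p else 0"
  shows "summable w"
    and "(\<lambda>N. \<Prod>p\<in>primes_upto N. (if p \<in> Q then 0 else 1) + a p) \<longlonglongrightarrow> suminf w"
proof -
  define D where "D N = {d::nat. squarefree d \<and> prime_factors d \<subseteq> primes_upto N}" for N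
  have finD: "finite (D N)" for N unfolding D_def by (rule finite_squarefree_prime_factors) simp
  have w0: "w d \<ge> 0" for d unfolding w_def by (auto intro!: prod_nonneg a)
  \<comment> \<open>A prime factor of \<open>d\<close> is at most \<open>d\<close>, so every
    squarefree \<open>d \<le> N\<close> already occurs in the expansion at level
    \<open>N\<close>.\<close>
  have inD: "d \<in> D N" if "d \<le> N" "squarefree d" for d N
  proof -
    have "d \<noteq> 0" using that not_squarefree_0 by metis
    then have "p \<le> N" if "p \<in> prime_factors d" for p
      using that \<open>d \<le> N\<close> dvd_imp_le[of p d] by (auto simp: in_prime_factors_iff)
    then show ?thesis using that unfolding D_def by auto
  qed
  have eq: "(\<Prod>p\<in>primes_upto N. (if p \<in> R then 0 else 1) + a p) =
      (\<Sum>d\<in>D N. if R \<subseteq> prime_factors d then \<Prod>p\<in>prime_factors d. a p else 0)"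
    if R: "R \<subseteq> primes_upto N" for N R
  proof -
    have "(\<Prod>p\<in>primes_upto N. (if p \<in> R then 0 else 1) + a p) =
       (\<Prod>p\<in>primes_upto N. a p + (if p \<in> R then 0 else 1))"
      by (intro prod.cong refl) simp
    also have "\<dots> = (\<Sum>X\<in>Pow (primes_upto N). prod a X * (\<Prod>p\<in>primes_upto N - X. if p \<in> R then 0 else 1))"
      by (rule prod_add) simp
    also have "\<dots> = (\<Sum>X\<in>Pow (primes_upto N). if R \<subseteq> X then prod a X else 0)"
    proof (intro sum.cong refl)
      fix X assume "X \<in> Pow (primes_upto N)"
      show "prod a X * (\<Prod>p\<in>primes_upto N - X. if p \<in> R then 0 else 1) = (if R \<subseteq> X then prod a X else 0)"
      proof (cases "R \<subseteq> X")
        case False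
        then obtain p where "p \<in> R" "p \<notin> X" by auto
        then have "(\<Prod>p\<in>primes_upto N - X. if p \<in> R then 0 else 1::real) = 0"
          using R by (intro prod_zero bexI[of _ p]) auto
        then show ?thesis using False by simp
      qed (auto intro!: prod.neutral)
    qed
    also have "\<dots> = (\<Sum>d\<in>D N. if R \<subseteq> prime_factors d then \<Prod>p\<in>prime_factors d. a p else 0)"
      unfolding D_def by (rule sum_squarefree_prime_factors) auto
    finally show ?thesis .
  qed
  let ?A = "suminf (\<lambda>p. if prime p then a p else 0)"
  have part: "(\<Sum>d<N. w d) \<le> (\<Sum>d\<in>D N. w d)" for N
  proof -
    have "(\<Sum>d<N. w d) = (\<Sum>d\<in>{d. d < N \<and> squarefree d}. w d)"
      by (rule sum.mono_neutral_right) (auto simp: w_def)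
    also have "\<dots> \<le> (\<Sum>d\<in>D N. w d)"
      by (rule sum_mono2) (use finD w0 inD in auto)
    finally show ?thesis .
  qed
  \<comment> \<open>Dropping the condition on \<open>Q\<close> only enlarges the sum, which is why
    \<open>eq\<close> is available for any \<open>R\<close>; then \<open>1 + x \<le> exp x\<close>
    bounds the full product.\<close>
  have bound: "(\<Sum>d<N. w d) \<le> exp ?A" for N
  proof -
    have "(\<Sum>d<N. w d) \<le> (\<Sum>d\<in>D N. w d)" by (rule part)
    also have "\<dots> \<le> (\<Sum>d\<in>D N. if {} \<subseteq> prime_factors d then \<Prod>p\<in>prime_factors d. a p else 0)"
      by (rule sum_mono) (auto simp: w_def intro!: prod_nonneg a)
    also have "\<dots> = (\<Prod>p\<in>primes_upto N. 1 + a p)"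
      by (subst eq[symmetric]) auto
    also have "\<dots> \<le> (\<Prod>p\<in>primes_upto N. exp (a p))"
      by (rule prod_mono) (use a in \<open>auto simp: add_nonneg_nonneg\<close>)
    also have "\<dots> = exp (\<Sum>p\<in>primes_upto N. a p)" by (simp add: exp_sum)
    also have "(\<Sum>p\<in>primes_upto N. a p) = (\<Sum>p\<in>primes_upto N. if prime p then a p else 0)"
      by (rule sum.cong) auto
    also have "\<dots> \<le> ?A"
      by (rule sum_le_suminf[OF sm]) (use a in auto)
    finally show ?thesis by simp
  qed
  show sw: "summable w"
    by (rule summableI_nonneg_bounded[OF w0 bound])
  \<comment> \<open>\<open>eq\<close> can be used for \<open>Q\<close> as soon as all primes of
    \<open>Q\<close> are at most \<open>N\<close>.\<close>
  obtain N0 where N0: "\<And>p. p \<in> Q \<Longrightarrow> p \<le> N0"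
    using Q(1) by (meson finite_nat_set_iff_bounded_le)
  have ev: "(\<Sum>d<N. w d) \<le> (\<Prod>p\<in>primes_upto N. (if p \<in> Q then 0 else 1) + a p) \<and>
     (\<Prod>p\<in>primes_upto N. (if p \<in> Q then 0 else 1) + a p) \<le> suminf w" if "N \<ge> N0" for N
  proof -
    have "(\<Prod>p\<in>primes_upto N. (if p \<in> Q then 0 else 1) + a p) = (\<Sum>d\<in>D N. w d)"
      using that N0 Q order_trans[OF N0 that] by (subst eq) (auto simp: w_def D_def intro!: sum.cong)
    moreover have "(\<Sum>d<N. w d) \<le> (\<Sum>d\<in>D N. w d)"
      by (rule part)
    moreover have "(\<Sum>d\<in>D N. w d) \<le> suminf w"
      by (rule sum_le_suminf[OF sw finD]) (use w0 in auto)
    ultimately show ?thesis by simp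
  qed
  show "(\<lambda>N. \<Prod>p\<in>primes_upto N. (if p \<in> Q then 0 else 1) + a p) \<longlonglongrightarrow> suminf w"
  proof (rule tendsto_sandwich)
    show "(\<lambda>N. \<Sum>d<N. w d) \<longlonglongrightarrow> suminf w" by (rule summable_LIMSEQ[OF sw])
    show "(\<lambda>N. suminf w) \<longlonglongrightarrow> suminf w" by simp
  qed (use ev in \<open>auto simp: eventually_at_top_linorder\<close>)
qed

text \<open>Applied with \<open>s = nk\<close>, this keeps \<open>1 - 2/P\<close> and
  \<open>P - 2\<close> positive for \<open>P = p^s\<close>; at \<open>p = 2\<close> with exponent 1
  both would vanish.\<close>

lemma prime_power_ge_4:
  assumes "prime (p::nat)" "s \<ge> 2"
  shows "real p ^ s \<ge> 4"
proof -
  have "(4::real) = 2 ^ 2" by simp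
  also have "\<dots> \<le> real p ^ 2" using prime_ge_2_nat[OF assms(1)] by (intro power_mono) auto
  also have "\<dots> \<le> real p ^ s" using prime_ge_1_nat[OF assms(1)] assms(2) by (intro power_increasing) auto
  finally show ?thesis .
qed

text \<open>The local arithmetic at one prime, with \<open>P = p^(nk)\<close>. The three identities
  are the Euler factors for a lattice point in \<open>p^k L\<close>, for a dual point whose
  denominator is divisible by \<open>p\<close>, and for a dual point whose denominator is
  not.\<close>

lemma local_factor_bounds:
  assumes "(P::real) \<ge> 4"
  shows "0 \<le> 1 - 2 / P" "0 \<le> 1 / (P - 2)" "1 / (P - 2) \<le> 2 / P"
    "0 \<le> 1 / (P * P - 2 * P)" "1 / (P * P - 2 * P) \<le> 1 / P"
    "(1 - 2 / P) * (1 + 1 / (P - 2)) = 1 - 1 / P"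
    "(1 - 2 / P) * (1 / (P * P - 2 * P)) = (1 - 1 / P)\<^sup>2 * (1 / (P - 1)\<^sup>2)"
    "(1 - 2 / P) * (1 + 1 / (P * P - 2 * P)) = (1 - 1 / P)\<^sup>2"
proof -
  have nz: "P \<noteq> 0" "P - 2 \<noteq> 0" "P - 1 \<noteq> 0" using assms by auto
  have e: "1 - 2 / P = (P - 2) / P" "1 - 1 / P = (P - 1) / P" "P * P - 2 * P = P * (P - 2)"
    "1 + 1 / (P - 2) = (P - 1) / (P - 2)"
    "1 + 1 / (P * (P - 2)) = (P - 1)\<^sup>2 / (P * (P - 2))"
    using nz by (auto simp: field_simps power2_eq_square)
  show "0 \<le> 1 - 2 / P" "0 \<le> 1 / (P - 2)" using assms by (auto simp: field_simps)
  show "1 / (P - 2) \<le> 2 / P" using assms by (simp add: field_simps)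
  show "0 \<le> 1 / (P * P - 2 * P)" using assms unfolding e by simp
  show "1 / (P * P - 2 * P) \<le> 1 / P" using assms unfolding e by (intro divide_left_mono) auto
  show "(1 - 2 / P) * (1 + 1 / (P - 2)) = 1 - 1 / P" unfolding e using nz by simp
  show "(1 - 2 / P) * (1 / (P * P - 2 * P)) = (1 - 1 / P)\<^sup>2 * (1 / (P - 1)\<^sup>2)"
    unfolding e using nz by (simp add: power_divide power2_eq_square)
  show "(1 - 2 / P) * (1 + 1 / (P * P - 2 * P)) = (1 - 1 / P)\<^sup>2"
    unfolding e using nz by (simp add: power_divide power2_eq_square)
qed

section \<open>Euler products of xi and zeta\<close>

lemma summable_inverse_power: "s \<ge> 2 \<Longrightarrow> summable (\<lambda>m. 1 / real m ^ s)"
  using inverse_power_summable[of s, where 'a=real] by (simp add: field_simps)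

lemma summable_prime_weight:
  fixes a :: "nat \<Rightarrow> real"
  assumes "s \<ge> 2" "\<And>p. prime p \<Longrightarrow> 0 \<le> a p" "\<And>p. prime p \<Longrightarrow> a p \<le> C / real p ^ s"
  shows "summable (\<lambda>p. if prime p then a p else 0)"
proof (rule summable_comparison_test')
  show "summable (\<lambda>m. \<bar>C\<bar> * (1 / real m ^ s))"
    by (intro summable_mult summable_inverse_power assms)
  fix p :: nat
  show "norm (if prime p then a p else 0) \<le> \<bar>C\<bar> * (1 / real p ^ s)" if "p \<ge> 0"
  proof (cases "prime p")
    case True
    have "C / real p ^ s \<le> \<bar>C\<bar> / real p ^ s" by (intro divide_right_mono) auto
    then show ?thesis using True assms(2,3)[of p] by simp
  qed simp
qed

lemma xi_euler_product:
  assumes "s \<ge> 2"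
  shows "(\<lambda>N. \<Prod>p\<in>primes_upto N. 1 - 2 / real p ^ s) \<longlonglongrightarrow> xi (real s)"
proof -
  let ?z = "\<lambda>p. if prime p then - (2 / real p ^ s) else 0"
  have "convergent_prod (\<lambda>p. 1 + ?z p)"
  proof (rule summable_imp_convergent_prod_real)
    have "summable (\<lambda>p. if prime p then 2 / real p ^ s else 0)"
      by (rule summable_prime_weight[OF assms, where C = 2]) auto
    then show "summable (\<lambda>p. \<bar>?z p\<bar>)" by (rule back_subst[of summable]) auto
    \<comment> \<open>The criterion also asks that no factor be 0, that is
      \<open>P \<noteq> 2\<close>, which \<open>P \<ge> 4\<close> gives.\<close>
    show "?z p \<noteq> - 1" for p
      using prime_power_ge_4[of p s] assms by (auto simp: field_simps)
  qed
  then have "(\<lambda>N. \<Prod>p\<le>N. 1 + ?z p) \<longlonglongrightarrow> prodinf (\<lambda>p. 1 + ?z p)"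
    by (rule convergent_prod_LIMSEQ)
  moreover have "(\<Prod>p\<le>N. 1 + ?z p) = (\<Prod>p\<in>primes_upto N. 1 - 2 / real p ^ s)" for N
  proof -
    have "(\<Prod>p\<in>primes_upto N. 1 - 2 / real p ^ s) = (\<Prod>p\<in>primes_upto N. 1 + ?z p)"
      by (rule prod.cong) auto
    also have "\<dots> = (\<Prod>p\<le>N. 1 + ?z p)" by (rule prod.mono_neutral_left) auto
    finally show ?thesis by simp
  qed
  moreover have "prodinf (\<lambda>p. 1 + ?z p) = xi (real s)"
    unfolding xi_def by (rule arg_cong[of _ _ prodinf]) (auto simp: fun_eq_iff powr_realpow prime_gt_0_nat)
  ultimately show ?thesis by simp
qed

lemma xi_nonneg:
  assumes "s \<ge> 2"
  shows "xi (real s) \<ge> 0"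
  using xi_euler_product[OF assms]
proof (rule LIMSEQ_le_const)
  show "\<exists>N0. \<forall>N\<ge>N0. 0 \<le> (\<Prod>p\<in>primes_upto N. 1 - 2 / real p ^ s)"
  proof (intro exI allI impI prod_nonneg)
    fix N p assume "p \<in> primes_upto N"
    then have "real p ^ s \<ge> 4" using prime_power_ge_4 assms by auto
    then show "0 \<le> 1 - 2 / real p ^ s" by (rule local_factor_bounds)
  qed
qed

text \<open>The sieve of Eratosthenes on the Dirichlet series: among the \<open>m\<close> prime to
  \<open>S\<close>, those divisible by a further prime \<open>q\<close> are the \<open>q m'\<close>
  with \<open>m'\<close> again prime to \<open>S\<close>, and they contribute \<open>1/q^s\<close>
  times the current sum.\<close>

lemma zeta_coprime_part:
  assumes "s \<ge> 2" "finite S" "\<And>p. p \<in> S \<Longrightarrow> prime p"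
  shows "(\<lambda>m. if \<forall>p\<in>S. \<not> p dvd m then 1 / real m ^ s else 0) sums
           ((\<Prod>p\<in>S. 1 - 1 / real p ^ s) * (\<Sum>m. 1 / real m ^ s))"
  using assms(2,3)
proof (induction S)
  case empty
  show ?case using summable_inverse_power[OF assms(1)] by (simp add: summable_sums)
next
  case (insert q S)
  define u where "u m = (if \<forall>p\<in>S. \<not> p dvd m then 1 / real m ^ s else 0)" for m
  let ?Z = "(\<Prod>p\<in>S. 1 - 1 / real p ^ s) * (\<Sum>m. 1 / real m ^ s)"
  have IH: "u sums ?Z" unfolding u_def using insert by simp
  have q: "prime q" "q > 0" using insert prime_gt_0_nat by auto
  have uq: "u (q * m) = 1 / real q ^ s * u m" for m
  proof -
    have "p dvd q * m \<longleftrightarrow> p dvd m" if "p \<in> S" for p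
      using that insert by (metis insertI1 insertI2 prime_dvd_mult_iff primes_dvd_imp_eq)
    then show ?thesis unfolding u_def by (auto simp: power_mult_distrib)
  qed
  have "(\<lambda>m. u (q * m)) sums (1 / real q ^ s * ?Z)"
    unfolding uq by (rule sums_mult[OF IH])
  then have "(\<lambda>m. (if q dvd m then u m else 0)) sums (1 / real q ^ s * ?Z)"
    using q by (subst sums_mono_reindex[of "\<lambda>m. q * m", symmetric])
      (auto simp: strict_mono_def elim!: dvdE)
  from sums_diff[OF IH this]
  have "(\<lambda>m. u m - (if q dvd m then u m else 0)) sums ((1 - 1 / real q ^ s) * ?Z)"
    by (simp add: algebra_simps)
  moreover have "u m - (if q dvd m then u m else 0) =
     (if \<forall>p\<in>insert q S. \<not> p dvd m then 1 / real m ^ s else 0)" for m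
    unfolding u_def by auto
  ultimately show ?case using insert by (simp add: mult.assoc)
qed

text \<open>After sieving by the primes up to \<open>N\<close>, only \<open>m = 1\<close> and some
  \<open>m > N\<close> survive, so the product times the zeta sum lies between 1 and 1 plus a
  tail.\<close>

lemma inverse_zeta_euler_product:
  assumes "s \<ge> 2"
  shows "(\<lambda>N. \<Prod>p\<in>primes_upto N. 1 - 1 / real p ^ s) \<longlonglongrightarrow> 1 / zeta (real s)"
    and "zeta (real s) > 0"
proof -
  let ?Z = "\<Sum>m. 1 / real m ^ s"
  note sm = summable_inverse_power[OF assms]
  have zeta: "zeta (real s) = ?Z"
  proof -
    \<comment> \<open>\<open>?Z\<close> starts at \<open>m = 0\<close>, where the term is
      \<open>1 / 0 = 0\<close>, so it agrees with the series of \<open>zeta\<close>, which starts at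
      1.\<close>
    have "?Z = (\<Sum>m. 1 / real (Suc m) ^ s) + 1 / real 0 ^ s"
      using suminf_split_initial_segment[OF sm, of 1] by simp
    then show ?thesis using assms unfolding zeta_def by (simp add: powr_realpow)
  qed
  have "1 / real 1 ^ s \<le> ?Z"
    using sum_le_suminf[OF sm, of "{1}"] by auto
  then have Z: "?Z > 0" by simp
  then show "zeta (real s) > 0" using zeta by simp
  define T where "T N = (\<Sum>m. 1 / real (m + Suc N) ^ s)" for N
  have T0: "T \<longlonglongrightarrow> 0"
  proof -
    have "(\<lambda>N. ?Z - (\<Sum>m<N. 1 / real m ^ s)) \<longlonglongrightarrow> ?Z - ?Z"
      by (intro tendsto_intros summable_LIMSEQ sm)
    then have "(\<lambda>N. ?Z - (\<Sum>m<Suc N. 1 / real m ^ s)) \<longlonglongrightarrow> ?Z - ?Z"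
      by (rule LIMSEQ_Suc)
    moreover have "T = (\<lambda>N. ?Z - (\<Sum>m<Suc N. 1 / real m ^ s))"
      unfolding T_def fun_eq_iff using suminf_split_initial_segment[OF sm, of "Suc N" for N]
      by (metis add_diff_cancel_right')
    ultimately show ?thesis by simp
  qed
  have bnd: "1 \<le> (\<Prod>p\<in>primes_upto N. 1 - 1 / real p ^ s) * ?Z \<and>
      (\<Prod>p\<in>primes_upto N. 1 - 1 / real p ^ s) * ?Z \<le> 1 + T N" if "N \<ge> 1" for N
  proof -
    define u where "u m = (if \<forall>p\<in>primes_upto N. \<not> p dvd m then 1 / real m ^ s else 0)" for m
    have u: "u sums ((\<Prod>p\<in>primes_upto N. 1 - 1 / real p ^ s) * ?Z)"
      unfolding u_def by (rule zeta_coprime_part[OF assms]) auto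
    have u0: "u m \<ge> 0" for m unfolding u_def by auto
    have u1: "u 1 = 1" unfolding u_def by auto
    have uz: "u m = 0" if m: "m \<le> N" "m \<noteq> 1" for m
    proof (cases "m = 0")
      case True then show ?thesis using assms by (simp add: u_def)
    next
      case False
      obtain p where p: "prime p" "p dvd m" using m prime_factor_nat by blast
      then have "p \<le> N" using False m dvd_imp_le[of p m] by linarith
      then show ?thesis using p unfolding u_def by auto
    qed
    have "u 1 \<le> suminf u"
      using sum_le_suminf[OF sums_summable[OF u], of "{1}"] u0 by auto
    moreover have "suminf u = (\<Sum>m. u (m + Suc N)) + (\<Sum>m<Suc N. u m)"
      by (rule suminf_split_initial_segment[OF sums_summable[OF u]])
    moreover have "(\<Sum>m<Suc N. u m) = (\<Sum>m\<in>{1}. u m)"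
      using that by (intro sum.mono_neutral_right) (auto simp: uz)
    moreover have "(\<Sum>m. u (m + Suc N)) \<le> T N"
      unfolding T_def
      by (intro suminf_le summable_ignore_initial_segment sm sums_summable[OF u])
         (auto simp: u_def)
    ultimately show ?thesis using sums_unique[OF u] u1 by simp
  qed
  have "(\<lambda>N. (\<Prod>p\<in>primes_upto N. 1 - 1 / real p ^ s) * ?Z) \<longlonglongrightarrow> 1"
  proof (rule tendsto_sandwich[of "\<lambda>N. 1" _ _ "\<lambda>N. 1 + T N"])
    show "(\<lambda>N. 1 + T N) \<longlonglongrightarrow> 1" using tendsto_add[OF tendsto_const T0, of 1] by simp
    show "(\<lambda>N. 1) \<longlonglongrightarrow> (1::real)" by simp
  qed (use bnd in \<open>auto simp: eventually_at_top_linorder\<close>)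
  from tendsto_divide[OF this tendsto_const, of ?Z] Z
  show "(\<lambda>N. \<Prod>p\<in>primes_upto N. 1 - 1 / real p ^ s) \<longlonglongrightarrow> 1 / zeta (real s)"
    by (simp add: zeta)
qed

text \<open>The density side, with \<open>Q\<close> the primes \<open>p\<close> for which
  \<open>l\<close> lies in \<open>p^k L\<close>; for \<open>l = 0\<close> these are all primes, so
  \<open>Q\<close> may be infinite. Setting the local weight to 0 off \<open>Q\<close> absorbs the
  condition on the prime factors, since a product with a prime outside \<open>Q\<close>
  vanishes.\<close>

lemma xi_times_squarefree_sum:
  fixes Q :: "nat set"
  assumes s: "s \<ge> 2"
  defines "w \<equiv> \<lambda>d::nat. if squarefree d \<and> prime_factors d \<subseteq> Q
             then \<Prod>p\<in>prime_factors d. 1 / (real p ^ s - 2) else 0"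
  shows "summable w"
    and "(\<lambda>N. \<Prod>p\<in>primes_upto N. 1 - (if p \<in> Q then 1 else 2) / real p ^ s)
           \<longlonglongrightarrow> xi (real s) * suminf w"
proof -
  define a where "a p = (if p \<in> Q then 1 / (real p ^ s - 2) else 0)" for p :: nat
  have ab: "0 \<le> a p \<and> a p \<le> 2 / real p ^ s" if "prime p" for p
    using local_factor_bounds(2,3)[OF prime_power_ge_4[OF that s]] unfolding a_def by auto
  have sm: "summable (\<lambda>p. if prime p then a p else 0)"
    by (rule summable_prime_weight[OF s, where C = 2]) (use ab in auto)
  have a0: "\<And>p. prime p \<Longrightarrow> 0 \<le> a p" using ab by auto
  have w: "w = (\<lambda>d. if squarefree d \<and> {} \<subseteq> prime_factors d then \<Prod>p\<in>prime_factors d. a p else 0)"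
  proof (rule ext)
    fix d
    show "w d = (if squarefree d \<and> {} \<subseteq> prime_factors d then \<Prod>p\<in>prime_factors d. a p else 0)"
    proof (cases "prime_factors d \<subseteq> Q")
      case True
      then show ?thesis unfolding w_def by (auto simp: a_def intro!: prod.cong)
    next
      case False
      then show ?thesis unfolding w_def by (auto simp: a_def prod_zero_iff)
    qed
  qed
  show "summable w" unfolding w
    by (rule euler_product_squarefree(1)[OF _ sm]) (use a0 in auto)
  have "(\<lambda>N. \<Prod>p\<in>primes_upto N. (if p \<in> {} then 0 else 1) + a p) \<longlonglongrightarrow> suminf w"
    unfolding w by (rule euler_product_squarefree(2)[OF _ sm]) (use a0 in auto)
  from tendsto_mult[OF xi_euler_product[OF s] this]
  have "(\<lambda>N. \<Prod>p\<in>primes_upto N. (1 - 2 / real p ^ s) * (1 + a p)) \<longlonglongrightarrow> xi (real s) * suminf w"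
    by (simp add: prod.distrib)
  moreover have "(\<Prod>p\<in>primes_upto N. (1 - 2 / real p ^ s) * (1 + a p)) =
      (\<Prod>p\<in>primes_upto N. 1 - (if p \<in> Q then 1 else 2) / real p ^ s)" for N
  proof (intro prod.cong refl)
    fix p assume "p \<in> primes_upto N"
    then have "real p ^ s \<ge> 4" using prime_power_ge_4 s by auto
    then show "(1 - 2 / real p ^ s) * (1 + a p) = 1 - (if p \<in> Q then 1 else 2) / real p ^ s"
      unfolding a_def using local_factor_bounds(6)[of "real p ^ s"] by auto
  qed
  ultimately show "(\<lambda>N. \<Prod>p\<in>primes_upto N. 1 - (if p \<in> Q then 1 else 2) / real p ^ s)
           \<longlonglongrightarrow> xi (real s) * suminf w" by simp
qed

text \<open>The intensity side: \<open>Q\<close> is the set of primes of a denominator, which must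
  all divide \<open>d\<close>. Every local factor contains \<open>(1 - 1/P)^2\<close>, whose product
  is \<open>1 / zeta^2\<close>; only the primes of \<open>Q\<close> leave a further factor
  \<open>1 / (P - 1)^2\<close>.\<close>

lemma xi_times_squarefree_sum_dual:
  assumes s: "s \<ge> 2" and Q: "finite Q" "\<And>p. p \<in> Q \<Longrightarrow> prime p"
  defines "w \<equiv> \<lambda>d::nat. if squarefree d \<and> Q \<subseteq> prime_factors d
             then \<Prod>p\<in>prime_factors d. 1 / (real p ^ (2 * s) - 2 * real p ^ s) else 0"
  shows "summable w"
    and "xi (real s) * suminf w = 1 / (zeta (real s))\<^sup>2 * (\<Prod>p\<in>Q. 1 / (real p ^ s - 1)\<^sup>2)"
proof -
  define a where "a p = 1 / (real p ^ (2 * s) - 2 * real p ^ s)" for p :: nat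
  have P2: "real p ^ (2 * s) = real p ^ s * real p ^ s" for p
    by (simp add: mult_2 power_add)
  have ab: "0 \<le> a p \<and> a p \<le> 1 / real p ^ s" if "prime p" for p
    using local_factor_bounds(4,5)[OF prime_power_ge_4[OF that s]] unfolding a_def P2 by auto
  have sm: "summable (\<lambda>p. if prime p then a p else 0)"
    by (rule summable_prime_weight[OF s, where C = 1]) (use ab in auto)
  have a0: "\<And>p. prime p \<Longrightarrow> 0 \<le> a p" using ab by auto
  have w: "w = (\<lambda>d. if squarefree d \<and> Q \<subseteq> prime_factors d then \<Prod>p\<in>prime_factors d. a p else 0)"
    unfolding w_def a_def ..
  show "summable w" unfolding w
    by (rule euler_product_squarefree(1)[OF _ sm]) (use a0 Q in auto)
  have "(\<lambda>N. \<Prod>p\<in>primes_upto N. (if p \<in> Q then 0 else 1) + a p) \<longlonglongrightarrow> suminf w"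
    unfolding w by (rule euler_product_squarefree(2)[OF _ sm]) (use a0 Q in auto)
  from tendsto_mult[OF xi_euler_product[OF s] this]
  have 1: "(\<lambda>N. \<Prod>p\<in>primes_upto N. (1 - 2 / real p ^ s) * ((if p \<in> Q then 0 else 1) + a p))
     \<longlonglongrightarrow> xi (real s) * suminf w"
    by (simp add: prod.distrib)
  let ?b = "\<lambda>p::nat. if p \<in> Q then 1 / (real p ^ s - 1)\<^sup>2 else 1"
  have eq: "(\<Prod>p\<in>primes_upto N. (1 - 2 / real p ^ s) * ((if p \<in> Q then 0 else 1) + a p)) =
      (\<Prod>p\<in>primes_upto N. (1 - 1 / real p ^ s))\<^sup>2 * (\<Prod>p\<in>primes_upto N. ?b p)" for N
  proof -
    have "(\<Prod>p\<in>primes_upto N. (1 - 2 / real p ^ s) * ((if p \<in> Q then 0 else 1) + a p)) =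
      (\<Prod>p\<in>primes_upto N. (1 - 1 / real p ^ s)\<^sup>2 * ?b p)"
    proof (intro prod.cong refl)
      fix p assume "p \<in> primes_upto N"
      then have P: "real p ^ s \<ge> 4" using prime_power_ge_4 s by auto
      show "(1 - 2 / real p ^ s) * ((if p \<in> Q then 0 else 1) + a p) = (1 - 1 / real p ^ s)\<^sup>2 * ?b p"
        using local_factor_bounds(7,8)[OF P] unfolding a_def P2 by simp
    qed
    then show ?thesis by (simp add: prod.distrib prod_power_distrib)
  qed
  \<comment> \<open>From \<open>N0\<close> on the product of the further factors is constant and
    equals the product over \<open>Q\<close>.\<close>
  obtain N0 where N0: "\<And>p. p \<in> Q \<Longrightarrow> p \<le> N0"
    using Q(1) by (meson finite_nat_set_iff_bounded_le)
  have "(\<Prod>p\<in>primes_upto N. ?b p) = (\<Prod>p\<in>Q. 1 / (real p ^ s - 1)\<^sup>2)" if "N \<ge> N0" for N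
  proof -
    have "(\<Prod>p\<in>Q. 1 / (real p ^ s - 1)\<^sup>2) = (\<Prod>p\<in>Q. ?b p)" by simp
    also have "\<dots> = (\<Prod>p\<in>primes_upto N. ?b p)"
      using N0 that Q order_trans[OF N0 that] by (intro prod.mono_neutral_left) auto
    finally show ?thesis by simp
  qed
  then have "(\<lambda>N. \<Prod>p\<in>primes_upto N. ?b p) \<longlonglongrightarrow> (\<Prod>p\<in>Q. 1 / (real p ^ s - 1)\<^sup>2)"
    by (intro tendsto_eventually) (auto simp: eventually_at_top_linorder)
  from tendsto_mult[OF tendsto_power[OF inverse_zeta_euler_product(1)[OF s], of 2] this]
  have 2: "(\<lambda>N. (\<Prod>p\<in>primes_upto N. (1 - 1 / real p ^ s))\<^sup>2 * (\<Prod>p\<in>primes_upto N. ?b p))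
     \<longlonglongrightarrow> (1 / zeta (real s))\<^sup>2 * (\<Prod>p\<in>Q. 1 / (real p ^ s - 1)\<^sup>2)" .
  show "xi (real s) * suminf w = 1 / (zeta (real s))\<^sup>2 * (\<Prod>p\<in>Q. 1 / (real p ^ s - 1)\<^sup>2)"
    using LIMSEQ_unique[OF 1[unfolded eq] 2] by (simp add: power_divide)
qed

section \<open>Counting lattice points\<close>

abbreviation ivec :: "int^'n \<Rightarrow> real^'n" where
  "ivec z \<equiv> (\<chi> i. of_int (z $ i))"

text \<open>Half open, so that the integer translates partition the space; centred, so that 0 is
  interior and the same cell can carry the Fejer kernel as an approximate identity at 0.\<close>

definition half_cube :: "(real^'n) set" where
  "half_cube = {x. \<forall>i. - 1/2 \<le> x $ i \<and> x $ i < 1/2}"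

lemma half_cube_between:
  "box (\<chi> i. - 1/2) (\<chi> i. 1/2) \<subseteq> (half_cube :: (real^'n) set)"
  "half_cube \<subseteq> cbox (\<chi> i. - 1/2) ((\<chi> i. 1/2) :: real^'n)"
  unfolding half_cube_def by (auto simp: mem_box_cart less_imp_le)

lemma half_cube_borel [measurable]: "(half_cube :: (real^'n) set) \<in> sets borel"
proof -
  have "(half_cube :: (real^'n) set) = (\<Inter>i. {x. - 1/2 \<le> x $ i} \<inter> {x. x $ i < 1/2})"
    unfolding half_cube_def by auto
  moreover have "{x :: real^'n. - 1/2 \<le> x $ i} \<in> sets borel" for i
    by (intro borel_closed closed_halfspace_component_ge_cart)
  moreover have "{x :: real^'n. x $ i < 1/2} \<in> sets borel" for i
    by (intro borel_open open_halfspace_component_lt_cart)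
  ultimately have "(\<Inter>i. {x :: real^'n. - 1/2 \<le> x $ i} \<inter> {x. x $ i < 1/2}) \<in> sets borel"
    by (intro sets.finite_INT sets.Int) auto
  then show ?thesis by (simp only: \<open>half_cube = _\<close>)
qed

lemma emeasure_half_cube [simp]: "emeasure lborel (half_cube :: (real^'n) set) = 1"
proof -
  have e: "((\<chi> i. 1/2) - (\<chi> i. - 1/2) :: real^'n) = 1" by (auto simp: vec_eq_iff)
  have pr: "prod ((\<bullet>) ((\<chi> i. 1/2) - (\<chi> i. - 1/2) :: real^'n)) Basis = 1"
    unfolding e by (rule prod.neutral) (auto simp: Basis_vec_def inner_axis)
  have le: "(\<chi> i. - 1/2 :: real^'n) \<bullet> b \<le> (\<chi> i. 1/2) \<bullet> b" if "b \<in> Basis" for b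
    using that by (auto simp: Basis_vec_def inner_axis)
  have "emeasure lborel (half_cube :: (real^'n) set) \<le> emeasure lborel (cbox (\<chi> i. - 1/2) ((\<chi> i. 1/2) :: real^'n))"
    by (intro emeasure_mono half_cube_between) auto
  moreover have "emeasure lborel (box (\<chi> i. - 1/2) ((\<chi> i. 1/2) :: real^'n)) \<le> emeasure lborel (half_cube :: (real^'n) set)"
    by (intro emeasure_mono half_cube_between) auto
  moreover have "emeasure lborel (cbox (\<chi> i. - 1/2) ((\<chi> i. 1/2) :: real^'n)) = 1"
    by (simp only: emeasure_lborel_cbox[OF le] pr ennreal_1)
  moreover have "emeasure lborel (box (\<chi> i. - 1/2) ((\<chi> i. 1/2) :: real^'n)) = 1"
    by (simp only: emeasure_lborel_box[OF le] pr ennreal_1)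
  ultimately show ?thesis by simp
qed

lemma half_cube_lmeasurable: "(half_cube :: (real^'n) set) \<in> lmeasurable"
  by (intro fmeasurableI) (auto simp: emeasure_completion)

lemma bounded_half_cube: "bounded (half_cube :: (real^'n) set)"
  using bounded_cbox half_cube_between(2) bounded_subset by blast

lemma half_cube_tiling: "\<exists>z. (x :: real^'n) - ivec z \<in> half_cube"
proof (rule exI[of _ "\<chi> i. \<lfloor>x $ i + 1/2\<rfloor>"])
  have "- 1/2 \<le> x $ i - of_int \<lfloor>x $ i + 1/2\<rfloor> \<and> x $ i - of_int \<lfloor>x $ i + 1/2\<rfloor> < 1/2" for i
    by linarith
  then show "x - ivec (\<chi> i. \<lfloor>x $ i + 1/2\<rfloor>) \<in> half_cube"
    unfolding half_cube_def by simp
qed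

lemma half_cube_tiling_unique:
  assumes "(x :: real^'n) - ivec z \<in> half_cube" "x - ivec z' \<in> half_cube"
  shows "z = z'"
proof -
  have "z $ i = z' $ i" for i
  proof -
    have "- 1/2 \<le> x $ i - of_int (z $ i)" "x $ i - of_int (z $ i) < 1/2"
      "- 1/2 \<le> x $ i - of_int (z' $ i)" "x $ i - of_int (z' $ i) < 1/2"
      using assms unfolding half_cube_def by auto
    then show ?thesis by linarith
  qed
  then show ?thesis by (simp add: vec_eq_iff)
qed

lemma invertible_vec_inj:
  assumes "invertible (A :: real^'n^'n)" "A *v x = A *v y"
  shows "x = y"
  using matrix_inv_mult_vec(1)[OF assms(1)] assms(2) by metis

lemma lattice_basis_det_pos: "lattice_basis A L \<Longrightarrow> \<bar>det A\<bar> > 0"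
  unfolding lattice_basis_def by (simp add: invertible_det_nz)

text \<open>Gauss's volume argument: the translates of \<open>A\<close> times the unit cell by
  lattice points have volume \<open>|det A|\<close>, are disjoint and cover the space. Those
  attached to points of a ball of radius \<open>r\<close> lie in the ball of radius
  \<open>r + D\<close> and cover the ball of radius \<open>r - D\<close>, where \<open>D\<close>
  bounds the norms in the cell. Hence \<open>D\<close> is the same for all centres.\<close>

lemma lattice_point_count:
  fixes L :: "(real^'n) set"
  assumes "lattice_basis A L"
  obtains D where "D > 0"
    "\<And>x r. finite (L \<inter> ball x r)"
    "\<And>x r. r \<ge> 0 \<Longrightarrow> card (L \<inter> ball x r) * \<bar>det A\<bar> \<le> unit_ball_vol CARD('n) * (r + D) ^ CARD('n)"
    "\<And>x r. r \<ge> D \<Longrightarrow> unit_ball_vol CARD('n) * (r - D) ^ CARD('n) \<le> card (L \<inter> ball x r) * \<bar>det A\<bar>"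
proof -
  have inv: "invertible A" and L: "L = range (\<lambda>z. A *v ivec z)"
    using assms by (auto simp: lattice_basis_def)
  define F where "F = (*v) A ` half_cube"
  have "bounded F"
    unfolding F_def by (intro bounded_linear_image bounded_half_cube matrix_vector_mul_bounded_linear)
  then obtain D where D: "D > 0" "\<And>x. x \<in> F \<Longrightarrow> norm x \<le> D"
    by (auto simp: bounded_pos)
  have Fm: "F \<in> lmeasurable" unfolding F_def
    using lebesgue_matrix_image half_cube_lmeasurable by blast
  have mF: "measure lebesgue F = \<bar>det A\<bar>"
  proof -
    have "measure lebesgue (half_cube :: (real^'n) set) = 1"
      by (simp add: measure_completion) (simp add: measure_def)
    moreover have "measure lebesgue F = \<bar>det A\<bar> * measure lebesgue (half_cube :: (real^'n) set)"
      using lebesgue_matrix_image half_cube_lmeasurable unfolding F_def by blast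
    ultimately show ?thesis by (simp only: mult_1_right)
  qed
  have Tm: "(+) p ` F \<in> lmeasurable" for p
    using Fm by (rule measurable_translation)
  have disj: "disjoint_family_on (\<lambda>p. (+) p ` F) L"
    unfolding disjoint_family_on_def
  proof (intro ballI impI equals0I)
    fix p q x assume pq: "p \<in> L" "q \<in> L" "p \<noteq> q" and x: "x \<in> (+) p ` F \<inter> (+) q ` F"
    obtain z z' where z: "p = A *v ivec z" "q = A *v ivec z'" using pq L by auto
    obtain u u' where u: "u \<in> half_cube" "u' \<in> half_cube" "x = p + A *v u" "x = q + A *v u'"
      using x unfolding F_def by auto
    have "matrix_inv A *v x = ivec z + u" "matrix_inv A *v x = ivec z' + u'"
      by (simp_all add: u(3) z matrix_vector_right_distrib matrix_inv_mult_vec[OF inv])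
         (metis matrix_inv_mult_vec(1)[OF inv] matrix_vector_right_distrib u(3,4) z)
    then have eq: "ivec z + u = ivec z' + u'" by simp
    have "(ivec z + u) - ivec z \<in> half_cube" using u(1) by simp
    moreover have "(ivec z + u) - ivec z' \<in> half_cube" unfolding eq using u(2) by simp
    ultimately have "z = z'" by (rule half_cube_tiling_unique)
    then show False using pq z by simp
  qed
  have meas: "measure lebesgue (\<Union>p\<in>X. (+) p ` F) = card X * \<bar>det A\<bar>"
     "(\<Union>p\<in>X. (+) p ` F) \<in> lmeasurable" if X: "finite X" "X \<subseteq> L" for X
  proof -
    have "measure lebesgue (\<Union>p\<in>X. (+) p ` F) = (\<Sum>p\<in>X. measure lebesgue ((+) p ` F))"
    proof (rule measure_finite_Union)
      show "emeasure lebesgue ((+) p ` F) \<noteq> \<infinity>" for p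
        unfolding infinity_ennreal_def by (rule fmeasurableD2[OF Tm])
    qed (use X fmeasurableD[OF Tm] disjoint_family_on_mono[OF X(2) disj] in auto)
    then show "measure lebesgue (\<Union>p\<in>X. (+) p ` F) = card X * \<bar>det A\<bar>"
      by (simp add: measure_translation mF)
    show "(\<Union>p\<in>X. (+) p ` F) \<in> lmeasurable"
      using X Tm by (intro fmeasurable.finite_UN) auto
  qed
  have ballm: "measure lebesgue (ball x r) = unit_ball_vol CARD('n) * r ^ CARD('n)" if "r \<ge> 0" for x :: "real^'n" and r
    using content_ball[OF that, of x] by (simp add: measure_completion)
  \<comment> \<open>Stated for finite \<open>X\<close>, because the finiteness of
    \<open>L \<inter> ball x r\<close> is itself drawn from this bound on its finite
    subsets.\<close>
  have upper: "card X * \<bar>det A\<bar> \<le> unit_ball_vol CARD('n) * (r + D) ^ CARD('n)"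
    if X: "finite X" "X \<subseteq> L \<inter> ball x r" and "r \<ge> 0" for X x r
  proof -
    have "(\<Union>p\<in>X. (+) p ` F) \<subseteq> ball x (r + D)"
    proof (intro UN_least image_subsetI)
      fix p u assume "p \<in> X" "u \<in> F"
      then have "dist x p < r" "norm u \<le> D" using X D by auto
      then show "p + u \<in> ball x (r + D)"
        using dist_triangle[of x "p + u" p] by (simp add: dist_norm)
    qed
    then have "measure lebesgue (\<Union>p\<in>X. (+) p ` F) \<le> measure lebesgue (ball x (r + D))"
      using meas X by (intro measure_mono_fmeasurable) (auto simp: fmeasurableD)
    then show ?thesis using meas(1)[of X] X ballm[of "r + D" x] \<open>r \<ge> 0\<close> D by simp
  qed
  have det: "\<bar>det A\<bar> > 0" using assms by (rule lattice_basis_det_pos)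
  have fin0: "finite (L \<inter> ball x r)" if "r \<ge> 0" for x r
  proof (rule finite_if_finite_subsets_card_bdd[THEN conjunct1])
    fix G assume G: "G \<subseteq> L \<inter> ball x r" "finite G"
    then have "real (card G) \<le> unit_ball_vol CARD('n) * (r + D) ^ CARD('n) / \<bar>det A\<bar>"
      using upper[of G x r] that det by (simp add: field_simps)
    then show "card G \<le> nat \<lceil>unit_ball_vol CARD('n) * (r + D) ^ CARD('n) / \<bar>det A\<bar>\<rceil>"
      by linarith
  qed
  have fin: "finite (L \<inter> ball x r)" for x r
    using fin0[of r x] by (cases "r \<ge> 0") (auto simp: ball_empty)
  have lower: "unit_ball_vol CARD('n) * (r - D) ^ CARD('n) \<le> card (L \<inter> ball x r) * \<bar>det A\<bar>"
    if "r \<ge> D" for x r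
  proof -
    have "ball x (r - D) \<subseteq> (\<Union>p\<in>L \<inter> ball x r. (+) p ` F)"
    proof
      fix y assume y: "y \<in> ball x (r - D)"
      obtain z where z: "matrix_inv A *v y - ivec z \<in> half_cube" using half_cube_tiling by blast
      define p where "p = A *v ivec z"
      have "y - p = A *v (matrix_inv A *v y - ivec z)"
        by (simp add: p_def matrix_vector_mult_diff_distrib matrix_inv_mult_vec[OF inv])
      then have F: "y - p \<in> F" unfolding F_def using z by blast
      then have "norm (y - p) \<le> D" using D by auto
      then have "dist x p < r" using y dist_triangle[of x p y] by (auto simp: dist_norm)
      moreover have "p \<in> L" unfolding L p_def by auto
      ultimately show "y \<in> (\<Union>p\<in>L \<inter> ball x r. (+) p ` F)"
        using F by (intro UN_I[of p]) (auto simp: image_iff intro!: bexI[of _ "y - p"])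
    qed
    then have "measure lebesgue (ball x (r - D)) \<le> measure lebesgue (\<Union>p\<in>L \<inter> ball x r. (+) p ` F)"
      using meas(2)[OF fin] by (intro measure_mono_fmeasurable) auto
    then show ?thesis using meas(1)[OF fin, of x r] ballm[of "r - D" x] that by simp
  qed
  show thesis
    by (rule that[OF D(1) fin upper[OF fin subset_refl] lower])
qed

section \<open>Scaled lattices and dual lattices\<close>

lemma lattice_basis_scaleR:
  assumes "lattice_basis A L" "t \<noteq> 0"
  shows "lattice_basis (t *\<^sub>R A) ((\<lambda>x. t *\<^sub>R x) ` L)"
    and "\<bar>det (t *\<^sub>R A)\<bar> = \<bar>t\<bar> ^ CARD('n) * \<bar>det (A :: real^'n^'n)\<bar>"
proof -
  have d: "det (t *\<^sub>R A) = t ^ CARD('n) * det A"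
    by (simp add: det_def prod.distrib sum_distrib_left algebra_simps)
  show "\<bar>det (t *\<^sub>R A)\<bar> = \<bar>t\<bar> ^ CARD('n) * \<bar>det A\<bar>"
    by (simp add: d abs_mult power_abs)
  have L: "L = range (\<lambda>z. A *v ivec z)" using assms by (auto simp: lattice_basis_def)
  have "(\<lambda>x. t *\<^sub>R x) ` L = range (\<lambda>z. (t *\<^sub>R A) *v ivec z)"
    unfolding L by (simp add: image_image scaleR_matrix_vector_assoc)
  moreover have "invertible (t *\<^sub>R A)"
    using assms d by (auto simp: lattice_basis_def invertible_det_nz)
  ultimately show "lattice_basis (t *\<^sub>R A) ((\<lambda>x. t *\<^sub>R x) ` L)"
    by (simp add: lattice_basis_def)
qed

text \<open>Pairing \<open>y\<close> with the columns of \<open>A\<close> shows that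
  \<open>y\<close> is dual to \<open>L\<close> exactly if \<open>transpose A *v y\<close> is an
  integer vector; solving for \<open>y\<close> gives the inverse transpose as basis.\<close>

lemma lattice_basis_dual:
  fixes A :: "real^'n^'n"
  assumes "lattice_basis A L"
  shows "lattice_basis (transpose (matrix_inv A)) (dual_lattice L)"
proof -
  have inv: "invertible A" and L: "L = range (\<lambda>z. A *v ivec z)"
    using assms by (auto simp: lattice_basis_def)
  have "invertible (matrix_inv A)" using matrix_inv_mult[OF inv] by (auto simp: invertible_def)
  then have inv': "invertible (transpose (matrix_inv A))" 
    by (metis det_transpose invertible_det_nz)
  have "dual_lattice L = range (\<lambda>z. transpose (matrix_inv A) *v ivec z)"
  proof (intro equalityI subsetI)
    fix y assume "y \<in> dual_lattice L"
    then have y: "y \<bullet> (A *v ivec z) \<in> \<int>" for z unfolding dual_lattice_def L by blast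
    define w where "w = transpose A *v y"
    have "w $ i \<in> \<int>" for i
    proof -
      have "ivec ((\<chi> j. if j = i then 1 else 0) :: int^'n) = (axis i 1 :: real^'n)"
        by (auto simp: vec_eq_iff axis_def)
      then have "y \<bullet> (A *v axis i 1) \<in> \<int>" using y by metis
      then have "w \<bullet> axis i 1 \<in> \<int>" unfolding w_def
        by (simp add: dot_lmul_matrix vector_transpose_matrix transpose_matrix_vector)
      then show ?thesis by (simp add: inner_axis)
    qed
    then obtain z where z: "\<And>i. w $ i = of_int (z i)" unfolding Ints_def by (auto simp: image_iff) metis
    have "w = ivec (\<chi> i. z i)" by (simp add: vec_eq_iff z)
    moreover have "y = transpose (matrix_inv A) *v w"
    proof -
      have "transpose (matrix_inv A) *v w = transpose (A ** matrix_inv A) *v y"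
        unfolding w_def by (simp only: matrix_vector_mul_assoc matrix_transpose_mul)
      then show ?thesis by (simp only: matrix_inv_mult[OF inv] transpose_mat matrix_vector_mul_lid)
    qed
    ultimately show "y \<in> range (\<lambda>z. transpose (matrix_inv A) *v ivec z)" by blast
  next
    fix y assume "y \<in> range (\<lambda>z. transpose (matrix_inv A) *v ivec z)"
    then obtain u where u: "y = transpose (matrix_inv A) *v ivec u" by auto
    have "y \<bullet> (A *v ivec z) \<in> \<int>" for z
    proof -
      have "y \<bullet> (A *v ivec z) = ivec u \<bullet> (matrix_inv A *v (A *v ivec z))"
        unfolding u by (simp add: dot_lmul_matrix transpose_matrix_vector)
      also have "\<dots> = ivec u \<bullet> ivec z" by (simp only: matrix_inv_mult_vec[OF inv])
      also have "\<dots> \<in> \<int>" by (auto simp: inner_vec_def)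
      finally show ?thesis .
    qed
    then show "y \<in> dual_lattice L" unfolding dual_lattice_def L by auto
  qed
  then show ?thesis using inv' by (simp add: lattice_basis_def)
qed

section \<open>Measures of polynomial growth\<close>

text \<open>The exponent is that of Lebesgue measure and of lattices. The constant is a parameter
  because the constants of the individual combs are later summed against the weights.\<close>

definition poly_growth :: "(real^'n) measure \<Rightarrow> real \<Rightarrow> bool" where
  "poly_growth m C \<longleftrightarrow> sets m = sets borel \<and> C \<ge> 0 \<and>
     (\<forall>r\<ge>1. emeasure m (ball 0 r) \<le> ennreal (C * r ^ CARD('n)))"

text \<open>This is \<open>zeta 2\<close>: growth of order \<open>r^n\<close> against decay of order
  \<open>n + 2\<close> leaves the exponent 2.\<close>

definition inverse_squares_sum :: real where
  "inverse_squares_sum = (\<Sum>j. 1 / real (Suc j) ^ 2)"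

lemma summable_inverse_squares: "summable (\<lambda>j. 1 / real (Suc j) ^ 2)"
  using inverse_power_summable[of 2, where 'a=real] by (subst summable_Suc_iff) (simp add: field_simps)

lemma inverse_squares_sum_nonneg: "inverse_squares_sum \<ge> 0"
  unfolding inverse_squares_sum_def by (intro suminf_nonneg summable_inverse_squares) auto

lemma ennreal_le_suminf: "f j \<le> suminf f" for f :: "nat \<Rightarrow> ennreal"
  using sum_le_suminf[of f "{j}"] by simp

text \<open>With \<open>j\<close> the integer part of \<open>norm x\<close>, the integrand is at
  most \<open>1/(j+1)^(n+2)\<close> and \<open>x\<close> lies in the ball of radius
  \<open>j + 1\<close>. Whole balls in place of shells suffice: each contributes at most
  \<open>C / (j+1)^2\<close>.\<close>

lemma poly_growth_nn_integral:
  fixes m :: "(real^'n) measure"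
  assumes "poly_growth m C"
  shows "(\<integral>\<^sup>+x. ennreal (1 / (1 + norm x) ^ (CARD('n) + 2)) \<partial>m) \<le> ennreal (C * inverse_squares_sum)"
proof -
  have [measurable_cong]: "sets m = sets borel" and C: "C \<ge> 0"
    and gr: "\<And>r. r \<ge> 1 \<Longrightarrow> emeasure m (ball 0 r) \<le> ennreal (C * r ^ CARD('n))"
    using assms by (auto simp: poly_growth_def)
  let ?t = "\<lambda>j x. ennreal (1 / real (Suc j) ^ (CARD('n) + 2)) * indicator (ball (0::real^'n) (real (Suc j))) x"
  have "ennreal (1 / (1 + norm x) ^ (CARD('n) + 2)) \<le> (\<Sum>j. ?t j x)" for x :: "real^'n"
  proof -
    define j where "j = nat \<lfloor>norm x\<rfloor>"
    have j: "real j \<le> norm x" "norm x < real (Suc j)"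
      unfolding j_def using norm_ge_zero[of x] by linarith+
    have "(real (Suc j)) ^ (CARD('n) + 2) \<le> (1 + norm x) ^ (CARD('n) + 2)"
      using j by (intro power_mono) auto
    then have "1 / (1 + norm x) ^ (CARD('n) + 2) \<le> 1 / (real (Suc j)) ^ (CARD('n) + 2)"
      by (intro divide_left_mono mult_pos_pos zero_less_power) (auto simp: add_pos_nonneg)
    then have "ennreal (1 / (1 + norm x) ^ (CARD('n) + 2)) \<le> ?t j x"
      using j by (auto intro!: ennreal_leI)
    also have "\<dots> \<le> (\<Sum>j. ?t j x)" by (rule ennreal_le_suminf)
    finally show ?thesis .
  qed
  then have "(\<integral>\<^sup>+x. ennreal (1 / (1 + norm x) ^ (CARD('n) + 2)) \<partial>m) \<le> (\<integral>\<^sup>+x. (\<Sum>j. ?t j x) \<partial>m)"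
    by (intro nn_integral_mono)
  also have "\<dots> = (\<Sum>j. \<integral>\<^sup>+x. ?t j x \<partial>m)"
    by (intro nn_integral_suminf borel_measurable_times_ennreal borel_measurable_indicator) auto
  also have "\<dots> \<le> (\<Sum>j. ennreal (C * (1 / real (Suc j) ^ 2)))"
  proof (intro suminf_le summableI)
    fix j
    have "(\<integral>\<^sup>+x. ?t j x \<partial>m) = ennreal (1 / real (Suc j) ^ (CARD('n) + 2)) * emeasure m (ball 0 (real (Suc j)))"
      by (subst nn_integral_cmult_indicator) auto
    also have "\<dots> \<le> ennreal (1 / real (Suc j) ^ (CARD('n) + 2)) * ennreal (C * real (Suc j) ^ CARD('n))"
      by (intro mult_left_mono gr) auto
    also have "\<dots> = ennreal (C * (1 / real (Suc j) ^ 2))"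
      by (subst ennreal_mult'[symmetric]) (auto simp: power_add power2_eq_square simp del: of_nat_Suc)
    finally show "(\<integral>\<^sup>+x. ?t j x \<partial>m) \<le> ennreal (C * (1 / real (Suc j) ^ 2))" .
  qed
  also have "\<dots> = ennreal (\<Sum>j. C * (1 / real (Suc j) ^ 2))"
    using C by (intro suminf_ennreal2 summable_mult summable_inverse_squares) auto
  also have "(\<Sum>j. C * (1 / real (Suc j) ^ 2)) = C * inverse_squares_sum"
    unfolding inverse_squares_sum_def by (intro suminf_mult summable_inverse_squares)
  finally show ?thesis .
qed

lemma poly_growth_integrable:
  fixes f :: "real^'n \<Rightarrow> 'b::{banach, second_countable_topology}"
  assumes m: "poly_growth m C" and [measurable]: "f \<in> borel_measurable borel"
    and B: "\<And>x. norm (f x) \<le> B / (1 + norm x) ^ (CARD('n) + 2)"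
  shows "integrable m f" "(LINT x|m. norm (f x)) \<le> B * (C * inverse_squares_sum)"
    "norm (LINT x|m. f x) \<le> B * (C * inverse_squares_sum)"
proof -
  have [measurable_cong]: "sets m = sets borel" and C: "C \<ge> 0"
    using m by (auto simp: poly_growth_def)
  have B0: "B \<ge> 0" using order_trans[OF norm_ge_zero B[of 0]] by simp
  have "(\<integral>\<^sup>+x. ennreal (norm (f x)) \<partial>m) \<le> (\<integral>\<^sup>+x. ennreal B * ennreal (1 / (1 + norm x) ^ (CARD('n) + 2)) \<partial>m)"
    using B B0 by (intro nn_integral_mono) (auto simp: ennreal_mult'[symmetric] intro!: ennreal_leI)
  also have "\<dots> = ennreal B * (\<integral>\<^sup>+x. ennreal (1 / (1 + norm x) ^ (CARD('n) + 2)) \<partial>m)"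
    by (rule nn_integral_cmult) measurable
  also have "\<dots> \<le> ennreal B * ennreal (C * inverse_squares_sum)"
    by (intro mult_left_mono poly_growth_nn_integral m) auto
  also have "\<dots> = ennreal (B * (C * inverse_squares_sum))"
    using B0 by (simp add: ennreal_mult')
  finally have le: "(\<integral>\<^sup>+x. ennreal (norm (f x)) \<partial>m) \<le> ennreal (B * (C * inverse_squares_sum))" .
  then show int: "integrable m f"
    by (intro integrableI_bounded) (auto simp: le_less_trans)
  have "ennreal (LINT x|m. norm (f x)) \<le> ennreal (B * (C * inverse_squares_sum))"
    using le int by (subst nn_integral_eq_integral[symmetric]) auto
  then show le': "(LINT x|m. norm (f x)) \<le> B * (C * inverse_squares_sum)"
    using B0 C inverse_squares_sum_nonneg by simp
  show "norm (LINT x|m. f x) \<le> B * (C * inverse_squares_sum)"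
    by (rule order_trans[OF integral_norm_bound le'])
qed

text \<open>Carries polynomial decay through a bounded shift or an invertible linear map;
  \<open>c\<close> is the price of comparing \<open>1 + norm\<close> before and after.\<close>

lemma decay_comparison:
  fixes a b c B :: real
  assumes "0 \<le> B" "0 \<le> a" "0 \<le> b" "1 + b \<le> c * (1 + a)"
  shows "B / (1 + a) ^ m \<le> B * c ^ m / (1 + b) ^ m"
proof -
  have "(1 + b) ^ m \<le> c ^ m * (1 + a) ^ m"
    using power_mono[OF assms(4), of m] assms(3) by (simp add: power_mult_distrib)
  then have "B * (1 + b) ^ m \<le> B * c ^ m * (1 + a) ^ m"
    using assms(1) by (simp add: mult_left_mono mult.assoc)
  moreover have pos: "0 < (1 + a) ^ m" "0 < (1 + b) ^ m" using assms by simp_all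
  ultimately show ?thesis
    by (simp only: pos_divide_le_eq[OF pos(1)] times_divide_eq_left pos_le_divide_eq[OF pos(2)])
qed

text \<open>A real \<open>SUP\<close> says something only for a set bounded above. Only finitely
  many lists have length at most \<open>N\<close>, and each of them yields a bounded family.\<close>

lemma schwartz_norm_bound:
  assumes "schwartz (f :: real^'n \<Rightarrow> complex)"
  shows "(1 + norm x) ^ N * norm (f x) \<le> schwartz_norm N f"
proof -
  let ?g = "\<lambda>is x. (1 + norm x) ^ N * norm (partial_derivs is f x)"
  have fin: "finite {is :: 'n list. length is \<le> N}"
    using finite_lists_length_le[of "UNIV :: 'n set" N] by simp
  have "bdd_above (\<Union>is\<in>{is :: 'n list. length is \<le> N}. range (?g is))"
  proof (subst bdd_above_UN[OF fin], intro ballI)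
    fix "is" :: "'n list"
    have "bounded (range (\<lambda>x. (1 + norm x) ^ N *\<^sub>R partial_derivs is f x))"
      using assms unfolding schwartz_def by blast
    then obtain b where "\<And>x. norm ((1 + norm x) ^ N *\<^sub>R partial_derivs is f x) \<le> b"
      unfolding bounded_iff by auto
    then show "bdd_above (range (?g is))" by (intro bdd_aboveI[of _ b]) auto
  qed
  moreover have "(\<Union>is\<in>{is :: 'n list. length is \<le> N}. range (?g is)) =
     (\<lambda>(is, x). ?g is x) ` ({is :: 'n list. length is \<le> N} \<times> UNIV)" by auto
  ultimately have "bdd_above ((\<lambda>(is, x). ?g is x) ` ({is :: 'n list. length is \<le> N} \<times> UNIV))"
    by simp
  from cSUP_upper2[OF this, of "([], x)" "?g [] x"]
  show ?thesis unfolding schwartz_norm_def by (simp add: partial_derivs_def)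
qed

lemma schwartz_decay:
  assumes "schwartz (f :: real^'n \<Rightarrow> complex)"
  shows "norm (f x) \<le> schwartz_norm N f / (1 + norm x) ^ N"
  using schwartz_norm_bound[OF assms, of x N]
  by (subst pos_le_divide_eq) (auto simp: mult.commute add_pos_nonneg intro!: zero_less_power)

lemma schwartz_differentiable:
  assumes "schwartz f"
  shows "f differentiable (at x)"
  using assms[unfolded schwartz_def, rule_format, of "[]"] by (simp add: partial_derivs_def)

lemma schwartz_continuous: "schwartz f \<Longrightarrow> continuous_on S f"
  by (meson schwartz_differentiable continuous_at_imp_continuous_on differentiable_imp_continuous_within)

lemma schwartz_borel [measurable_dest]: "schwartz f \<Longrightarrow> f \<in> borel_measurable borel"
  by (intro borel_measurable_continuous_onI schwartz_continuous)

lemma poly_growth_schwartz: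
  fixes m :: "(real^'n) measure"
  assumes "poly_growth m C" "schwartz f"
  shows "integrable m f"
    "norm (LINT x|m. f x) \<le> C * inverse_squares_sum * schwartz_norm (CARD('n) + 2) f"
    "(LINT x|m. norm (f x)) \<le> C * inverse_squares_sum * schwartz_norm (CARD('n) + 2) f"
  using poly_growth_integrable[OF assms(1) schwartz_borel[OF assms(2)] schwartz_decay[OF assms(2)]]
  by (simp_all add: mult_ac)

lemma poly_growth_tempered:
  fixes m :: "(real^'n) measure"
  assumes "poly_growth m C"
  shows "locally_finite_borel m" "tempered_distribution (distribution_of m)" "tempered_measure m"
proof -
  have sets: "sets m = sets borel" and C: "C \<ge> 0"
    and gr: "\<And>r. r \<ge> 1 \<Longrightarrow> emeasure m (ball 0 r) \<le> ennreal (C * r ^ CARD('n))"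
    using assms by (auto simp: poly_growth_def)
  have "emeasure m K < \<infinity>" if K: "compact K" for K
  proof -
    obtain r where r: "r > 0" "\<And>x. x \<in> K \<Longrightarrow> norm x \<le> r"
      using compact_imp_bounded[OF K] by (auto simp: bounded_pos)
    then have "K \<subseteq> ball 0 (r + 1)" by fastforce
    then have "emeasure m K \<le> emeasure m (ball 0 (r + 1))"
      by (intro emeasure_mono) (auto simp: sets)
    also have "\<dots> \<le> ennreal (C * (r + 1) ^ CARD('n))" using r by (intro gr) auto
    finally show ?thesis by (simp add: le_less_trans)
  qed
  then show lf: "locally_finite_borel m" by (simp add: locally_finite_borel_def sets)
  show td: "tempered_distribution (distribution_of m)"
    unfolding tempered_distribution_def distribution_of_def
  proof (intro conjI allI impI exI)
    fix f g :: "real^'n \<Rightarrow> complex" and a b :: complex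
    assume "schwartz f" "schwartz g"
    then have "integrable m f" "integrable m g" using poly_growth_schwartz(1)[OF assms] by auto
    then show "(LINT x|m. a * f x + b * g x) = a * (LINT x|m. f x) + b * (LINT x|m. g x)"
      by simp
  next
    fix f :: "real^'n \<Rightarrow> complex" assume "schwartz f"
    then show "norm (LINT x|m. f x) \<le> C * inverse_squares_sum * schwartz_norm (CARD('n) + 2) f"
      by (rule poly_growth_schwartz(2)[OF assms])
  qed
  show "tempered_measure m"
    unfolding tempered_measure_def using lf td poly_growth_schwartz(1)[OF assms] by blast
qed

lemma poly_growth_lborel: "poly_growth (lborel :: (real^'n) measure) (unit_ball_vol (real CARD('n)))"
  unfolding poly_growth_def by (auto simp: emeasure_ball)

section \<open>Decay of Fourier transforms\<close>

lemma integral_lborel_translation: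
  fixes f :: "real^'n \<Rightarrow> complex"
  assumes [measurable]: "f \<in> borel_measurable borel"
  shows "(LINT x|lborel. f (x + a)) = (LINT x|lborel. f x)"
    and "integrable lborel (\<lambda>x. f (x + a)) \<longleftrightarrow> integrable lborel f"
proof -
  have d: "distr lborel borel (\<lambda>x. x + a) = (lborel :: (real^'n) measure)"
  proof -
    have "(\<lambda>x. x + a) = (+) a" by (auto simp: add.commute)
    then show ?thesis using lborel_distr_plus[of a] by simp
  qed
  show "(LINT x|lborel. f (x + a)) = (LINT x|lborel. f x)"
    by (subst d[symmetric]) (simp add: integral_distr)
  show "integrable lborel (\<lambda>x. f (x + a)) \<longleftrightarrow> integrable lborel f"
    by (subst d[symmetric]) (simp add: integrable_distr_eq)
qed

text \<open>Takes the place of integration by parts. The difference quotients of \<open>g\<close>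
  have integral 0 by translation invariance, and they converge to \<open>g'\<close> under a common
  integrable bound.\<close>

lemma integral_directional_derivative_zero:
  fixes g g' :: "real^'n \<Rightarrow> complex"
  assumes [measurable]: "g \<in> borel_measurable borel" "g' \<in> borel_measurable borel"
    and e: "norm e \<le> 1"
    and der: "\<And>x s. ((\<lambda>t. g (x + t *\<^sub>R e)) has_vector_derivative g' (x + s *\<^sub>R e)) (at s)"
    and g: "\<And>x. norm (g x) \<le> B / (1 + norm x) ^ (CARD('n) + 2)"
    and g': "\<And>x. norm (g' x) \<le> B / (1 + norm x) ^ (CARD('n) + 2)"
  shows "(LINT x|lborel. g' x) = 0"
proof -
  define q where "q j x = real (Suc j) *\<^sub>R (g (x + (1 / real (Suc j)) *\<^sub>R e) - g x)" for j x
  have int: "integrable lborel g"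
    using poly_growth_integrable(1)[OF poly_growth_lborel _ g] by simp
  have B0: "B \<ge> 0" using order_trans[OF norm_ge_zero g[of 0]] by simp
  have q0: "(LINT x|lborel. q j x) = 0" for j
    unfolding q_def using int integral_lborel_translation[of g "(1 / real (Suc j)) *\<^sub>R e"] by simp
  have lim: "(\<lambda>j. q j x) \<longlonglongrightarrow> g' x" for x
  proof -
    have "((\<lambda>h. norm (g (x + h *\<^sub>R e) - g x - h *\<^sub>R g' x) / norm h) \<longlongrightarrow> 0) (at 0)"
      using der[of x 0] by (simp add: has_vector_derivative_def has_derivative_at)
    moreover have "filterlim (\<lambda>j. 1 / real (Suc j)) (at 0) sequentially"
      using LIMSEQ_inverse_real_of_nat by (auto simp: filterlim_at inverse_eq_divide)
    ultimately have *: "(\<lambda>j. norm (g (x + (1 / real (Suc j)) *\<^sub>R e) - g x - (1 / real (Suc j)) *\<^sub>R g' x) / norm (1 / real (Suc j))) \<longlonglongrightarrow> 0"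
      by (rule filterlim_compose)
    have gen: "norm v / norm (1 / real (Suc j)) = norm (real (Suc j) *\<^sub>R v)" for v :: complex and j
      by (simp del: of_nat_Suc)
    have eq: "norm (g (x + (1 / real (Suc j)) *\<^sub>R e) - g x - (1 / real (Suc j)) *\<^sub>R g' x) / norm (1 / real (Suc j)) = norm (q j x - g' x)" for j
    proof -
      have "q j x - g' x = real (Suc j) *\<^sub>R (g (x + (1 / real (Suc j)) *\<^sub>R e) - g x - (1 / real (Suc j)) *\<^sub>R g' x)"
        unfolding q_def scaleR_diff_right scaleR_scaleR by (simp del: of_nat_Suc)
      then show ?thesis by (simp only: gen)
    qed
    have "(\<lambda>j. norm (q j x - g' x)) \<longlonglongrightarrow> 0" using * unfolding eq .
    then show ?thesis by (rule LIM_zero_cancel[OF tendsto_norm_zero_cancel])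
  qed
  let ?w = "\<lambda>x :: real^'n. B * 2 ^ (CARD('n) + 2) / (1 + norm x) ^ (CARD('n) + 2)"
  \<comment> \<open>Mean value inequality on a segment of length at most 1: moving the point by at
    most 1 changes \<open>1 + norm\<close> by a factor of at most 2, whence the power of 2 in
    \<open>?w\<close>.\<close>
  have bound: "norm (q j x) \<le> ?w x" for j x
  proof -
    let ?h = "1 / real (Suc j)"
    have h: "0 \<le> ?h" "?h \<le> 1" by auto
    have "norm (g (x + ?h *\<^sub>R e) - g (x + 0 *\<^sub>R e)) \<le> ?w x * norm (?h - 0)"
    proof (rule differentiable_bound[of "{0..1}" "\<lambda>t. g (x + t *\<^sub>R e)" "\<lambda>s t. t *\<^sub>R g' (x + s *\<^sub>R e)"])
      fix s :: real assume s: "s \<in> {0..1}"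
      show "((\<lambda>t. g (x + t *\<^sub>R e)) has_derivative (\<lambda>t. t *\<^sub>R g' (x + s *\<^sub>R e))) (at s within {0..1})"
        using der[of x s] has_derivative_at_withinI unfolding has_vector_derivative_def by blast
      have "norm (s *\<^sub>R e) \<le> 1" using s e mult_le_one[of s "norm e"] by simp
      moreover have "norm x \<le> norm (x + s *\<^sub>R e) + norm (s *\<^sub>R e)"
        using norm_triangle_ineq4[of "x + s *\<^sub>R e" "s *\<^sub>R e"] by simp
      ultimately have "norm x \<le> norm (x + s *\<^sub>R e) + 1" by (meson add_left_mono order_trans)
      moreover have "0 \<le> norm (x + s *\<^sub>R e)" by (rule norm_ge_zero)
      ultimately have "1 + norm x \<le> 2 * (1 + norm (x + s *\<^sub>R e))" unfolding distrib_left by linarith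
      from decay_comparison[OF B0 norm_ge_zero norm_ge_zero this]
      have "B / (1 + norm (x + s *\<^sub>R e)) ^ (CARD('n) + 2) \<le> ?w x" .
      with g'[of "x + s *\<^sub>R e"] have "norm (g' (x + s *\<^sub>R e)) \<le> ?w x" by linarith
      moreover have "onorm (\<lambda>t. t *\<^sub>R g' (x + s *\<^sub>R e)) = norm (g' (x + s *\<^sub>R e))"
        using onorm_scaleR_left[of "\<lambda>t::real. t" "g' (x + s *\<^sub>R e)"] by (simp add: onorm_id bounded_linear_ident)
      ultimately show "onorm (\<lambda>t. t *\<^sub>R g' (x + s *\<^sub>R e)) \<le> ?w x" by simp
    qed (use h in auto)
    then have "norm (g (x + ?h *\<^sub>R e) - g x) \<le> ?w x / real (Suc j)" by simp
    then have "real (Suc j) * norm (g (x + ?h *\<^sub>R e) - g x) \<le> real (Suc j) * (?w x / real (Suc j))"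
      by (rule mult_left_mono) simp
    also have "\<dots> = ?w x" by (simp del: of_nat_Suc)
    finally show ?thesis unfolding q_def norm_scaleR by (simp del: of_nat_Suc)
  qed
  have wint: "integrable lborel ?w"
    using B0 by (intro poly_growth_integrable(1)[OF poly_growth_lborel, of _ "B * 2 ^ (CARD('n) + 2)"]) auto
  have "(\<lambda>j. LINT x|lborel. q j x) \<longlonglongrightarrow> (LINT x|lborel. g' x)"
    by (rule integral_dominated_convergence[OF _ _ wint]) (use lim bound in \<open>auto simp: q_def\<close>)
  then show ?thesis by (simp add: q0 LIMSEQ_const_iff)
qed

lemma schwartz_partial_deriv:
  assumes "schwartz f"
  shows "schwartz (partial_deriv i f)"
proof -
  have "partial_derivs is (partial_deriv i f) = partial_derivs (is @ [i]) f" for "is"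
    by (simp add: partial_derivs_def)
  then show ?thesis using assms unfolding schwartz_def by metis
qed

text \<open>\<open>partial_deriv\<close> is a \<open>vector_derivative\<close>, hence chosen whether
  or not one exists. Total differentiability supplies existence, at every point of the line parallel
  to the axis.\<close>

lemma schwartz_has_partial_deriv:
  assumes "schwartz (f :: real^'n \<Rightarrow> complex)"
  shows "((\<lambda>t. f (x + t *\<^sub>R axis i 1)) has_vector_derivative partial_deriv i f (x + s *\<^sub>R axis i 1)) (at s)"
proof -
  obtain f' where f': "(f has_derivative f') (at (x + s *\<^sub>R axis i 1))"
    using schwartz_differentiable[OF assms] by (auto simp: differentiable_def)
  have lin: "linear f'" using f' by (rule has_derivative_linear)
  have *: "((\<lambda>t. f (y + t *\<^sub>R axis i 1)) has_vector_derivative f' (axis i 1)) (at u)"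
    if "y + u *\<^sub>R axis i 1 = x + s *\<^sub>R axis i 1" for y u
  proof -
    have "((\<lambda>t. y + t *\<^sub>R axis i 1) has_derivative (\<lambda>t. t *\<^sub>R axis i 1)) (at u)"
      by (auto intro!: derivative_eq_intros)
    then have "((\<lambda>t. f (y + t *\<^sub>R axis i 1)) has_derivative (\<lambda>t. f' (t *\<^sub>R axis i 1))) (at u)"
      by (rule has_derivative_compose) (use f' that in simp)
    then show ?thesis
      by (simp add: has_vector_derivative_def linear_cmul[OF lin])
  qed
  from *[of "x + s *\<^sub>R axis i 1" 0] have "partial_deriv i f (x + s *\<^sub>R axis i 1) = f' (axis i 1)"
    unfolding partial_deriv_def by (intro vector_derivative_at) simp
  then show ?thesis using *[of x s] by simp
qed

lemma norm_exp_i_real [simp]: "norm (exp (- 2 * complex_of_real pi * \<i> * complex_of_real t)) = 1"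
  using norm_exp_i_times[of "- 2 * pi * t"] by (simp add: mult_ac)

text \<open>The character times \<open>f\<close> is a decaying function, so its \<open>i\<close>-th
  derivative integrates to 0; by the product rule this is the difference of the two sides.\<close>

lemma fourier_partial_deriv:
  assumes f: "schwartz (f :: real^'n \<Rightarrow> complex)"
  shows "fourier (partial_deriv i f) y = 2 * pi * \<i> * (y $ i) * fourier f y"
proof -
  let ?E = "\<lambda>x. exp (- 2 * pi * \<i> * complex_of_real (x \<bullet> y))"
  let ?e = "axis i 1 :: real^'n"
  define c where "c = 2 * complex_of_real pi * \<i> * complex_of_real (y $ i)"
  define g where "g = (\<lambda>x. ?E x * f x)"
  define g' where "g' = (\<lambda>x. ?E x * partial_deriv i f x - c * (?E x * f x))"
  note f' = schwartz_partial_deriv[OF f, of i]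
  note [measurable] = schwartz_borel[OF f] schwartz_borel[OF f']
  have gm: "g \<in> borel_measurable borel" "g' \<in> borel_measurable borel"
    unfolding g_def g'_def by measurable
  have der: "((\<lambda>t. g (x + t *\<^sub>R ?e)) has_vector_derivative g' (x + s *\<^sub>R ?e)) (at s)" for x s
  proof -
    have "((\<lambda>t. - 2 * pi * \<i> * complex_of_real ((x + t *\<^sub>R ?e) \<bullet> y)) has_vector_derivative - c) (at s)"
    proof -
      have "(\<lambda>t. - 2 * pi * \<i> * complex_of_real ((x + t *\<^sub>R ?e) \<bullet> y)) =
         (\<lambda>t. - 2 * pi * \<i> * complex_of_real (x \<bullet> y) + complex_of_real t * (- c))"
        by (auto simp: fun_eq_iff inner_add_left inner_axis' c_def algebra_simps)
      moreover have "((\<lambda>t. - 2 * pi * \<i> * complex_of_real (x \<bullet> y) + complex_of_real t * (- c))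
          has_vector_derivative - c) (at s)"
        by (auto intro!: derivative_eq_intros simp: scaleR_conv_of_real)
      ultimately show ?thesis by simp
    qed
    from field_vector_diff_chain_at[OF this DERIV_exp]
    have "((\<lambda>t. ?E (x + t *\<^sub>R ?e)) has_vector_derivative - c * ?E (x + s *\<^sub>R ?e)) (at s)"
      unfolding o_def .
    from has_vector_derivative_mult[OF this schwartz_has_partial_deriv[OF f]]
    show ?thesis unfolding g_def g'_def by (simp add: algebra_simps)
  qed
  define B0 where "B0 = schwartz_norm (CARD('n) + 2) f"
  define B1 where "B1 = schwartz_norm (CARD('n) + 2) (partial_deriv i f)"
  \<comment> \<open>One constant that majorises both \<open>g\<close> and \<open>g'\<close>, as
    \<open>integral_directional_derivative_zero\<close> expects.\<close>
  let ?B = "B0 + B1 + norm c * B0"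
  have fb: "norm (f x) \<le> B0 / (1 + norm x) ^ (CARD('n) + 2)"
       "norm (partial_deriv i f x) \<le> B1 / (1 + norm x) ^ (CARD('n) + 2)" for x
    unfolding B0_def B1_def by (intro schwartz_decay f f')+
  have nn: "B0 \<ge> 0" "B1 \<ge> 0"
    using order_trans[OF norm_ge_zero fb(1)[of 0]] order_trans[OF norm_ge_zero fb(2)[of 0]] by simp_all
  have mono: "u / (1 + norm x) ^ (CARD('n) + 2) \<le> v / (1 + norm x) ^ (CARD('n) + 2)" if "u \<le> v" for u v and x :: "real^'n"
    using that by (intro divide_right_mono) auto
  have gb: "norm (g x) \<le> ?B / (1 + norm x) ^ (CARD('n) + 2)" for x
  proof -
    have "norm (g x) = norm (f x)" by (simp add: g_def norm_mult)
    also have "\<dots> \<le> B0 / (1 + norm x) ^ (CARD('n) + 2)" by (rule fb)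
    also have "\<dots> \<le> ?B / (1 + norm x) ^ (CARD('n) + 2)" using nn by (intro mono) auto
    finally show ?thesis .
  qed
  have gb': "norm (g' x) \<le> ?B / (1 + norm x) ^ (CARD('n) + 2)" for x
  proof -
    have "norm (g' x) \<le> norm (partial_deriv i f x) + norm c * norm (f x)"
      using norm_triangle_ineq4[of "?E x * partial_deriv i f x" "c * (?E x * f x)"]
      by (simp add: g'_def norm_mult)
    also have "\<dots> \<le> B1 / (1 + norm x) ^ (CARD('n) + 2) + norm c * (B0 / (1 + norm x) ^ (CARD('n) + 2))"
      by (intro add_mono mult_left_mono fb) auto
    also have "\<dots> = (B1 + norm c * B0) / (1 + norm x) ^ (CARD('n) + 2)"
      by (simp add: add_divide_distrib)
    also have "\<dots> \<le> ?B / (1 + norm x) ^ (CARD('n) + 2)" using nn by (intro mono) auto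
    finally show ?thesis .
  qed
  have 0: "(LINT x|lborel. g' x) = 0"
    by (rule integral_directional_derivative_zero[OF gm _ der gb gb']) simp
  have i1: "integrable lborel (\<lambda>x. ?E x * partial_deriv i f x)"
    by (rule poly_growth_integrable(1)[OF poly_growth_lborel, of _ B1]) (use fb(2) in \<open>auto simp: norm_mult\<close>)
  have i2: "integrable lborel (\<lambda>x. ?E x * f x)"
    by (rule poly_growth_integrable(1)[OF poly_growth_lborel, of _ B0]) (use fb(1) in \<open>auto simp: norm_mult\<close>)
  show ?thesis using 0 i1 i2 unfolding g'_def fourier_def by (simp add: c_def)
qed

lemma schwartz_iterated_partial_deriv:
  assumes "schwartz f"
  shows "schwartz ((partial_deriv i ^^ m) f)"
  by (induction m) (auto intro: schwartz_partial_deriv assms)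

lemma fourier_iterated_partial_deriv:
  assumes "schwartz (f :: real^'n \<Rightarrow> complex)"
  shows "fourier ((partial_deriv i ^^ m) f) y = (2 * pi * \<i> * (y $ i)) ^ m * fourier f y"
  by (induction m) (auto simp: fourier_partial_deriv schwartz_iterated_partial_deriv assms)

lemma norm_fourier_le:
  assumes f: "schwartz (f :: real^'n \<Rightarrow> complex)"
  shows "norm (fourier f y) \<le> unit_ball_vol (real CARD('n)) * inverse_squares_sum * schwartz_norm (CARD('n) + 2) f"
proof -
  have "norm (fourier f y) \<le> (LINT x|lborel. norm (exp (- 2 * pi * \<i> * complex_of_real (x \<bullet> y)) * f x))"
    unfolding fourier_def by (rule integral_norm_bound)
  also have "\<dots> = (LINT x|lborel. norm (f x))" by (simp add: norm_mult)
  also have "\<dots> \<le> unit_ball_vol (real CARD('n)) * inverse_squares_sum * schwartz_norm (CARD('n) + 2) f"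
    by (rule poly_growth_schwartz(3)[OF poly_growth_lborel f])
  finally show ?thesis .
qed

lemma norm_le_card_component: "\<exists>i. norm (y :: real^'n) \<le> CARD('n) * \<bar>y $ i\<bar>"
proof -
  obtain i where i: "\<bar>y $ i\<bar> = Max (range (\<lambda>i. \<bar>y $ i\<bar>))"
    using Max_in[of "range (\<lambda>i. \<bar>y $ i\<bar>)"] by (metis finite_class.finite_UNIV finite_imageI imageE empty_not_UNIV image_is_empty)
  have "norm y \<le> (\<Sum>j\<in>UNIV. \<bar>y $ j\<bar>)" by (rule norm_le_l1_cart)
  also have "\<dots> \<le> (\<Sum>j\<in>(UNIV :: 'n set). \<bar>y $ i\<bar>)"
    unfolding i by (intro sum_mono Max_ge) auto
  finally show ?thesis by auto
qed

text \<open>Some coordinate satisfies \<open>norm y \<le> n |y_i|\<close>. The transform of the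
  \<open>m\<close>-th derivative in that direction is bounded and carries the factor
  \<open>|2 pi y_i|^m\<close>, which controls \<open>norm y ^ m\<close>.\<close>

lemma fourier_decay:
  assumes f: "schwartz (f :: real^'n \<Rightarrow> complex)"
  shows "\<exists>C. \<forall>y. norm (fourier f y) \<le> C / (1 + norm y) ^ m"
proof -
  define K where "K g = unit_ball_vol (real CARD('n)) * inverse_squares_sum * schwartz_norm (CARD('n) + 2) g" for g :: "real^'n \<Rightarrow> complex"
  let ?D = "\<lambda>i. (partial_deriv i ^^ m) f"
  have K: "norm (fourier f y) \<le> K f" "norm (fourier (?D i) y) \<le> K (?D i)" for y i
    unfolding K_def by (intro norm_fourier_le schwartz_iterated_partial_deriv f)+
  have Knn: "0 \<le> K f" "0 \<le> K (?D i)" for i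
    using order_trans[OF norm_ge_zero K(1)] order_trans[OF norm_ge_zero K(2)] by blast+
  \<comment> \<open>The first summand serves \<open>norm y \<le> 1\<close>, where
    \<open>1 + norm y \<le> 2\<close>; the second serves \<open>norm y > 1\<close>, where
    \<open>1 + norm y \<le> 2 n |y_i|\<close>. Summing over \<open>i\<close> makes it independent of
    the coordinate picked for \<open>y\<close>.\<close>
  define C where "C = 2 ^ m * K f + (2 * CARD('n)) ^ m * (\<Sum>i\<in>UNIV. K (?D i))"
  have "norm (fourier f y) * (1 + norm y) ^ m \<le> C" for y
  proof (cases "norm y \<le> 1")
    case True
    then have "norm (fourier f y) * (1 + norm y) ^ m \<le> K f * 2 ^ m"
      by (intro mult_mono K power_mono) (auto intro: Knn)
    also have "\<dots> \<le> C" unfolding C_def using Knn by (auto simp: mult.commute sum_nonneg)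
    finally show ?thesis .
  next
    case False
    obtain i where i: "norm y \<le> CARD('n) * \<bar>y $ i\<bar>" using norm_le_card_component by blast
    have "\<bar>y $ i\<bar> \<le> 2 * pi * \<bar>y $ i\<bar>" 
      using mult_right_mono[of 1 "2 * pi" "\<bar>y $ i\<bar>"] pi_gt3 by simp
    then have "norm (fourier f y) * \<bar>y $ i\<bar> ^ m \<le> norm (fourier f y) * (2 * pi * \<bar>y $ i\<bar>) ^ m"
      by (intro mult_left_mono power_mono) auto
    also have "\<dots> = norm (fourier (?D i) y)"
      by (simp add: fourier_iterated_partial_deriv[OF f] norm_mult norm_power abs_mult)
    also have "\<dots> \<le> K (?D i)" by (rule K)
    also have "\<dots> \<le> (\<Sum>i\<in>UNIV. K (?D i))" using Knn by (intro member_le_sum) auto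
    finally have le: "norm (fourier f y) * \<bar>y $ i\<bar> ^ m \<le> (\<Sum>i\<in>UNIV. K (?D i))" .
    have "1 + norm y \<le> 2 * CARD('n) * \<bar>y $ i\<bar>" using False i by simp
    then have "norm (fourier f y) * (1 + norm y) ^ m \<le> norm (fourier f y) * (2 * CARD('n) * \<bar>y $ i\<bar>) ^ m"
      by (intro mult_left_mono power_mono) auto
    also have "\<dots> = (2 * CARD('n)) ^ m * (norm (fourier f y) * \<bar>y $ i\<bar> ^ m)"
      by (simp add: power_mult_distrib mult_ac)
    also have "\<dots> \<le> (2 * CARD('n)) ^ m * (\<Sum>i\<in>UNIV. K (?D i))"
      using le by (intro mult_left_mono) auto
    also have "\<dots> \<le> C" unfolding C_def using Knn by simp
    finally show ?thesis .
  qed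
  moreover have "(1 + norm y) ^ m > 0" for y :: "real^'n" by (intro zero_less_power add_pos_nonneg) auto
  ultimately have "norm (fourier f y) \<le> C / (1 + norm y) ^ m" for y
    by (simp add: pos_le_divide_eq)
  then show ?thesis by blast
qed

lemma fourier_borel:
  assumes f: "schwartz (f :: real^'n \<Rightarrow> complex)"
  shows "fourier f \<in> borel_measurable borel"
proof -
  note [measurable] = schwartz_borel[OF f]
  show ?thesis unfolding fourier_def by measurable
qed

section \<open>Growth of lattice combs\<close>

lemma lattice_basis_countable: "lattice_basis A L \<Longrightarrow> countable L"
  unfolding lattice_basis_def by auto

lemma lattice_finite_ball:
  assumes "lattice_basis A L"
  shows "finite (L \<inter> ball x r)"
  using lattice_point_count[OF assms] by metis

lemma lattice_card_ball_bound:
  fixes L :: "(real^'n) set"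
  assumes "lattice_basis A L"
  shows "\<exists>C\<ge>0. \<forall>x. \<forall>r::real. r \<ge> 1 \<longrightarrow> card (L \<inter> ball x r) \<le> C * r ^ CARD('n)"
proof -
  obtain D where D: "D > 0"
    "\<And>x r. r \<ge> 0 \<Longrightarrow> card (L \<inter> ball x r) * \<bar>det A\<bar> \<le> unit_ball_vol CARD('n) * (r + D) ^ CARD('n)"
    using lattice_point_count[OF assms] by metis
  note det = lattice_basis_det_pos[OF assms]
  let ?C = "unit_ball_vol CARD('n) * (1 + D) ^ CARD('n) / \<bar>det A\<bar>"
  have "card (L \<inter> ball x r) \<le> ?C * r ^ CARD('n)" if r: "r \<ge> 1" for x and r :: real
  proof -
    have "r + D \<le> (1 + D) * r" using r D(1) by (simp add: algebra_simps)
    then have "(r + D) ^ CARD('n) \<le> ((1 + D) * r) ^ CARD('n)"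
      using r D(1) by (intro power_mono) auto
    then have "unit_ball_vol CARD('n) * (r + D) ^ CARD('n) \<le> unit_ball_vol CARD('n) * ((1 + D) ^ CARD('n) * r ^ CARD('n))"
      by (intro mult_left_mono) (auto simp: power_mult_distrib)
    with D(2)[of r x] r have "card (L \<inter> ball x r) * \<bar>det A\<bar> \<le> unit_ball_vol CARD('n) * ((1 + D) ^ CARD('n) * r ^ CARD('n))"
      by linarith
    then show ?thesis using det by (simp add: pos_le_divide_eq mult_ac)
  qed
  moreover have "?C \<ge> 0" using D(1) by simp
  ultimately show ?thesis by blast
qed

lemma scaled_Int_ball:
  fixes L :: "(real^'n) set"
  assumes "t > 0"
  shows "(\<lambda>x. t *\<^sub>R x) ` L \<inter> ball x r = (\<lambda>x. t *\<^sub>R x) ` (L \<inter> ball (x /\<^sub>R t) (r / t))"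
proof -
  have "dist x (t *\<^sub>R y) < r \<longleftrightarrow> dist (x /\<^sub>R t) y < r / t" for y
  proof -
    have "dist x (t *\<^sub>R y) = dist (t *\<^sub>R (x /\<^sub>R t)) (t *\<^sub>R y)" using assms by simp
    also have "\<dots> = t * dist (x /\<^sub>R t) y" using assms 
      by (simp only: dist_norm scaleR_diff_right[symmetric] norm_scaleR abs_of_pos)
    finally show ?thesis using assms by (simp add: field_simps)
  qed
  then show ?thesis by (auto simp: mem_ball)
qed

lemma card_scaled_Int_ball:
  fixes L :: "(real^'n) set"
  assumes "t > 0"
  shows "card ((\<lambda>x. t *\<^sub>R x) ` L \<inter> ball x r) = card (L \<inter> ball (x /\<^sub>R t) (r / t))"
  unfolding scaled_Int_ball[OF assms] by (rule card_image) (use assms in \<open>auto simp: inj_on_def\<close>)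

text \<open>The origin belongs to every scaled lattice, so the full count stays at least 1 when
  \<open>r\<close> is small against \<open>t\<close>. Without it the bound \<open>(r/t)^n\<close>
  holds at all scales, because below the least nonzero norm nothing is left. This makes the sum over
  arbitrarily large primes converge.\<close>

lemma lattice_nonzero_count:
  fixes L :: "(real^'n) set"
  assumes "lattice_basis A L"
  shows "\<exists>C\<ge>0. \<forall>t r::real. t > 0 \<longrightarrow> r > 0 \<longrightarrow>
     card ((\<lambda>x. t *\<^sub>R x) ` L \<inter> ball 0 r - {0}) \<le> C * (r / t) ^ CARD('n)"
proof -
  obtain C where C: "C \<ge> 0" "\<And>x r::real. r \<ge> 1 \<Longrightarrow> card (L \<inter> ball x r) \<le> C * r ^ CARD('n)"
    using lattice_card_ball_bound[OF assms] by blast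
  note fin = lattice_finite_ball[OF assms]
  have "\<exists>\<delta>>0. \<delta> \<le> 1 \<and> L \<inter> ball 0 \<delta> - {0} = {}"
  proof -
    define \<delta> where "\<delta> = Min (insert 1 (norm ` (L \<inter> ball 0 1 - {0})))"
    have fin': "finite (insert 1 (norm ` (L \<inter> ball 0 1 - {0})))" using fin[of 0 1] by simp
    have "\<delta> > 0" unfolding \<delta>_def using fin' by (subst Min_gr_iff) auto
    moreover have "\<delta> \<le> 1" unfolding \<delta>_def using fin' by (intro Min_le) auto
    moreover have "\<delta> \<le> norm x" if "x \<in> L \<inter> ball 0 1 - {0}" for x
      unfolding \<delta>_def using fin' that by (intro Min_le) auto
    ultimately show ?thesis by (intro exI[of _ \<delta>]) fastforce
  qed
  then obtain \<delta> where \<delta>: "\<delta> > 0" "\<delta> \<le> 1" "L \<inter> ball 0 \<delta> - {0} = {}" by blast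
  have base: "card (L \<inter> ball 0 s - {0}) \<le> C / \<delta> ^ CARD('n) * s ^ CARD('n)" if s: "s > 0" for s
  proof -
    \<comment> \<open>Above 1 the usual bound applies, below \<open>\<delta>\<close> the set is
      empty, and between them the count at radius 1 is inflated by
      \<open>(s/\<delta>)^n \<ge> 1\<close>.\<close>
    consider "s \<ge> 1" | "s \<le> \<delta>" | "\<delta> \<le> s" "s \<le> 1" by linarith
    then show ?thesis
    proof cases
      case 1
      have "card (L \<inter> ball 0 s - {0}) \<le> card (L \<inter> ball 0 s)" by (intro card_mono fin) auto
      then have "card (L \<inter> ball 0 s - {0}) \<le> C * s ^ CARD('n)" using C(2)[OF 1, of 0] by linarith
      also have "\<dots> \<le> C / \<delta> ^ CARD('n) * s ^ CARD('n)"
        using C(1) \<delta> s by (intro mult_right_mono) (auto simp: field_simps power_le_one mult_left_le)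
      finally show ?thesis .
    next
      case 2
      then have "ball 0 s \<subseteq> ball (0 :: real^'n) \<delta>" by (rule subset_ball)
      then have E: "L \<inter> ball 0 s - {0} = {}" using \<delta>(3) by blast
      show ?thesis unfolding E using C(1) \<delta> s by simp
    next
      case 3
      have "card (L \<inter> ball 0 s - {0}) \<le> card (L \<inter> ball 0 1)"
        using subset_ball[OF 3(2), of "0 :: real^'n"] by (intro card_mono fin) auto
      then have "card (L \<inter> ball 0 s - {0}) \<le> C * 1" using C(2)[of 1 0] by simp
      also have "\<dots> \<le> C * (s / \<delta>) ^ CARD('n)"
        using C(1) 3 \<delta> by (intro mult_left_mono one_le_power) auto
      finally show ?thesis by (simp add: power_divide)
    qed
  qed
  have "card ((\<lambda>x. t *\<^sub>R x) ` L \<inter> ball 0 r - {0}) \<le> C / \<delta> ^ CARD('n) * (r / t) ^ CARD('n)"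
    if "t > 0" "r > 0" for t r
  proof -
    have "(\<lambda>x. t *\<^sub>R x) ` L \<inter> ball 0 r - {0} = (\<lambda>x. t *\<^sub>R x) ` (L \<inter> ball 0 (r / t) - {0})"
      using that scaled_Int_ball[of t L 0 r] by auto
    then have "card ((\<lambda>x. t *\<^sub>R x) ` L \<inter> ball 0 r - {0}) = card (L \<inter> ball 0 (r / t) - {0})"
      using that by (simp add: card_image inj_on_def)
    then show ?thesis using base[of "r / t"] that by simp
  qed
  moreover have "C / \<delta> ^ CARD('n) \<ge> 0" using C \<delta> by simp
  ultimately show ?thesis by blast
qed

lemma emeasure_dirac_comb:
  assumes "B \<in> sets borel"
  shows "emeasure (dirac_comb S) B = emeasure (count_space UNIV) (B \<inter> S)"
proof -
  have "emeasure (dirac_comb S) B = emeasure (count_space S) (B \<inter> S)"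
    unfolding dirac_comb_def using assms by (subst emeasure_distr) auto
  then show ?thesis by (simp add: emeasure_count_space)
qed

lemma sets_dirac_comb [simp, measurable_cong]: "sets (dirac_comb S) = sets borel"
  by (simp add: dirac_comb_def)

text \<open>Two regimes. The refinements \<open>t \<le> 1\<close> occur as the dual lattices divided
  by \<open>d^k\<close>, and their growth \<open>1/t^n\<close> must be paid for by the weights; the
  dilations \<open>t \<ge> 1\<close> occur as \<open>d^k L\<close> and share one constant. The count
  in unit balls with any centre serves translation boundedness.\<close>

lemma poly_growth_scaled_comb:
  fixes L :: "(real^'n) set"
  assumes "lattice_basis A L"
  shows "\<exists>C\<ge>0. (\<forall>t. 0 < t \<longrightarrow> t \<le> 1 \<longrightarrow> poly_growth (dirac_comb ((\<lambda>x. t *\<^sub>R x) ` L)) (C / t ^ CARD('n)) \<and>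
        (\<forall>x. card ((\<lambda>x. t *\<^sub>R x) ` L \<inter> ball x 1) \<le> C / t ^ CARD('n))) \<and>
     (\<forall>t\<ge>1. poly_growth (dirac_comb ((\<lambda>x. t *\<^sub>R x) ` L)) C)"
proof -
  obtain C where C: "C \<ge> 0" "\<And>x r::real. r \<ge> 1 \<Longrightarrow> card (L \<inter> ball x r) \<le> C * r ^ CARD('n)"
    using lattice_card_ball_bound[OF assms] by blast
  note fin = lattice_finite_ball[OF assms]
  have em: "emeasure (dirac_comb ((\<lambda>x. t *\<^sub>R x) ` L)) (ball 0 r) = ennreal (card (L \<inter> ball 0 (r / t)))"
    if "t > 0" for t r :: real
  proof -
    have "finite (ball 0 r \<inter> (\<lambda>x. t *\<^sub>R x) ` L)"
      using fin[of 0 "r / t"] scaled_Int_ball[OF that, of L 0 r] by (simp add: Int_commute)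
    then show ?thesis
      using card_scaled_Int_ball[OF that, of L 0 r]
      by (simp add: emeasure_dirac_comb Int_commute ennreal_of_nat_eq_real_of_nat)
  qed
  have small: "card (L \<inter> ball x (r / t)) \<le> C / t ^ CARD('n) * r ^ CARD('n)"
    if "0 < t" "t \<le> 1" "r \<ge> 1" for t r x
  proof -
    have "r / t \<ge> 1" using that by (simp add: field_simps)
    from C(2)[OF this, of x] show ?thesis by (simp add: power_divide)
  qed
  have 1: "poly_growth (dirac_comb ((\<lambda>x. t *\<^sub>R x) ` L)) (C / t ^ CARD('n)) \<and>
        (\<forall>x. card ((\<lambda>x. t *\<^sub>R x) ` L \<inter> ball x 1) \<le> C / t ^ CARD('n))" if "0 < t" "t \<le> 1" for t
  proof -
    have "card ((\<lambda>x. t *\<^sub>R x) ` L \<inter> ball x 1) \<le> C / t ^ CARD('n)" for x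
      using small[OF that, of 1 "x /\<^sub>R t"] by (simp add: card_scaled_Int_ball[OF that(1)])
    then show ?thesis
      unfolding poly_growth_def using C(1) that small em by (auto intro!: ennreal_leI)
  qed
  have 2: "poly_growth (dirac_comb ((\<lambda>x. t *\<^sub>R x) ` L)) C" if "t \<ge> 1" for t
  proof -
    have "card (L \<inter> ball 0 (r / t)) \<le> C * r ^ CARD('n)" if r: "r \<ge> 1" for r
    proof -
      have "r / t \<le> r" using r \<open>t \<ge> 1\<close> by (simp add: field_simps mult_le_cancel_left1)
      then have "card (L \<inter> ball 0 (r / t)) \<le> card (L \<inter> ball 0 r)"
        using subset_ball[of "r / t" r 0] by (intro card_mono fin) auto
      then show ?thesis using C(2)[OF r, of 0] by linarith
    qed
    then show ?thesis
      unfolding poly_growth_def using C(1) that em by (auto intro!: ennreal_leI)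
  qed
  from 1 2 C(1) show ?thesis by blast
qed

lemma lattice_comb_integral:
  fixes L :: "(real^'n) set" and f :: "real^'n \<Rightarrow> 'b::{banach, second_countable_topology}"
  assumes "lattice_basis A L" and f: "f \<in> borel_measurable borel"
  shows "(LINT x|dirac_comb L. f x) = (LINT z|count_space UNIV. f (A *v ivec z))"
    and "integrable (dirac_comb L) f \<longleftrightarrow> integrable (count_space UNIV) (\<lambda>z. f (A *v ivec z))"
proof -
  have inv: "invertible A" and L: "L = range (\<lambda>z. A *v ivec z)"
    using assms by (auto simp: lattice_basis_def)
  have inj: "inj (\<lambda>z. A *v ivec z)"
  proof (rule injI)
    fix x y :: "int^'n" assume "A *v ivec x = A *v ivec y"
    then have "ivec x = (ivec y :: real^'n)" by (rule invertible_vec_inj[OF inv])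
    then show "x = y" by (simp add: vec_eq_iff)
  qed
  then have bij: "bij_betw (\<lambda>z. A *v ivec z) UNIV L" unfolding L by (rule inj_on_imp_bij_betw)
  have id: "(\<lambda>x. x) \<in> count_space L \<rightarrow>\<^sub>M borel" by simp
  show "(LINT x|dirac_comb L. f x) = (LINT z|count_space UNIV. f (A *v ivec z))"
    unfolding dirac_comb_def integral_distr[OF id f] by (rule integral_bij_count_space[OF bij, symmetric])
  have "distr (count_space UNIV) (count_space L) (\<lambda>z. A *v ivec z) = count_space L"
    by (rule distr_bij_count_space[OF bij])
  then show "integrable (dirac_comb L) f \<longleftrightarrow> integrable (count_space UNIV) (\<lambda>z. f (A *v ivec z))"
    unfolding dirac_comb_def integrable_distr_eq[OF id f] 
    using integrable_distr_eq[of "\<lambda>z. A *v ivec z" "count_space UNIV" "count_space L" f] L by auto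
qed

section \<open>The Poisson summation formula\<close>

lemma cis_borel [measurable]: "cis \<in> borel_measurable borel"
  by (intro borel_measurable_continuous_onI continuous_intros)

text \<open>The squared modulus makes positivity evident; the Cesaro form of the same kernel is
  \<open>fejer_expansion\<close>.\<close>

definition fejer :: "nat \<Rightarrow> real \<Rightarrow> real" where
  "fejer N t = (cmod (\<Sum>j<N. cis (real j * (- 2 * pi * t))))\<^sup>2 / N"

lemma fejer_nonneg [simp]: "fejer N t \<ge> 0"
  by (simp add: fejer_def)

text \<open>The difference \<open>a\<close> of two indices below \<open>N\<close> occurs
  \<open>N - |a|\<close> times. In the induction the new index adds one conjugate pair of cross
  terms and a 1, hence each frequency from \<open>-N\<close> to \<open>N\<close> once more.\<close>

lemma norm_square_sum_cis:
  "complex_of_real ((cmod (\<Sum>j<N. cis (real j * u)))\<^sup>2) =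
     (\<Sum>a\<in>{- int N..int N}. of_int (int N - \<bar>a\<bar>) * cis (of_int a * u))"
proof (induction N)
  case (Suc N)
  let ?S = "\<Sum>j<N. cis (real j * u)"
  let ?z = "cis (real N * u)"
  have "complex_of_real ((cmod (?S + ?z))\<^sup>2) = (?S + ?z) * cnj (?S + ?z)"
    by (simp only: complex_norm_square)
  also have "\<dots> = complex_of_real ((cmod ?S)\<^sup>2) + (?S * cnj ?z + cnj ?S * ?z + ?z * cnj ?z)"
    unfolding complex_norm_square by (simp add: algebra_simps)
  also have "?z * cnj ?z = 1" by (simp add: cis_cnj cis_mult)
  also have "?S * cnj ?z = (\<Sum>a\<in>{- int N..-1}. cis (of_int a * u))"
    unfolding sum_distrib_right
    by (rule sum.reindex_bij_witness[of _ "\<lambda>a. nat (a + int N)" "\<lambda>j. int j - int N"])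
       (auto simp: cis_cnj cis_mult algebra_simps)
  also have "cnj ?S * ?z = (\<Sum>a\<in>{1..int N}. cis (of_int a * u))"
    unfolding cnj_sum sum_distrib_right
    by (rule sum.reindex_bij_witness[of _ "\<lambda>a. nat (int N - a)" "\<lambda>j. int N - int j"])
       (auto simp: cis_cnj cis_mult algebra_simps)
  also have "(\<Sum>a\<in>{- int N..-1}. cis (of_int a * u)) + (\<Sum>a\<in>{1..int N}. cis (of_int a * u)) + 1 =
      (\<Sum>a\<in>{- int N..int N}. cis (of_int a * u))"
  proof -
    have "{- int N..int N} = insert 0 ({- int N..-1} \<union> {1..int N})" by auto
    then show ?thesis by (simp add: sum.union_disjoint)
  qed
  finally have "complex_of_real ((cmod (?S + ?z))\<^sup>2) =
      (\<Sum>a\<in>{- int N..int N}. of_int (int N - \<bar>a\<bar>) * cis (of_int a * u)) +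
      (\<Sum>a\<in>{- int N..int N}. cis (of_int a * u))"
    unfolding Suc.IH .
  also have "\<dots> = (\<Sum>a\<in>{- int N..int N}. of_int (int (Suc N) - \<bar>a\<bar>) * cis (of_int a * u))"
    by (simp add: sum.distrib[symmetric] algebra_simps)
  \<comment> \<open>The two extra frequencies \<open>|a| = N + 1\<close> have coefficient 0.\<close>
  also have "\<dots> = (\<Sum>a\<in>{- int (Suc N)..int (Suc N)}. of_int (int (Suc N) - \<bar>a\<bar>) * cis (of_int a * u))"
  proof (rule sum.mono_neutral_left)
    show "\<forall>a\<in>{- int (Suc N)..int (Suc N)} - {- int N..int N}. of_int (int (Suc N) - \<bar>a\<bar>) * cis (of_int a * u) = 0"
    proof
      fix a assume "a \<in> {- int (Suc N)..int (Suc N)} - {- int N..int N}"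
      then have "\<bar>a\<bar> = int (Suc N)" by auto
      then show "of_int (int (Suc N) - \<bar>a\<bar>) * cis (of_int a * u) = 0" by simp
    qed
  qed auto
  finally show ?case by simp
qed simp

lemma fejer_expansion:
  assumes "N > 0"
  shows "complex_of_real (fejer N t) =
    (\<Sum>a\<in>{- int N..int N}. of_real (1 - \<bar>of_int a\<bar> / N) * cis (- 2 * pi * of_int a * t))"
proof -
  have "complex_of_real (fejer N t) = complex_of_real ((cmod (\<Sum>j<N. cis (real j * (- 2 * pi * t))))\<^sup>2) / of_nat N"
    by (simp add: fejer_def mult_ac)
  also have "\<dots> = (\<Sum>a\<in>{- int N..int N}. of_int (int N - \<bar>a\<bar>) * cis (of_int a * (- 2 * pi * t)) / of_nat N)"
    unfolding norm_square_sum_cis by (rule sum_divide_distrib)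
  also have "\<dots> = (\<Sum>a\<in>{- int N..int N}. of_real (1 - \<bar>of_int a\<bar> / N) * cis (- 2 * pi * of_int a * t))"
    using assms by (intro sum.cong refl) (simp add: field_simps flip: of_int_abs)
  finally show ?thesis .
qed

text \<open>The sum is geometric with ratio \<open>z\<close> of modulus 1, and
  \<open>|1 - z^N| \<le> 2\<close>. Keeping \<open>|1 - z|\<close> on the left avoids a division at
  integer \<open>t\<close>.\<close>

lemma fejer_bound:
  "fejer N t * (cmod (1 - cis (- 2 * pi * t)))\<^sup>2 \<le> 4 / N"
proof -
  let ?z = "cis (- 2 * pi * t)"
  have "(\<Sum>j<N. cis (real j * (- 2 * pi * t))) = (\<Sum>j<N. ?z ^ j)"
    by (intro sum.cong refl Complex.DeMoivre[symmetric])
  then have "(1 - ?z) * (\<Sum>j<N. cis (real j * (- 2 * pi * t))) = 1 - ?z ^ N"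
    by (simp add: one_diff_power_eq)
  then have "cmod (1 - ?z) * cmod (\<Sum>j<N. cis (real j * (- 2 * pi * t))) = cmod (1 - ?z ^ N)"
    by (metis norm_mult)
  also have "\<dots> \<le> 2"
    using norm_triangle_ineq4[of 1 "?z ^ N"] by (simp add: norm_power)
  finally have "(cmod (1 - ?z) * cmod (\<Sum>j<N. cis (real j * (- 2 * pi * t))))\<^sup>2 \<le> 2\<^sup>2"
    by (intro power_mono) auto
  then show ?thesis
    by (simp add: fejer_def power_mult_distrib divide_right_mono mult.commute)
qed

lemma fejer_borel [measurable]: "fejer N \<in> borel_measurable borel"
  unfolding fejer_def
  by (intro borel_measurable_divide borel_measurable_continuous_onI continuous_intros)

lemma fejer_le: "fejer N t \<le> N"
proof -
  have "cmod (\<Sum>j<N. cis (real j * (- 2 * pi * t))) \<le> N"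
    using norm_sum[of "\<lambda>j. cis (real j * (- 2 * pi * t))" "{..<N}"] by simp
  then have "(cmod (\<Sum>j<N. cis (real j * (- 2 * pi * t))))\<^sup>2 \<le> (real N)\<^sup>2"
    by (intro power_mono) auto
  then have "fejer N t \<le> (real N)\<^sup>2 / N" unfolding fejer_def by (intro divide_right_mono) auto
  then show ?thesis by (cases "N = 0") (simp_all add: power2_eq_square)
qed

abbreviation unit_ivl :: "real set" where "unit_ivl \<equiv> {- 1/2..<1/2}"

text \<open>Orthogonality of characters: for \<open>a \<noteq> 0\<close> the primitive has period 1.
  The fundamental theorem is applied on the closed interval, which differs by a single
  point.\<close>

lemma integral_cis_unit_ivl:
  "(LINT t|lborel. indicator unit_ivl t *\<^sub>R cis (- 2 * pi * of_int a * t)) = of_bool (a = 0)"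
proof -
  have "(LINT t|lborel. indicator unit_ivl t *\<^sub>R cis (- 2 * pi * of_int a * t)) =
     (LINT t|lborel. indicator {- 1/2..1/2} t *\<^sub>R cis (- 2 * pi * of_int a * t))"
  proof (rule integral_cong_AE)
    have "AE t in lborel. t \<noteq> (1/2::real)" by (rule AE_lborel_singleton)
    then show "AE t in lborel. indicator unit_ivl t *\<^sub>R cis (- 2 * pi * of_int a * t) =
       indicator {- 1/2..1/2} t *\<^sub>R cis (- 2 * pi * of_int a * t)"
      by eventually_elim (auto simp: indicator_def)
  qed measurable
  also have "\<dots> = of_bool (a = 0)"
  proof (cases "a = 0")
    case False
    let ?c = "- 2 * pi * of_int a :: real"
    let ?F = "\<lambda>t. cis (?c * t) / (\<i> * of_real ?c)"
    have "(?F has_vector_derivative cis (?c * t)) (at t within {- 1/2..1/2})" for t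
    proof -
      have "((\<lambda>t. complex_of_real t * (\<i> * of_real ?c)) has_vector_derivative \<i> * of_real ?c) (at t)"
        by (auto intro!: derivative_eq_intros simp: scaleR_conv_of_real)
      from has_vector_derivative_at_within[OF field_vector_diff_chain_at[OF this DERIV_exp]]
      have "((\<lambda>t. cis (?c * t)) has_vector_derivative (\<i> * of_real ?c) * cis (?c * t)) (at t within {- 1/2..1/2})"
        by (simp add: o_def cis_conv_exp mult_ac)
      then show ?thesis
        using has_vector_derivative_divide[of "\<lambda>t. cis (?c * t)" "(\<i> * of_real ?c) * cis (?c * t)" _ "\<i> * of_real ?c"] False
        by simp
    qed
    then have "(LINT t|lborel. indicator {- 1/2..1/2} t *\<^sub>R cis (?c * t)) = ?F (1/2) - ?F (- 1/2)"
      by (intro integral_FTC_Icc continuous_intros) auto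
    also have "cis (?c * (1/2)) = cis (?c * (- 1/2))"
    proof -
      have "cis (?c * (1/2)) = cis (?c * (- 1/2)) * cis (?c)" by (simp add: cis_mult)
      moreover have "cis ?c = 1"
        using cis_multiple_2pi[of "- of_int a"] by (simp add: mult_ac)
      ultimately show ?thesis by simp
    qed
    finally show ?thesis using False by simp
  qed simp
  finally show ?thesis .
qed

lemma integral_fejer: 
  assumes "N > 0"
  shows "(LINT t|lborel. indicator unit_ivl t * fejer N t) = 1"
proof -
  have "complex_of_real (LINT t|lborel. indicator unit_ivl t * fejer N t) =
     (LINT t|lborel. (\<Sum>a\<in>{- int N..int N}. of_real (1 - \<bar>of_int a\<bar> / N) * (indicator unit_ivl t *\<^sub>R cis (- 2 * pi * of_int a * t))))"
    unfolding integral_complex_of_real[symmetric] of_real_mult fejer_expansion[OF assms] sum_distrib_left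
    by (intro Bochner_Integration.integral_cong refl sum.cong) (auto simp: indicator_def)
  also have "\<dots> = (\<Sum>a\<in>{- int N..int N}. of_real (1 - \<bar>of_int a\<bar> / N) * of_bool (a = 0))"
  proof (subst Bochner_Integration.integral_sum)
    have *: "integrable lborel (\<lambda>t. indicator unit_ivl t *\<^sub>R cis (- 2 * pi * of_int a * t))" for a
    proof (rule integrableI_bounded_set[of unit_ivl _ _ 1])
      show "(\<lambda>t. indicator unit_ivl t *\<^sub>R cis (- 2 * pi * of_int a * t)) \<in> borel_measurable lborel"
        by measurable
    qed (auto simp: indicator_def)
    then show "integrable lborel (\<lambda>t. of_real (1 - \<bar>of_int a\<bar> / N) * (indicator unit_ivl t *\<^sub>R cis (- 2 * pi * of_int a * t)))" for a
      by (rule integrable_mult_right)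
    show "(\<Sum>a\<in>{- int N..int N}. LINT t|lborel. of_real (1 - \<bar>of_int a\<bar> / N) * (indicator unit_ivl t *\<^sub>R cis (- 2 * pi * of_int a * t))) =
      (\<Sum>a\<in>{- int N..int N}. of_real (1 - \<bar>of_int a\<bar> / N) * of_bool (a = 0))"
      by (simp only: integral_mult_right_zero integral_cis_unit_ivl)
  qed
  also have "\<dots> = (\<Sum>a\<in>{0}. of_real (1 - \<bar>of_int a\<bar> / N) * of_bool (a = 0))"
    by (rule sum.mono_neutral_right) auto
  also have "\<dots> = 1" by simp
  finally show ?thesis using of_real_eq_1_iff by blast
qed

text \<open>Lebesgue measure on vectors is the image of a product measure indexed by
  \<open>Basis\<close>. The bijection of \<open>i\<close> with \<open>axis i 1\<close>, inverted by
  \<open>k\<close>, turns this into a product over coordinates.\<close>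

lemma lborel_integral_prod_cart:
  fixes \<phi> :: "'n::finite \<Rightarrow> real \<Rightarrow> 'b::{real_normed_field, banach, second_countable_topology}"
  assumes "\<And>i. integrable lborel (\<phi> i)"
  shows "(LINT x|lborel. (\<Prod>i\<in>UNIV. \<phi> i ((x :: real^'n) $ i))) = (\<Prod>i\<in>UNIV. LINT t|lborel. \<phi> i t)"
proof -
  let ?b = "\<lambda>i. axis i 1 :: real^'n"
  define k where "k = inv_into UNIV ?b"
  have inj: "inj ?b" by (auto simp: inj_def axis_eq_axis)
  have B: "(Basis :: (real^'n) set) = range ?b" by (auto simp: Basis_vec_def)
  have k: "k (?b i) = i" for i unfolding k_def by (rule inv_f_f[OF inj])
  have [measurable]: "\<phi> i \<in> borel_measurable borel" for i using assms[of i] by auto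
  interpret product_sigma_finite "\<lambda>_::real^'n. lborel :: real measure" ..
  let ?P = "\<Pi>\<^sub>M b\<in>(Basis :: (real^'n) set). (lborel :: real measure)"
  let ?T = "\<lambda>f. \<Sum>b\<in>(Basis :: (real^'n) set). f b *\<^sub>R b"
  have lb: "(lborel :: (real^'n) measure) = distr ?P borel ?T"
    unfolding lborel_def[where 'a = "real^'n"] lborel_eq_real ..
  have T: "?T \<in> ?P \<rightarrow>\<^sub>M borel" by measurable
  have meas [measurable]: "(\<lambda>x :: real^'n. \<Prod>i\<in>UNIV. \<phi> i (x $ i)) \<in> borel_measurable borel"
  proof -
    have "(\<lambda>x :: real^'n. \<phi> i (x $ i)) \<in> borel_measurable borel" for i
      by (rule measurable_compose[of "\<lambda>x. x $ i" borel borel]) (auto intro!: borel_measurable_continuous_onI continuous_intros)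
    then show ?thesis by measurable
  qed
  have eq: "(\<Prod>i\<in>UNIV. \<phi> i (?T f $ i)) = (\<Prod>b\<in>Basis. \<phi> (k b) (f b))" for f
  proof -
    have "?T f $ i = f (?b i)" for i
      using inner_sum_left_Basis[of "?b i" f] by (simp add: B inner_axis)
    then show ?thesis unfolding B by (subst prod.reindex[OF inj]) (simp add: k)
  qed
  have "(LINT x|lborel. (\<Prod>i\<in>UNIV. \<phi> i (x $ i))) = (LINT f|?P. (\<Prod>b\<in>Basis. \<phi> (k b) (f b)))"
    unfolding lb integral_distr[OF T meas] eq ..
  also have "\<dots> = (\<Prod>b\<in>Basis. LINT t|lborel. \<phi> (k b) t)"
    by (rule product_integral_prod) (use assms in auto)
  also have "\<dots> = (\<Prod>i\<in>UNIV. LINT t|lborel. \<phi> i t)"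
    unfolding B by (subst prod.reindex[OF inj]) (simp add: k)
  finally show "(LINT x|lborel. (\<Prod>i\<in>UNIV. \<phi> i (x $ i))) = (\<Prod>i\<in>UNIV. LINT t|lborel. \<phi> i t)" .
qed

section \<open>The Fejer kernel in n dimensions\<close>

definition fejer_kernel :: "nat \<Rightarrow> real^'n \<Rightarrow> real" where
  "fejer_kernel N x = (\<Prod>i\<in>UNIV. fejer N (x $ i))"

lemma fejer_kernel_nonneg [simp]: "fejer_kernel N x \<ge> 0"
  by (simp add: fejer_kernel_def prod_nonneg)

lemma borel_component [measurable]: "(\<lambda>x :: real^'n. x $ i) \<in> borel_measurable borel"
  by (intro borel_measurable_continuous_onI continuous_intros)

lemma fejer_kernel_borel [measurable]: "fejer_kernel N \<in> borel_measurable borel"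
  unfolding fejer_kernel_def by measurable

lemma fejer_kernel_le: "fejer_kernel N (x :: real^'n) \<le> real N ^ CARD('n)"
proof -
  have "fejer_kernel N x \<le> (\<Prod>i\<in>(UNIV :: 'n set). real N)"
    unfolding fejer_kernel_def by (intro prod_mono) (auto simp: fejer_le)
  then show ?thesis by simp
qed

lemma cis_2pi_int: "cis (2 * pi * of_int a) = 1"
  using cis_multiple_2pi[of "of_int a"] by simp

lemma fejer_add_int: "fejer N (t + of_int a) = fejer N t"
proof -
  have "cis (real j * (- 2 * pi * (t + of_int a))) = cis (real j * (- 2 * pi * t))" for j
  proof -
    have "cis (real j * (- 2 * pi * (t + of_int a))) =
       cis (real j * (- 2 * pi * t)) * cis (2 * pi * of_int (- int j * a))"
      by (simp add: cis_mult algebra_simps)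
    then show ?thesis by (simp only: cis_2pi_int mult_1_right)
  qed
  then show ?thesis by (simp only: fejer_def)
qed

lemma fejer_kernel_add_ivec: "fejer_kernel N (x + ivec z) = fejer_kernel N x"
  by (simp add: fejer_kernel_def fejer_add_int)

lemma indicator_half_cube:
  "indicator half_cube (x :: real^'n) = (\<Prod>i\<in>UNIV. indicator unit_ivl (x $ i) :: real)"
proof (cases "x \<in> half_cube")
  case True
  then have "(\<Prod>i\<in>UNIV. indicator unit_ivl (x $ i) :: real) = 1"
    by (intro prod.neutral) (auto simp: half_cube_def)
  then show ?thesis using True by simp
next
  case False
  then obtain i where "x $ i \<notin> unit_ivl" by (auto simp: half_cube_def)
  then have "indicator unit_ivl (x $ i) = (0::real)" by (rule indicator_simps)
  then have "(\<Prod>i\<in>UNIV. indicator unit_ivl (x $ i) :: real) = 0"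
    by (intro prod_zero bexI[of _ i] finite UNIV_I)
  then show ?thesis using False by simp
qed

lemma integrable_bounded_unit_ivl:
  fixes f :: "real \<Rightarrow> real"
  assumes [measurable]: "f \<in> borel_measurable borel" and "\<And>t. \<bar>f t\<bar> \<le> B"
  shows "integrable lborel (\<lambda>t. indicator unit_ivl t * f t)"
  by (rule integrableI_bounded_set[of unit_ivl _ _ B])
    (use assms(2) in \<open>auto simp: indicator_def intro: order_trans[OF abs_ge_zero]\<close>)

lemma integrable_bounded_half_cube:
  fixes f :: "real^'n \<Rightarrow> 'b::{banach, second_countable_topology}"
  assumes [measurable]: "f \<in> borel_measurable borel" and "\<And>x. x \<in> half_cube \<Longrightarrow> norm (f x) \<le> B"
  shows "integrable lborel (\<lambda>x. indicator half_cube x *\<^sub>R f x)"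
  by (rule integrableI_bounded_set[of half_cube _ _ "max B 0"])
    (use assms(2) in \<open>auto simp: indicator_def max.coboundedI1\<close>)

lemma integral_fejer_kernel:
  assumes "N > 0"
  shows "(LINT x|lborel. indicator half_cube (x :: real^'n) * fejer_kernel N x) = 1"
proof -
  have "(LINT x|lborel. indicator half_cube (x :: real^'n) * fejer_kernel N x) =
     (LINT x|lborel. (\<Prod>i\<in>(UNIV :: 'n set). indicator unit_ivl (x $ i) * fejer N (x $ i)))"
    unfolding indicator_half_cube fejer_kernel_def prod.distrib ..
  also have "\<dots> = (\<Prod>i\<in>(UNIV :: 'n set). LINT t|lborel. indicator unit_ivl t * fejer N t)"
    by (intro lborel_integral_prod_cart integrable_bounded_unit_ivl[of _ "real N"]) (auto simp: fejer_le)
  also have "\<dots> = 1" unfolding integral_fejer[OF assms] by simp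
  finally show ?thesis .
qed

text \<open>The extra weight vanishes at 0 and is bounded below where the \<open>i\<close>-th
  coordinate is away from 0, so this is a variance estimate. Only the \<open>i\<close>-th factor is
  affected: \<open>fejer_bound\<close> gives \<open>4 / N\<close> there, and the others integrate to
  1.\<close>

lemma integral_fejer_kernel_concentration:
  assumes "N > 0"
  shows "(LINT x|lborel. indicator half_cube (x :: real^'n) *
           (fejer_kernel N x * (cmod (1 - cis (- 2 * pi * (x $ i))))\<^sup>2)) \<le> 4 / N"
    (is "?I \<le> _")
proof -
  let ?d = "\<lambda>t. (cmod (1 - cis (- 2 * pi * t)))\<^sup>2"
  define \<phi> where "\<phi> j t = indicator unit_ivl t * (fejer N t * (if j = i then ?d t else 1))" for j :: 'n and t
  have d: "0 \<le> ?d t" "?d t \<le> 4" for t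
  proof -
    have "cmod (1 - cis (- 2 * pi * t)) \<le> 2"
      using norm_triangle_ineq4[of 1 "cis (- 2 * pi * t)"] by simp
    then have "?d t \<le> 2\<^sup>2" by (intro power_mono) auto
    then show "?d t \<le> 4" by simp
  qed simp
  have int: "integrable lborel (\<phi> j)" for j
    unfolding \<phi>_def
  proof (rule integrable_bounded_unit_ivl[of _ "real N * 4"])
    show "\<bar>fejer N t * (if j = i then ?d t else 1)\<bar> \<le> real N * 4" for t
      using d[of t] fejer_le[of N t] unfolding abs_mult by (intro mult_mono) auto
  qed measurable
  have "(\<Prod>j\<in>UNIV. \<phi> j (x $ j)) = indicator half_cube x * (fejer_kernel N x * ?d (x $ i))" for x
    unfolding indicator_half_cube fejer_kernel_def \<phi>_def prod.distrib by simp
  then have "?I = (LINT x|lborel. (\<Prod>j\<in>UNIV. \<phi> j (x $ j)))" by (simp only:)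
  also have "\<dots> = (\<Prod>j\<in>UNIV. LINT t|lborel. \<phi> j t)"
    by (rule lborel_integral_prod_cart[of \<phi>, OF int])
  also have "\<dots> = (\<Prod>j\<in>UNIV. if j = i then LINT t|lborel. \<phi> i t else 1)"
    
  proof (intro prod.cong refl)
    fix j
    show "(LINT t|lborel. \<phi> j t) = (if j = i then LINT t|lborel. \<phi> i t else 1)"
    proof (cases "j = i")
      case False
      then have "\<phi> j = (\<lambda>t. indicator unit_ivl t * fejer N t)" by (auto simp: \<phi>_def)
      then show ?thesis using False by (simp only: integral_fejer[OF assms] if_False)
    qed simp
  qed
  also have "\<dots> = (LINT t|lborel. \<phi> i t)" by simp
  also have "\<dots> \<le> (LINT t|lborel. indicator unit_ivl t * (4 / N))"
  proof (rule integral_mono[OF int])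
    show "integrable lborel (\<lambda>t. indicator unit_ivl t * (4 / N))"
      by (rule integrable_bounded_unit_ivl[of _ "4 / N"]) auto
    show "\<phi> i t \<le> indicator unit_ivl t * (4 / N)" for t
      using fejer_bound[of N t] unfolding \<phi>_def by (simp add: indicator_def)
  qed
  also have "\<dots> = 4 / N"
    by simp
  finally show ?thesis .
qed

text \<open>Argument in the manner of Chebyshev: on the whole cell \<open>|f x - f 0|\<close> is at
  most \<open>\<epsilon>/2\<close> plus a constant times the concentration weights. Integrating this
  pointwise bound against the kernel replaces a splitting of the domain.\<close>

lemma fejer_kernel_approximate_identity:
  fixes f :: "real^'n \<Rightarrow> complex"
  assumes [measurable]: "f \<in> borel_measurable borel"
    and B: "\<And>x. x \<in> half_cube \<Longrightarrow> norm (f x) \<le> B"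
    and cont: "continuous (at 0) f"
  shows "(\<lambda>N. LINT x|lborel. indicator half_cube x *\<^sub>R (fejer_kernel N x *\<^sub>R f x)) \<longlonglongrightarrow> f 0"
proof (rule LIMSEQ_I)
  fix \<epsilon> :: real assume \<epsilon>: "\<epsilon> > 0"
  let ?d = "\<lambda>t. (cmod (1 - cis (- 2 * pi * t)))\<^sup>2"
  let ?W = "\<lambda>x :: real^'n. \<Sum>i\<in>UNIV. ?d (x $ i)"
  have "0 \<in> (half_cube :: (real^'n) set)" by (simp add: half_cube_def)
  then have B0: "norm (f 0) \<le> B" "B \<ge> 0" using B[of 0] order_trans[OF norm_ge_zero] by blast+
  obtain \<delta> where \<delta>: "\<delta> > 0" "\<And>x. norm x < \<delta> \<Longrightarrow> norm (f x - f 0) < \<epsilon> / 2"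
    using cont \<epsilon> half_gt_zero[OF \<epsilon>] unfolding continuous_at_eps_delta by (metis dist_norm diff_zero)
  \<comment> \<open>A point of norm at least \<open>\<delta>\<close> has a coordinate of size at
    least \<open>\<delta> / n\<close>. The cap at 1/2 keeps \<open>2 pi \<eta>\<close> in the range
    where the cosine decreases.\<close>
  define \<eta> where "\<eta> = min (\<delta> / CARD('n)) (1/2)"
  have \<eta>: "\<eta> > 0" "\<eta> \<le> 1/2" using \<delta> min.cobounded2[of "\<delta> / CARD('n)" "1/2"] unfolding \<eta>_def by auto
  \<comment> \<open>The value \<open>|1 - cis (2 pi \<eta>)|^2\<close>, the least weight on
    \<open>\<eta> \<le> |t| \<le> 1/2\<close>.\<close>
  define c where "c = 2 - 2 * cos (2 * pi * \<eta>)"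
  have "cos (2 * pi * \<eta>) < cos 0"
    using \<eta> by (intro cos_monotone_0_pi) auto
  then have c: "c > 0" by (simp add: c_def)
  have dc: "?d t \<ge> c" if "\<eta> \<le> \<bar>t\<bar>" "\<bar>t\<bar> \<le> 1/2" for t
  proof -
    have "?d t = (1 - cos (2 * pi * t))\<^sup>2 + (sin (2 * pi * t))\<^sup>2"
      by (simp add: cmod_power2)
    also have "\<dots> = 2 - 2 * cos (2 * pi * t)"
      using sin_cos_squared_add[of "2 * pi * t"] by (simp add: power2_eq_square algebra_simps)
    finally have d: "?d t = 2 - 2 * cos (2 * pi * \<bar>t\<bar>)" by (simp add: abs_if)
    have "cos (2 * pi * \<bar>t\<bar>) \<le> cos (2 * pi * \<eta>)"
      using that \<eta> by (intro cos_monotone_0_pi_le) auto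
    then show ?thesis unfolding d c_def by simp
  qed
  have key: "norm (f x - f 0) \<le> \<epsilon> / 2 + 2 * B / c * ?W x" if x: "x \<in> half_cube" for x
  proof (cases "norm x < \<delta>")
    case True
    have "0 \<le> 2 * B / c * ?W x" using c B0 by (intro mult_nonneg_nonneg sum_nonneg) auto
    with \<delta>(2)[OF True] show ?thesis by linarith
  next
    case False
    obtain i where i: "norm x \<le> CARD('n) * \<bar>x $ i\<bar>" using norm_le_card_component by blast
    then have "\<delta> / CARD('n) \<le> \<bar>x $ i\<bar>" using False by (simp add: field_simps)
    then have "\<eta> \<le> \<bar>x $ i\<bar>" by (simp add: \<eta>_def)
    moreover have "\<bar>x $ i\<bar> \<le> 1/2" 
    proof -
      have "- 1/2 \<le> x $ i" "x $ i < 1/2" using x unfolding half_cube_def by blast+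
      then show ?thesis by linarith
    qed
    ultimately have "c \<le> ?d (x $ i)" by (rule dc)
    also have "\<dots> \<le> ?W x" by (intro member_le_sum) auto
    finally have "2 * B / c * c \<le> 2 * B / c * ?W x" using B0 c by (intro mult_left_mono) auto
    then have "2 * B \<le> 2 * B / c * ?W x" using c by simp
    moreover have "norm (f x - f 0) \<le> 2 * B"
      using norm_triangle_ineq4[of "f x" "f 0"] B[OF x] B0 by linarith
    ultimately show ?thesis using \<epsilon> by linarith
  qed
  obtain N0 where N0: "real N0 > 2 * B / c * CARD('n) * 4 / (\<epsilon> / 2)"
    using reals_Archimedean2 by blast
  show "\<exists>N0. \<forall>N\<ge>N0. norm ((LINT x|lborel. indicator half_cube x *\<^sub>R (fejer_kernel N x *\<^sub>R f x)) - f 0) < \<epsilon>"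
  proof (intro exI[of _ "Suc N0"] allI impI)
    fix N assume "N \<ge> Suc N0"
    then have N: "N > 0" "real N > 2 * B / c * CARD('n) * 4 / (\<epsilon> / 2)" using N0 by auto
    have KB: "fejer_kernel N x \<le> real N ^ CARD('n)" for x :: "real^'n" by (rule fejer_kernel_le)
    have i1: "integrable lborel (\<lambda>x. indicator half_cube x *\<^sub>R (fejer_kernel N x *\<^sub>R f x))"
    proof (rule integrable_bounded_half_cube[of _ "real N ^ CARD('n) * B"])
      show "norm (fejer_kernel N x *\<^sub>R f x) \<le> real N ^ CARD('n) * B" if "x \<in> half_cube" for x
        using KB[of x] B[OF that] by (simp add: mult_mono)
    qed measurable
    have i2: "integrable lborel (\<lambda>x. indicator half_cube x *\<^sub>R (fejer_kernel N (x :: real^'n) *\<^sub>R f 0))"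
    proof (rule integrable_bounded_half_cube[of _ "real N ^ CARD('n) * B"])
      show "norm (fejer_kernel N (x :: real^'n) *\<^sub>R f 0) \<le> real N ^ CARD('n) * B" if "x \<in> half_cube" for x :: "real^'n"
        using KB[of x] B0 by (simp add: mult_mono)
    qed measurable
    have iK: "integrable lborel (\<lambda>x :: real^'n. indicator half_cube x * fejer_kernel N x)"
      using integrable_bounded_half_cube[of "fejer_kernel N :: real^'n \<Rightarrow> real" "real N ^ CARD('n)"] KB by simp
    have iW: "integrable lborel (\<lambda>x :: real^'n. indicator half_cube x * (fejer_kernel N x * ?d (x $ i)))" for i
    proof -
      have "integrable lborel (\<lambda>x :: real^'n. indicator half_cube x *\<^sub>R (fejer_kernel N x * ?d (x $ i)))"
      proof (rule integrable_bounded_half_cube[of _ "real N ^ CARD('n) * 2\<^sup>2"])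
        show "norm (fejer_kernel N x * ?d (x $ i)) \<le> real N ^ CARD('n) * 2\<^sup>2" for x :: "real^'n"
        proof -
          have "cmod (1 - cis (- 2 * pi * (x $ i))) \<le> 2"
            using norm_triangle_ineq4[of 1 "cis (- 2 * pi * (x $ i))"] by simp
          then have "?d (x $ i) \<le> 2\<^sup>2" by (intro power_mono) auto
          then show ?thesis using KB[of x] by (simp only: real_norm_def abs_mult abs_power2 abs_of_nonneg fejer_kernel_nonneg) (intro mult_mono, auto)
        qed
      qed measurable
      then show ?thesis by simp
    qed
    have "(LINT x|lborel. indicator half_cube x *\<^sub>R (fejer_kernel N (x :: real^'n) *\<^sub>R f 0)) =
        (LINT x|lborel. indicator half_cube (x :: real^'n) * fejer_kernel N x) *\<^sub>R f 0"
      by (subst integral_scaleR_left[symmetric]) (use iK in auto)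
    then have e0: "(LINT x|lborel. indicator half_cube x *\<^sub>R (fejer_kernel N (x :: real^'n) *\<^sub>R f 0)) = f 0"
      by (simp add: integral_fejer_kernel[OF N(1)])
    have "(LINT x|lborel. indicator half_cube x *\<^sub>R (fejer_kernel N x *\<^sub>R f x)) - f 0 =
       (LINT x|lborel. indicator half_cube x *\<^sub>R (fejer_kernel N x *\<^sub>R f x) - indicator half_cube x *\<^sub>R (fejer_kernel N (x :: real^'n) *\<^sub>R f 0))"
      by (simp only: Bochner_Integration.integral_diff[OF i1 i2] e0)
    also have "norm \<dots> \<le> (LINT x|lborel. norm (indicator half_cube x *\<^sub>R (fejer_kernel N x *\<^sub>R f x) - indicator half_cube x *\<^sub>R (fejer_kernel N (x :: real^'n) *\<^sub>R f 0)))"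
      by (rule integral_norm_bound)
    also have "\<dots> \<le> (LINT x|lborel. \<epsilon> / 2 * (indicator half_cube (x :: real^'n) * fejer_kernel N x) +
         2 * B / c * (\<Sum>i\<in>UNIV. indicator half_cube x * (fejer_kernel N x * ?d (x $ i))))"
    proof (rule integral_mono)
      show "integrable lborel (\<lambda>x. norm (indicator half_cube x *\<^sub>R (fejer_kernel N x *\<^sub>R f x) - indicator half_cube x *\<^sub>R (fejer_kernel N (x :: real^'n) *\<^sub>R f 0)))"
        using i1 i2 by (intro integrable_norm Bochner_Integration.integrable_diff)
      show "integrable lborel (\<lambda>x :: real^'n. \<epsilon> / 2 * (indicator half_cube x * fejer_kernel N x) +
         2 * B / c * (\<Sum>i\<in>UNIV. indicator half_cube x * (fejer_kernel N x * ?d (x $ i))))"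
        using iK iW by (intro Bochner_Integration.integrable_add integrable_mult_right Bochner_Integration.integrable_sum)
      fix x :: "real^'n"
      show "norm (indicator half_cube x *\<^sub>R (fejer_kernel N x *\<^sub>R f x) - indicator half_cube x *\<^sub>R (fejer_kernel N (x :: real^'n) *\<^sub>R f 0)) \<le>
        \<epsilon> / 2 * (indicator half_cube x * fejer_kernel N x) +
         2 * B / c * (\<Sum>i\<in>UNIV. indicator half_cube x * (fejer_kernel N x * ?d (x $ i)))"
      proof (cases "x \<in> half_cube")
        case True
        have "norm (fejer_kernel N x *\<^sub>R f x - fejer_kernel N (x :: real^'n) *\<^sub>R f 0) = fejer_kernel N x * norm (f x - f 0)"
          by (simp flip: scaleR_diff_right)
        also have "\<dots> \<le> fejer_kernel N x * (\<epsilon> / 2 + 2 * B / c * ?W x)"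
          by (intro mult_left_mono key True) simp
        also have "\<dots> = \<epsilon> / 2 * fejer_kernel N x + 2 * B / c * (\<Sum>i\<in>UNIV. fejer_kernel N x * ?d (x $ i))"
          unfolding sum_distrib_left[symmetric] by (simp add: algebra_simps)
        finally show ?thesis using True by simp
      qed simp
    qed
    also have "\<dots> = \<epsilon> / 2 * (LINT x|lborel. indicator half_cube (x :: real^'n) * fejer_kernel N x) +
         2 * B / c * (\<Sum>i\<in>UNIV. LINT x|lborel. indicator half_cube (x :: real^'n) * (fejer_kernel N x * ?d (x $ i)))"
      using iK iW by (simp only: Bochner_Integration.integral_add integral_mult_right_zero Bochner_Integration.integral_sum
         integrable_mult_right Bochner_Integration.integrable_sum)
    also have "\<dots> \<le> \<epsilon> / 2 * 1 + 2 * B / c * (\<Sum>i\<in>(UNIV :: 'n set). 4 / N)"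
      unfolding integral_fejer_kernel[OF N(1)]
      using B0 c by (intro add_left_mono mult_left_mono sum_mono integral_fejer_kernel_concentration N) auto
    also have "\<dots> = \<epsilon> / 2 + 2 * B / c * CARD('n) * 4 / N" by simp
    also have "2 * B / c * CARD('n) * 4 / N < \<epsilon> / 2"
    proof -
      have "2 * B / c * CARD('n) * 4 < real N * (\<epsilon> / 2)" using N(2) \<epsilon> by (subst (asm) pos_divide_less_eq) auto
      then show ?thesis using N(1) by (subst pos_divide_less_eq) (auto simp: mult.commute)
    qed
    finally show "norm ((LINT x|lborel. indicator half_cube x *\<^sub>R (fejer_kernel N x *\<^sub>R f x)) - f 0) < \<epsilon>"
      by simp
  qed
qed

text \<open>Fubini for counting measure on integer vectors times Lebesgue measure: for each
  \<open>x\<close> exactly one translate of the cell contributes, which gives both the integrability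
  of the pair function and the value of the inner sum.\<close>

lemma integral_unit_cell_tiling:
  fixes g :: "real^'n \<Rightarrow> complex"
  assumes g: "integrable lborel g"
  shows "(LINT x|lborel. g x) =
    (LINT z|count_space UNIV. LINT x|lborel. indicator half_cube x *\<^sub>R g (x + ivec z))"
proof -
  let ?C = "count_space (UNIV :: (int^'n) set)"
  have [measurable]: "g \<in> borel_measurable borel" using g by auto
  interpret C: sigma_finite_measure ?C
    by (rule sigma_finite_measure_count_space_countable) auto
  interpret pair_sigma_finite ?C "lborel :: (real^'n) measure" ..
  let ?f = "\<lambda>(z :: int^'n) x. indicator half_cube (x - ivec z) *\<^sub>R g x"
  have m: "case_prod ?f \<in> borel_measurable (?C \<Otimes>\<^sub>M lborel)"
    by (rule measurable_pair_measure_countable1) (auto intro!: borel_measurable_scaleR)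
  have one: "\<exists>z0. \<forall>z. indicator half_cube (x - ivec z) = (indicator {z0} z :: real)" for x :: "real^'n"
  proof -
    obtain z0 where "x - ivec z0 \<in> half_cube" using half_cube_tiling by blast
    then show ?thesis
      using half_cube_tiling_unique by (intro exI[of _ z0]) (auto simp: indicator_def)
  qed
  have "(\<integral>\<^sup>+w. ennreal (norm (case_prod ?f w)) \<partial>(?C \<Otimes>\<^sub>M lborel)) =
     (\<integral>\<^sup>+x. (\<integral>\<^sup>+z. ennreal (norm (?f z x)) \<partial>?C) \<partial>lborel)"
    using m by (subst nn_integral_snd[symmetric]) (auto simp: split_beta')
  also have "\<dots> = (\<integral>\<^sup>+x. ennreal (norm (g x)) \<partial>lborel)"
  proof (intro nn_integral_cong)
    fix x :: "real^'n"
    obtain z0 where z0: "\<And>z. indicator half_cube (x - ivec z) = (indicator {z0} z :: real)" using one by blast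
    have "(\<integral>\<^sup>+z. ennreal (norm (?f z x)) \<partial>?C) = (\<integral>\<^sup>+z. ennreal (norm (g x)) * indicator {z0} z \<partial>?C)"
      unfolding z0 by (intro nn_integral_cong) (auto simp: indicator_def)
    also have "\<dots> = ennreal (norm (g x))" by (subst nn_integral_cmult_indicator) auto
    finally show "(\<integral>\<^sup>+z. ennreal (norm (?f z x)) \<partial>?C) = ennreal (norm (g x))" .
  qed
  also have "\<dots> < \<infinity>" using g by (simp add: integrable_iff_bounded)
  finally have "integrable (?C \<Otimes>\<^sub>M lborel) (case_prod ?f)"
    using m by (intro integrableI_bounded)
  then have "(LINT x|lborel. LINT z|?C. ?f z x) = (LINT z|?C. LINT x|lborel. ?f z x)"
    by (rule Fubini_integral)
  moreover have "(LINT z|?C. ?f z x) = g x" for x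
  proof -
    obtain z0 where z0: "\<And>z. indicator half_cube (x - ivec z) = (indicator {z0} z :: real)" using one by blast
    show ?thesis unfolding z0 by (simp add: integral_scaleR_left)
  qed
  moreover have "(LINT x|lborel. ?f z x) = (LINT x|lborel. indicator half_cube x *\<^sub>R g (x + ivec z))" for z
    using integral_lborel_translation(1)[of "?f z" "ivec z"] by simp
  ultimately show ?thesis by simp
qed

section \<open>Cesaro weights in n dimensions\<close>

lemma prod_cis: "(\<Prod>i\<in>A. cis (f i)) = cis (\<Sum>i\<in>A. f i)"
  by (induction A rule: infinite_finite_induct) (auto simp: cis_mult)

text \<open>The cut-off matters: outside the cube factors are negative, and two of them would
  multiply to a positive weight.\<close>

definition fejer_weight :: "nat \<Rightarrow> int^'n \<Rightarrow> real" where
  "fejer_weight N m = (if \<forall>i. \<bar>m $ i\<bar> \<le> int N then \<Prod>i\<in>UNIV. (1 - \<bar>of_int (m $ i)\<bar> / N) else 0)"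

lemma finite_int_cube: "finite {m :: int^'n. \<forall>i. \<bar>m $ i\<bar> \<le> int N}"
proof (rule finite_subset)
  show "{m :: int^'n. \<forall>i. \<bar>m $ i\<bar> \<le> int N} \<subseteq> vec_lambda ` (PiE UNIV (\<lambda>_. {- int N..int N}))"
  proof
    fix m :: "int^'n" assume "m \<in> {m :: int^'n. \<forall>i. \<bar>m $ i\<bar> \<le> int N}"
    then have "(\<lambda>i. m $ i) \<in> PiE UNIV (\<lambda>_. {- int N..int N})" by (auto simp: abs_le_iff minus_le_iff)
    moreover have "m = vec_lambda (\<lambda>i. m $ i)" by simp
    ultimately show "m \<in> vec_lambda ` (PiE UNIV (\<lambda>_. {- int N..int N}))" by blast
  qed
qed (intro finite_imageI finite_PiE, auto)

lemma fejer_kernel_expansion: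
  fixes x :: "real^'n"
  assumes "N > 0"
  shows "complex_of_real (fejer_kernel N x) =
    (\<Sum>m | \<forall>i. \<bar>m $ i\<bar> \<le> int N. of_real (fejer_weight N m) * cis (- 2 * pi * (x \<bullet> ivec m)))"
proof -
  let ?w = "\<lambda>a::int. complex_of_real (1 - \<bar>of_int a\<bar> / N)"
  have "complex_of_real (fejer_kernel N x) =
     (\<Prod>i\<in>UNIV. \<Sum>a\<in>{- int N..int N}. ?w a * cis (- 2 * pi * of_int a * (x $ i)))"
    by (simp only: fejer_kernel_def of_real_prod fejer_expansion[OF assms])
  also have "\<dots> = (\<Sum>p\<in>PiE UNIV (\<lambda>_. {- int N..int N}). \<Prod>i\<in>UNIV. ?w (p i) * cis (- 2 * pi * of_int (p i) * (x $ i)))"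
    by (rule prod_sum_PiE) auto
  also have "\<dots> = (\<Sum>m | \<forall>i. \<bar>m $ i\<bar> \<le> int N. of_real (fejer_weight N m) * cis (- 2 * pi * (x \<bullet> ivec m)))"
  proof (rule sum.reindex_bij_witness[of _ "\<lambda>m i. m $ i" vec_lambda])
    fix p assume "p \<in> PiE (UNIV :: 'n set) (\<lambda>_. {- int N..int N})"
    then have p: "\<And>i. \<bar>p i\<bar> \<le> int N" by (auto simp: abs_le_iff PiE_iff minus_le_iff)
    then show "vec_lambda p \<in> {m. \<forall>i. \<bar>m $ i\<bar> \<le> int N}" by simp
    have "(\<Prod>i\<in>UNIV. ?w (p i) * cis (- 2 * pi * of_int (p i) * (x $ i))) =
       (\<Prod>i\<in>UNIV. ?w (p i)) * cis (\<Sum>i\<in>UNIV. - 2 * pi * of_int (p i) * (x $ i))"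
      by (simp only: prod.distrib prod_cis)
    also have "(\<Sum>i\<in>UNIV. - 2 * pi * of_int (p i) * (x $ i)) = - 2 * pi * (x \<bullet> ivec (vec_lambda p))"
      by (simp add: inner_vec_def sum_distrib_left mult_ac sum_negf)
    also have "(\<Prod>i\<in>UNIV. ?w (p i)) = of_real (fejer_weight N (vec_lambda p))"
      using p by (simp add: fejer_weight_def)
    finally show "of_real (fejer_weight N (vec_lambda p)) * cis (- 2 * pi * (x \<bullet> ivec (vec_lambda p))) =
      (\<Prod>i\<in>UNIV. ?w (p i) * cis (- 2 * pi * of_int (p i) * (x $ i)))" by simp
  qed (auto simp: abs_le_iff PiE_iff minus_le_iff)
  finally show ?thesis .
qed

lemma fejer_weight_bounds: "0 \<le> fejer_weight N m" "fejer_weight N m \<le> 1"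
proof -
  have "0 \<le> 1 - \<bar>of_int (m $ i)\<bar> / real N \<and> 1 - \<bar>of_int (m $ i)\<bar> / real N \<le> 1" if "\<forall>i. \<bar>m $ i\<bar> \<le> int N" for i
  proof -
    have "\<bar>of_int (m $ i)\<bar> \<le> real N" using that[rule_format, of i] by linarith
    then show ?thesis by (cases "N = 0") (auto simp: field_simps)
  qed
  then show "0 \<le> fejer_weight N m" "fejer_weight N m \<le> 1"
    unfolding fejer_weight_def by (auto intro!: prod_nonneg prod_le_1)
qed

lemma fejer_weight_tendsto: "(\<lambda>N. fejer_weight (Suc N) m) \<longlonglongrightarrow> 1"
proof -
  define M where "M = (\<Sum>i\<in>UNIV. nat \<bar>m $ i\<bar>)"
  have M: "\<bar>m $ i\<bar> \<le> int M" for i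
  proof -
    have "nat \<bar>m $ i\<bar> \<le> M" unfolding M_def by (rule member_le_sum) auto
    then show ?thesis by linarith
  qed
  have "(\<lambda>N. \<Prod>i\<in>UNIV. (1 - \<bar>of_int (m $ i)\<bar> / real (Suc N))) \<longlonglongrightarrow> (\<Prod>i\<in>(UNIV :: 'a set). (1 - 0))"
    by (intro tendsto_intros LIMSEQ_Suc[OF lim_const_over_n])
  moreover have "eventually (\<lambda>N. (\<Prod>i\<in>UNIV. (1 - \<bar>of_int (m $ i)\<bar> / real (Suc N))) = fejer_weight (Suc N) m) sequentially"
    using eventually_ge_at_top[of M]
  proof eventually_elim
    case (elim N)
    then have "\<forall>i. \<bar>m $ i\<bar> \<le> int (Suc N)" using M by (meson le_trans le_SucI of_nat_mono order_trans)
    then show ?case unfolding fejer_weight_def by simp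
  qed
  ultimately show ?thesis by (simp add: filterlim_cong)
qed

lemma lattice_basis_integer: "lattice_basis (mat 1 :: real^'n^'n) (range ivec)"
  unfolding lattice_basis_def by (simp add: invertible_det_nz)

lemma integrable_decay_lattice:
  fixes f :: "real^'n \<Rightarrow> complex"
  assumes L: "lattice_basis A L" and f: "f \<in> borel_measurable borel"
    and "\<And>x. norm (f x) \<le> B / (1 + norm x) ^ (CARD('n) + 2)"
  shows "integrable (count_space UNIV) (\<lambda>z. f (A *v ivec z))"
proof -
  obtain C where C: "\<forall>t\<ge>1. poly_growth (dirac_comb ((\<lambda>x. t *\<^sub>R x) ` L)) C"
    using poly_growth_scaled_comb[OF L] by blast
  from C[rule_format, of 1] have "poly_growth (dirac_comb L) C" by simp
  then have "integrable (dirac_comb L) f" using f assms(3) by (rule poly_growth_integrable(1))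
  then show ?thesis using lattice_comb_integral(2)[OF L f] by simp
qed

text \<open>The integral \<open>A N\<close> of \<open>h\<close> against the Fejer kernel is
  evaluated twice. The Fourier expansion of the kernel gives a Cesaro-weighted sum of
  \<open>H\<close>; the periodicity of the kernel unfolds the integral into cells, on each of which
  it tends to \<open>h\<close> at the centre. Dominated convergence over the integer vectors gives
  both limits, using summability of \<open>H\<close> on one side and the decay of \<open>h\<close>
  on the other.\<close>

lemma poisson_summation_integers:
  fixes h :: "real^'n \<Rightarrow> complex"
  defines "H \<equiv> \<lambda>m. LINT x|lborel. cis (- 2 * pi * (x \<bullet> ivec m)) * h x"
  assumes cont: "continuous_on UNIV h"
    and B: "\<And>x. norm (h x) \<le> B / (1 + norm x) ^ (CARD('n) + 2)"
    and H: "integrable (count_space UNIV) H"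
  shows "(LINT m|count_space UNIV. H m) = (LINT z|count_space UNIV. h (ivec z))"
proof -
  let ?C = "count_space (UNIV :: (int^'n) set)"
  have [measurable]: "h \<in> borel_measurable borel" using cont by (rule borel_measurable_continuous_onI)
  have B0: "B \<ge> 0" using order_trans[OF norm_ge_zero B[of 0]] by simp
  have p1: "(1 + norm x) ^ (CARD('n) + 2) \<ge> 1" for x :: "real^'n" by (intro one_le_power) simp
  have hB: "norm (h x) \<le> B" for x
  proof -
    have "B / (1 + norm x) ^ (CARD('n) + 2) \<le> B / 1"
      by (rule divide_left_mono[OF p1 B0 mult_pos_pos[OF less_le_trans[OF zero_less_one p1] zero_less_one]])
    then show ?thesis using B[of x] by (simp only: div_by_1)
  qed
  define A where "A N = (LINT x|lborel. fejer_kernel (Suc N) x *\<^sub>R h x)" for N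
  have A1: "A N = (LINT m|?C. fejer_weight (Suc N) m *\<^sub>R H m)" for N
  proof -
    let ?M = "{m :: int^'n. \<forall>i. \<bar>m $ i\<bar> \<le> int (Suc N)}"
    have int: "integrable lborel (\<lambda>x. of_real (fejer_weight (Suc N) m) * (cis (- 2 * pi * (x \<bullet> ivec m)) * h x))" for m
      by (intro integrable_mult_right poly_growth_integrable(1)[OF poly_growth_lborel, of _ B])
        (use B in \<open>auto simp: norm_mult\<close>)
    have "A N = (LINT x|lborel. (\<Sum>m\<in>?M. of_real (fejer_weight (Suc N) m) * (cis (- 2 * pi * (x \<bullet> ivec m)) * h x)))"
      unfolding A_def scaleR_conv_of_real fejer_kernel_expansion[OF zero_less_Suc] sum_distrib_right mult.assoc ..
    also have "\<dots> = (\<Sum>m\<in>?M. of_real (fejer_weight (Suc N) m) * H m)"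
      unfolding H_def by (subst Bochner_Integration.integral_sum) (use int in \<open>auto simp only: integral_mult_right_zero\<close>)
    also have "\<dots> = (LINT m|?C. fejer_weight (Suc N) m *\<^sub>R H m)"
    proof (subst lebesgue_integral_count_space_finite_support)
      have sub: "{m \<in> UNIV. fejer_weight (Suc N) m *\<^sub>R H m \<noteq> 0} \<subseteq> ?M" by (auto simp: fejer_weight_def split: if_splits)
      then show "finite {m \<in> UNIV. fejer_weight (Suc N) m *\<^sub>R H m \<noteq> 0}" by (rule finite_subset[OF _ finite_int_cube])
      show "(\<Sum>m\<in>?M. of_real (fejer_weight (Suc N) m) * H m) =
         (\<Sum>m | m \<in> UNIV \<and> fejer_weight (Suc N) m *\<^sub>R H m \<noteq> 0. fejer_weight (Suc N) m *\<^sub>R H m)"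
        using sub finite_int_cube[of "Suc N"] by (intro sum.mono_neutral_cong_right) (auto simp: scaleR_conv_of_real)
    qed
    finally show ?thesis .
  qed
  have "(\<lambda>N. LINT m|?C. fejer_weight (Suc N) m *\<^sub>R H m) \<longlonglongrightarrow> (LINT m|?C. H m)"
  proof (rule integral_dominated_convergence[of _ _ _ "\<lambda>m. norm (H m)"])
    show "AE m in ?C. (\<lambda>N. fejer_weight (Suc N) m *\<^sub>R H m) \<longlonglongrightarrow> H m"
    proof (rule AE_I2)
      fix m
      show "(\<lambda>N. fejer_weight (Suc N) m *\<^sub>R H m) \<longlonglongrightarrow> H m"
        using tendsto_scaleR[OF fejer_weight_tendsto tendsto_const, of m "H m"] by simp
    qed
    show "AE m in ?C. norm (fejer_weight (Suc N) m *\<^sub>R H m) \<le> norm (H m)" for N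
      by (intro AE_I2) (simp add: fejer_weight_bounds abs_of_nonneg mult_left_le_one_le)
  qed (use H in auto)
  then have lim1: "A \<longlonglongrightarrow> (LINT m|?C. H m)" unfolding A1[symmetric] .
  define a where "a N z = (LINT x|lborel. indicator half_cube x *\<^sub>R (fejer_kernel (Suc N) x *\<^sub>R h (x + ivec z)))" for N z
  have A2: "A N = (LINT z|?C. a N z)" for N
  proof -
    have "integrable lborel (\<lambda>x. fejer_kernel (Suc N) x *\<^sub>R h x)"
    proof (rule poly_growth_integrable(1)[OF poly_growth_lborel, of _ "real (Suc N) ^ CARD('n) * B"])
      fix x :: "real^'n"
      have "norm (fejer_kernel (Suc N) x *\<^sub>R h x) \<le> real (Suc N) ^ CARD('n) * (B / (1 + norm x) ^ (CARD('n) + 2))"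
        unfolding norm_scaleR abs_of_nonneg[OF fejer_kernel_nonneg] by (intro mult_mono fejer_kernel_le B) auto
      then show "norm (fejer_kernel (Suc N) x *\<^sub>R h x) \<le> real (Suc N) ^ CARD('n) * B / (1 + norm x) ^ (CARD('n) + 2)"
        by simp
    qed measurable
    from integral_unit_cell_tiling[OF this] show ?thesis
      unfolding A_def a_def by (simp only: fejer_kernel_add_ivec)
  qed
  have "(\<lambda>N. LINT z|?C. a N z) \<longlonglongrightarrow> (LINT z|?C. h (ivec z))"
  proof -
    \<comment> \<open>Points of the cell have norm at most \<open>n\<close>, so the decay of
      \<open>h\<close> near \<open>ivec z\<close> is that at \<open>ivec z\<close> itself up to the
      factor \<open>(1 + n)^(n+2)\<close>.\<close>
    define B' where "B' = B * (1 + real CARD('n)) ^ (CARD('n) + 2)"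
    have B'0: "B' \<ge> 0" using B0 by (simp add: B'_def)
    show ?thesis
    proof (rule integral_dominated_convergence)
      have nn: "0 \<le> B' / (1 + norm y) ^ (CARD('n) + 2)" for y :: "real^'n"
        using B'0 by (intro divide_nonneg_nonneg zero_le_power) auto
      have "integrable ?C (\<lambda>z. complex_of_real (B' / (1 + norm (mat 1 *v ivec z :: real^'n)) ^ (CARD('n) + 2)))"
      proof (rule integrable_decay_lattice[OF lattice_basis_integer, of "\<lambda>y. complex_of_real (B' / (1 + norm y) ^ (CARD('n) + 2))" B'])
        show "norm (complex_of_real (B' / (1 + norm x) ^ (CARD('n) + 2))) \<le> B' / (1 + norm x) ^ (CARD('n) + 2)" for x :: "real^'n"
          unfolding norm_of_real abs_of_nonneg[OF nn] by (rule order_refl)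
      qed measurable
      from integrable_norm[OF this]
      show "integrable ?C (\<lambda>z. B' / (1 + norm (ivec z :: real^'n)) ^ (CARD('n) + 2))"
        unfolding norm_of_real matrix_vector_mul_lid abs_of_nonneg[OF nn] .
      show "AE z in ?C. (\<lambda>N. a N z) \<longlonglongrightarrow> h (ivec z)"
      proof (rule AE_I2)
        fix z :: "int^'n"
        have "continuous (at 0) (\<lambda>x. h (x + ivec z))"
        proof -
          have "continuous_on UNIV (\<lambda>x. h (x + ivec z))"
            by (rule continuous_on_compose2[OF cont]) (auto intro!: continuous_intros)
          then show ?thesis by (simp add: continuous_on_eq_continuous_at)
        qed
        from LIMSEQ_Suc[OF fejer_kernel_approximate_identity[OF _ _ this, of B]] hB
        show "(\<lambda>N. a N z) \<longlonglongrightarrow> h (ivec z)" unfolding a_def by simp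
      qed
      show "AE z in ?C. norm (a N z) \<le> B' / (1 + norm (ivec z :: real^'n)) ^ (CARD('n) + 2)" for N
      proof (rule AE_I2)
        fix z :: "int^'n"
        let ?b = "B' / (1 + norm (ivec z :: real^'n)) ^ (CARD('n) + 2)"
        define b where "b = ?b"
        have bnd: "norm (h (x + ivec z)) \<le> b" if x: "x \<in> half_cube" for x
        proof -
          have "norm x \<le> (\<Sum>i\<in>UNIV. \<bar>x $ i\<bar>)" by (rule norm_le_l1_cart)
          also have "\<dots> \<le> (\<Sum>i\<in>(UNIV :: 'n set). 1)"
          proof (rule sum_mono)
            fix i
            have "- 1/2 \<le> x $ i" "x $ i < 1/2" using x unfolding half_cube_def by blast+
            then show "\<bar>x $ i\<bar> \<le> 1" by linarith
          qed
          finally have nx: "norm x \<le> CARD('n)" by simp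
          have "norm (ivec z) \<le> norm (x + ivec z) + norm x"
            using norm_triangle_ineq4[of "x + ivec z" x] by simp
          then have "1 + norm (ivec z) \<le> (1 + real CARD('n)) + norm (x + ivec z)" using nx by linarith
          also have "\<dots> \<le> (1 + real CARD('n)) * (1 + norm (x + ivec z))" by (simp add: algebra_simps)
          finally have "1 + norm (ivec z) \<le> (1 + real CARD('n)) * (1 + norm (x + ivec z))" .
          from decay_comparison[OF B0 norm_ge_zero norm_ge_zero this]
          have "B / (1 + norm (x + ivec z)) ^ (CARD('n) + 2) \<le> ?b" unfolding B'_def .
          then show ?thesis unfolding b_def using B[of "x + ivec z"] by linarith
        qed
        have i1: "integrable lborel (\<lambda>x. indicator half_cube x *\<^sub>R (fejer_kernel (Suc N) x *\<^sub>R h (x + ivec z)))"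
        proof (rule integrable_bounded_half_cube[of _ "real (Suc N) ^ CARD('n) * B"])
          show "norm (fejer_kernel (Suc N) x *\<^sub>R h (x + ivec z)) \<le> real (Suc N) ^ CARD('n) * B" for x
            using fejer_kernel_le[of "Suc N" x] hB[of "x + ivec z"] by (simp add: mult_mono del: of_nat_Suc)
        qed measurable
        have iK: "integrable lborel (\<lambda>x :: real^'n. indicator half_cube x *\<^sub>R fejer_kernel (Suc N) x)"
          by (rule integrable_bounded_half_cube[of _ "real (Suc N) ^ CARD('n)"])
            (use fejer_kernel_le[of "Suc N"] in \<open>auto simp del: of_nat_Suc\<close>)
        have "norm (a N z) \<le> (LINT x|lborel. norm (indicator half_cube x *\<^sub>R (fejer_kernel (Suc N) x *\<^sub>R h (x + ivec z))))"
          unfolding a_def by (rule integral_norm_bound)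
        also have "\<dots> \<le> (LINT x|lborel. (indicator half_cube (x :: real^'n) *\<^sub>R fejer_kernel (Suc N) x) * b)"
        proof (rule integral_mono[OF integrable_norm[OF i1] integrable_mult_left[OF iK]])
          fix x :: "real^'n"
          show "norm (indicator half_cube x *\<^sub>R (fejer_kernel (Suc N) x *\<^sub>R h (x + ivec z)))
             \<le> (indicator half_cube x *\<^sub>R fejer_kernel (Suc N) x) * b"
            using mult_left_mono[OF bnd fejer_kernel_nonneg, of x "Suc N" x] by (cases "x \<in> half_cube") auto
        qed
        also have "\<dots> = b"
          using integral_fejer_kernel[of "Suc N", where 'n = 'n] by simp
        finally show "norm (a N z) \<le> ?b" unfolding b_def .
      qed
    qed auto
  qed
  then have "A \<longlonglongrightarrow> (LINT z|?C. h (ivec z))" unfolding A2[symmetric] .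
  with lim1 show ?thesis by (rule LIMSEQ_unique)
qed

lemma invertible_norm_bound:
  fixes A :: "real^'n^'n"
  assumes "invertible A"
  shows "\<exists>K>0. \<forall>x. norm x \<le> K * norm (A *v x)"
proof -
  have "bounded_linear ((*v) (matrix_inv A))" by (rule matrix_vector_mul_bounded_linear)
  then obtain K where K: "K > 0" "\<And>x. norm (matrix_inv A *v x) \<le> norm x * K"
    using bounded_linear.pos_bounded by blast
  have "norm x \<le> K * norm (A *v x)" for x
    using K(2)[of "A *v x"] by (simp add: matrix_inv_mult_vec[OF assms] mult.commute)
  then show ?thesis using K(1) by blast
qed

text \<open>Substituting the dual basis matrix turns the frequencies \<open>A *v ivec m\<close> into
  integer vectors and \<open>f\<close> into \<open>h\<close>. Continuity and decay of
  \<open>h\<close> are enough, while \<open>fourier_decay\<close> supplies the summability on the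
  frequency side.\<close>

lemma poisson_summation_lattice:
  fixes f :: "real^'n \<Rightarrow> complex"
  assumes L: "lattice_basis A L" and f: "schwartz f"
  shows "(LINT x|dirac_comb L. fourier f x) = (LINT y|dirac_comb (dual_lattice L). f y) / \<bar>det A\<bar>"
proof -
  let ?B = "transpose (matrix_inv A)"
  have inv: "invertible A" using L by (simp add: lattice_basis_def)
  note L' = lattice_basis_dual[OF L]
  have inv': "invertible ?B" using L' by (simp add: lattice_basis_def)
  have det: "\<bar>det A\<bar> > 0" using lattice_basis_det_pos[OF L] .
  have detB: "\<bar>det ?B\<bar> = 1 / \<bar>det A\<bar>" by (simp add: det_transpose det_matrix_inv[OF inv])
  note [measurable] = schwartz_borel[OF f]
  define h where "h x = f (?B *v x)" for x
  have cB: "continuous_on UNIV ((*v) ?B)"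
    by (intro linear_continuous_on matrix_vector_mul_bounded_linear)
  have cont: "continuous_on UNIV h"
    unfolding h_def by (rule continuous_on_compose2[OF schwartz_continuous[OF f] cB]) auto
  have F: "fourier f (A *v ivec m) = \<bar>det ?B\<bar> *\<^sub>R (LINT x|lborel. cis (- 2 * pi * (x \<bullet> ivec m)) * h x)" for m
  proof -
    have "fourier f (A *v ivec m) = \<bar>det ?B\<bar> *\<^sub>R (LINT x|lborel. exp (- 2 * pi * \<i> * complex_of_real ((?B *v x) \<bullet> (A *v ivec m))) * f (?B *v x))"
      unfolding fourier_def by (rule lborel_integral_matrix[OF inv']) measurable
    moreover have "(?B *v x) \<bullet> (A *v ivec m) = x \<bullet> ivec m" for x
    proof -
      have "(?B *v x) \<bullet> (A *v ivec m) = x \<bullet> (matrix_inv A *v (A *v ivec m))"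
        by (simp add: dot_lmul_matrix)
      then show ?thesis by (simp only: matrix_inv_mult_vec[OF inv])
    qed
    ultimately show ?thesis unfolding h_def cis_conv_exp by (simp add: mult_ac)
  qed
  obtain K where K: "K > 0" "\<And>x. norm x \<le> K * norm (?B *v x)"
    using invertible_norm_bound[OF inv'] by blast
  define S where "S = schwartz_norm (CARD('n) + 2) f"
  have S: "norm (f x) \<le> S / (1 + norm x) ^ (CARD('n) + 2)" for x
    unfolding S_def by (rule schwartz_decay[OF f])
  have S0: "S \<ge> 0" using order_trans[OF norm_ge_zero S[of 0]] by simp
  have hB: "norm (h x) \<le> (S * (1 + K) ^ (CARD('n) + 2)) / (1 + norm x) ^ (CARD('n) + 2)" for x
  proof -
    have "1 + norm x \<le> (1 + K) * (1 + norm (?B *v x))"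
      using K(1) K(2)[of x] by (simp add: algebra_simps add_increasing)
    from decay_comparison[OF S0 norm_ge_zero norm_ge_zero this]
    have "S / (1 + norm (?B *v x)) ^ (CARD('n) + 2) \<le> S * (1 + K) ^ (CARD('n) + 2) / (1 + norm x) ^ (CARD('n) + 2)" .
    then show ?thesis unfolding h_def using S[of "?B *v x"] by linarith
  qed
  obtain C where C: "\<And>y. norm (fourier f y) \<le> C / (1 + norm y) ^ (CARD('n) + 2)"
    using fourier_decay[OF f] by blast
  note fm = fourier_borel[OF f]
  have intF: "integrable (count_space UNIV) (\<lambda>m. fourier f (A *v ivec m))"
    by (rule integrable_decay_lattice[OF L fm C])
  have "integrable (count_space UNIV) (\<lambda>m. \<bar>det A\<bar> *\<^sub>R fourier f (A *v ivec m))"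
    using intF by (rule integrable_scaleR_right)
  then have intH: "integrable (count_space UNIV) (\<lambda>m. LINT x|lborel. cis (- 2 * pi * (x \<bullet> ivec m)) * h x)"
    unfolding F detB using det by simp
  have "(LINT x|dirac_comb L. fourier f x) = (LINT m|count_space UNIV. fourier f (A *v ivec m))"
    by (rule lattice_comb_integral(1)[OF L fm])
  also have "\<dots> = \<bar>det ?B\<bar> *\<^sub>R (LINT m|count_space UNIV. LINT x|lborel. cis (- 2 * pi * (x \<bullet> ivec m)) * h x)"
    unfolding F by (rule integral_scaleR_right)
  also have "\<dots> = \<bar>det ?B\<bar> *\<^sub>R (LINT z|count_space UNIV. h (ivec z))"
    unfolding poisson_summation_integers[OF cont hB intH] ..
  also have "(LINT z|count_space UNIV. h (ivec z)) = (LINT y|dirac_comb (dual_lattice L). f y)"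
    unfolding h_def by (rule lattice_comb_integral(1)[OF L' schwartz_borel[OF f], symmetric])
  finally show ?thesis unfolding detB scaleR_conv_of_real by simp
qed

section \<open>Series of lattice combs\<close>

text \<open>Counting measure on the whole space with a density, pushed to the Borel sets. Point
  masses can be read off and pure-pointness is built in, even if the weight lives on a dense
  set.\<close>

definition weighted_comb :: "(real^'n \<Rightarrow> real) \<Rightarrow> (real^'n) measure" where
  "weighted_comb w = distr (density (count_space UNIV) (\<lambda>x. ennreal (w x))) borel (\<lambda>x. x)"

lemma sets_weighted_comb [simp, measurable_cong]: "sets (weighted_comb w) = sets borel"
  by (simp add: weighted_comb_def)

lemma emeasure_weighted_comb:
  assumes "B \<in> sets borel"
  shows "emeasure (weighted_comb w) B = (\<integral>\<^sup>+x. ennreal (w x) * indicator B x \<partial>count_space UNIV)"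
  unfolding weighted_comb_def using assms by (subst emeasure_distr) (auto simp: emeasure_density)

lemma emeasure_weighted_comb_singleton: "emeasure (weighted_comb w) {x} = ennreal (w x)"
  by (subst emeasure_weighted_comb) (auto simp: mult.commute nn_integral_count_space_indicator)

lemma pure_point_weighted_comb: "pure_point (weighted_comb w)"
  unfolding pure_point_def emeasure_weighted_comb_singleton
  by (auto simp: emeasure_weighted_comb nn_integral_count_space_indicator)

lemma dirac_comb_eq_weighted_comb:
  fixes S :: "(real^'n) set"
  shows "dirac_comb S = weighted_comb (indicator S)"
proof (rule measure_eqI)
  fix B :: "(real^'n) set" assume "B \<in> sets (dirac_comb S)"
  then have B: "B \<in> sets borel" by simp
  have "emeasure (dirac_comb S) B = (\<integral>\<^sup>+x. indicator (B \<inter> S) x \<partial>count_space UNIV)"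
    by (simp add: emeasure_dirac_comb[OF B])
  also have "\<dots> = emeasure (weighted_comb (indicator S)) B"
    unfolding emeasure_weighted_comb[OF B] by (intro nn_integral_cong) (auto simp: indicator_def)
  finally show "emeasure (dirac_comb S) B = emeasure (weighted_comb (indicator S)) B" .
qed simp

lemma integral_weighted_comb:
  fixes f :: "real^'n \<Rightarrow> complex"
  assumes w: "\<And>x. w x \<ge> 0" and f: "f \<in> borel_measurable borel"
  shows "(LINT x|weighted_comb w. f x) = (LINT x|count_space UNIV. w x *\<^sub>R f x)"
    and "integrable (weighted_comb w) f \<longleftrightarrow> integrable (count_space UNIV) (\<lambda>x. w x *\<^sub>R f x)"
proof -
  have id: "(\<lambda>x. x) \<in> density (count_space UNIV) (\<lambda>x. ennreal (w x)) \<rightarrow>\<^sub>M (borel :: (real^'n) measure)"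
    by simp
  show "(LINT x|weighted_comb w. f x) = (LINT x|count_space UNIV. w x *\<^sub>R f x)"
    unfolding weighted_comb_def integral_distr[OF id f] using w by (subst integral_density) auto
  show "integrable (weighted_comb w) f \<longleftrightarrow> integrable (count_space UNIV) (\<lambda>x. w x *\<^sub>R f x)"
    unfolding weighted_comb_def integrable_distr_eq[OF id f] using w by (subst integrable_density) auto
qed

text \<open>The coefficients are added at each point, so the result is again a
  \<open>weighted_comb\<close>. That it is the series of the individual combs is
  \<open>emeasure_comb_series\<close>, by monotone convergence.\<close>

definition comb_series :: "(nat \<Rightarrow> real) \<Rightarrow> (nat \<Rightarrow> (real^'n) set) \<Rightarrow> (real^'n) measure" where
  "comb_series c S = weighted_comb (\<lambda>x. \<Sum>d. c d * indicator (S d) x)"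

lemma summable_comb_weight:
  fixes c :: "nat \<Rightarrow> real"
  assumes "summable c" "\<And>d. c d \<ge> 0"
  shows "summable (\<lambda>d. c d * indicator (S d) x)"
  by (rule summable_comparison_test'[OF assms(1)]) (auto simp: indicator_def assms(2))

lemma comb_weight_nonneg:
  fixes c :: "nat \<Rightarrow> real"
  assumes "summable c" "\<And>d. c d \<ge> 0"
  shows "(\<Sum>d. c d * indicator (S d) x) \<ge> 0"
  by (intro suminf_nonneg summable_comb_weight assms) (auto simp: assms(2))

lemma emeasure_comb_series:
  assumes c: "summable c" "\<And>d. c d \<ge> 0" and B: "B \<in> sets borel"
  shows "emeasure (comb_series c S) B = (\<Sum>d. ennreal (c d) * emeasure (dirac_comb (S d)) B)"
proof -
  have "emeasure (comb_series c S) B =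
     (\<integral>\<^sup>+x. (\<Sum>d. ennreal (c d) * (indicator (S d) x * indicator B x)) \<partial>count_space UNIV)"
    unfolding comb_series_def emeasure_weighted_comb[OF B]
  proof (intro nn_integral_cong)
    fix x
    have "ennreal (\<Sum>d. c d * indicator (S d) x) = (\<Sum>d. ennreal (c d * indicator (S d) x))"
      by (rule suminf_ennreal2[symmetric]) (use c in \<open>auto intro: summable_comb_weight\<close>)
    also have "\<dots> = (\<Sum>d. ennreal (c d) * indicator (S d) x)"
      by (intro suminf_cong) (auto simp: indicator_def)
    finally have e: "ennreal (\<Sum>d. c d * indicator (S d) x) = (\<Sum>d. ennreal (c d) * indicator (S d) x)" .
    show "ennreal (\<Sum>d. c d * indicator (S d) x) * indicator B x =
       (\<Sum>d. ennreal (c d) * (indicator (S d) x * indicator B x))"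
      unfolding e by (simp only: ennreal_suminf_multc[symmetric] mult.assoc)
  qed
  also have "\<dots> = (\<Sum>d. \<integral>\<^sup>+x. ennreal (c d) * (indicator (S d) x * indicator B x) \<partial>count_space UNIV)"
    by (rule nn_integral_suminf) simp
  also have "\<dots> = (\<Sum>d. ennreal (c d) * emeasure (dirac_comb (S d)) B)"
  proof (intro suminf_cong)
    fix d
    have "emeasure (dirac_comb (S d)) B = (\<integral>\<^sup>+x. indicator (S d) x * indicator B x \<partial>count_space UNIV)"
      unfolding dirac_comb_eq_weighted_comb emeasure_weighted_comb[OF B]
      by (intro nn_integral_cong) (auto simp: indicator_def)
    then show "(\<integral>\<^sup>+x. ennreal (c d) * (indicator (S d) x * indicator B x) \<partial>count_space UNIV) =
       ennreal (c d) * emeasure (dirac_comb (S d)) B"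
      by (simp add: nn_integral_cmult)
  qed
  finally show ?thesis .
qed

text \<open>Bounds are asked only where \<open>c d > 0\<close>: the application gets them from
  \<open>squarefree d\<close>, and at \<open>d = 0\<close> the scaled lattice degenerates to the
  origin.\<close>

lemma emeasure_comb_series_le:
  assumes c: "summable c" "\<And>d. c d \<ge> 0" and B: "B \<in> sets borel"
    and le: "\<And>d. c d > 0 \<Longrightarrow> emeasure (dirac_comb (S d)) B \<le> ennreal (K d)"
    and K: "\<And>d. K d \<ge> 0" "summable (\<lambda>d. c d * K d)"
  shows "emeasure (comb_series c S) B \<le> ennreal (\<Sum>d. c d * K d)"
proof -
  have "emeasure (comb_series c S) B \<le> (\<Sum>d. ennreal (c d * K d))"
    unfolding emeasure_comb_series[OF c B]
  proof (intro suminf_le summableI)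
    fix d
    show "ennreal (c d) * emeasure (dirac_comb (S d)) B \<le> ennreal (c d * K d)"
    proof (cases "c d = 0")
      case False
      then have "c d > 0" using c(2)[of d] by simp
      then show ?thesis using le[of d] K(1)[of d] c(2)[of d]
        by (simp add: ennreal_mult mult_left_mono)
    qed simp
  qed
  also have "\<dots> = ennreal (\<Sum>d. c d * K d)"
    by (rule suminf_ennreal2) (use c K in auto)
  finally show ?thesis .
qed

lemma poly_growth_comb_series:
  fixes S :: "nat \<Rightarrow> (real^'n) set"
  assumes c: "summable c" "\<And>d. c d \<ge> 0"
    and S: "\<And>d. c d > 0 \<Longrightarrow> poly_growth (dirac_comb (S d)) (K d)"
    and K: "\<And>d. K d \<ge> 0" "summable (\<lambda>d. c d * K d)"
  shows "poly_growth (comb_series c S) (\<Sum>d. c d * K d)"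
  unfolding poly_growth_def
proof (intro conjI allI impI)
  show "sets (comb_series c S) = sets borel" by (simp add: comb_series_def)
  show "(\<Sum>d. c d * K d) \<ge> 0" using c K by (intro suminf_nonneg) auto
  fix r :: real assume r: "r \<ge> 1"
  have "emeasure (comb_series c S) (ball 0 r) \<le> ennreal (\<Sum>d. c d * (K d * r ^ CARD('n)))"
  proof (rule emeasure_comb_series_le[OF c])
    show "emeasure (dirac_comb (S d)) (ball 0 r) \<le> ennreal (K d * r ^ CARD('n))" if "c d > 0" for d
      using S[OF that] r by (simp add: poly_growth_def)
    show "summable (\<lambda>d. c d * (K d * r ^ CARD('n)))"
      using summable_mult2[OF K(2), of "r ^ CARD('n)"] by (simp add: mult.assoc)
  qed (use K r in auto)
  also have "(\<Sum>d. c d * (K d * r ^ CARD('n))) = (\<Sum>d. c d * K d) * r ^ CARD('n)"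
    using suminf_mult2[OF K(2), of "r ^ CARD('n)"] by (simp add: mult.assoc)
  finally show "emeasure (comb_series c S) (ball 0 r) \<le> ennreal ((\<Sum>d. c d * K d) * r ^ CARD('n))" .
qed

text \<open>Sum and integral are exchanged over counting measure; the norms of the terms have
  integrals of order \<open>c d * K d\<close>, which is summable.\<close>

lemma integral_comb_series:
  fixes f :: "real^'n \<Rightarrow> complex" and S :: "nat \<Rightarrow> (real^'n) set"
  assumes c: "summable c" "\<And>d. c d \<ge> 0"
    and S: "\<And>d. c d > 0 \<Longrightarrow> poly_growth (dirac_comb (S d)) (K d)"
    and K: "\<And>d. K d \<ge> 0" "summable (\<lambda>d. c d * K d)"
    and f: "f \<in> borel_measurable borel"
    and B: "\<And>x. norm (f x) \<le> B / (1 + norm x) ^ (CARD('n) + 2)"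
  shows "(\<lambda>d. c d *\<^sub>R (LINT x|dirac_comb (S d). f x)) sums (LINT x|comb_series c S. f x)"
proof -
  let ?g = "\<lambda>d x. (c d * indicator (S d) x) *\<^sub>R f x"
  have B0: "B \<ge> 0" using order_trans[OF norm_ge_zero B[of 0]] by simp
  have intd: "integrable (dirac_comb (S d)) f" "(LINT x|dirac_comb (S d). norm (f x)) \<le> B * (K d * inverse_squares_sum)"
    if "c d > 0" for d
    using poly_growth_integrable[OF S[OF that] f B] by auto
  have ind: "integrable (count_space UNIV) (\<lambda>x. indicator (S d) x *\<^sub>R f x)" if "c d > 0" for d
    using intd(1)[OF that] unfolding dirac_comb_eq_weighted_comb
    by (subst (asm) integral_weighted_comb(2)[OF _ f]) auto
  have g_int: "integrable (count_space UNIV) (?g d)" for d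
  proof (cases "c d = 0")
    case False
    then have "c d > 0" using c(2)[of d] by simp
    from integrable_scaleR_right[OF ind[OF this], of "c d"] show ?thesis by simp
  qed simp
  have g_val: "(LINT x|count_space UNIV. ?g d x) = c d *\<^sub>R (LINT x|dirac_comb (S d). f x)" for d
    unfolding dirac_comb_eq_weighted_comb
    by (subst integral_weighted_comb(1)[OF _ f]) (auto simp flip: integral_scaleR_right)
  have g_norm: "(LINT x|count_space UNIV. norm (?g d x)) \<le> B * inverse_squares_sum * (c d * K d)" for d
  proof (cases "c d = 0")
    case False
    then have cd: "c d > 0" using c(2)[of d] by simp
    have fn: "(\<lambda>x. complex_of_real (norm (f x))) \<in> borel_measurable borel" using f by measurable
    \<comment> \<open>The norm is treated as a complex function so that
      \<open>integral_weighted_comb\<close> covers it.\<close>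
    have "complex_of_real (LINT x|dirac_comb (S d). norm (f x)) = (LINT x|dirac_comb (S d). complex_of_real (norm (f x)))"
      by simp
    also have "\<dots> = (LINT x|count_space UNIV. indicator (S d) x *\<^sub>R complex_of_real (norm (f x)))"
      unfolding dirac_comb_eq_weighted_comb by (rule integral_weighted_comb(1)[OF _ fn]) simp
    also have "\<dots> = (LINT x|count_space UNIV. complex_of_real (indicator (S d) x * norm (f x)))"
      by (intro Bochner_Integration.integral_cong) (auto simp: scaleR_conv_of_real)
    also have "\<dots> = complex_of_real (LINT x|count_space UNIV. indicator (S d) x * norm (f x))"
      by (rule integral_complex_of_real)
    finally have "(LINT x|count_space UNIV. indicator (S d) x * norm (f x)) = (LINT x|dirac_comb (S d). norm (f x))"
      by (metis of_real_eq_iff)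
    moreover have "(LINT x|count_space UNIV. norm (?g d x)) = c d * (LINT x|count_space UNIV. indicator (S d) x * norm (f x))"
      using cd by (subst integral_mult_right_zero[symmetric]) (auto simp: abs_mult mult.assoc intro!: Bochner_Integration.integral_cong)
    ultimately show ?thesis using mult_left_mono[OF intd(2)[OF cd], of "c d"] cd by (simp add: mult_ac)
  qed simp
  have summ: "summable (\<lambda>d. LINT x|count_space UNIV. norm (?g d x))"
    by (rule summable_comparison_test'[OF summable_mult[OF K(2), of "B * inverse_squares_sum"]])
      (use g_norm in \<open>auto intro!: integral_nonneg_AE\<close>)
  have AE: "AE x in count_space UNIV. summable (\<lambda>d. norm (?g d x))"
  proof (rule AE_I2)
    fix x
    have "summable (\<lambda>d. c d * indicator (S d) x * norm (f x))"
      by (intro summable_mult2 summable_comb_weight c)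
    then show "summable (\<lambda>d. norm (?g d x))" using c(2) by (simp add: abs_mult)
  qed
  have "(\<lambda>d. LINT x|count_space UNIV. ?g d x) sums (LINT x|count_space UNIV. (\<Sum>d. ?g d x))"
    by (rule sums_integral[OF g_int AE summ])
  moreover have "(LINT x|count_space UNIV. (\<Sum>d. ?g d x)) = (LINT x|comb_series c S. f x)"
    unfolding comb_series_def
    by (subst integral_weighted_comb(1)[OF comb_weight_nonneg[OF c] f])
      (intro Bochner_Integration.integral_cong refl suminf_scaleR_left[symmetric] summable_comb_weight c)
  ultimately show ?thesis by (simp only: g_val)
qed

text \<open>\<open>measure\<close> sends infinite mass to 0, so finiteness inside a unit ball has to
  be secured before extended values are replaced by real ones.\<close>

lemma measure_comb_series:
  fixes S :: "nat \<Rightarrow> (real^'n) set"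
  assumes c: "summable c" "\<And>d. c d \<ge> 0" and B: "B \<in> sets borel" "B \<subseteq> ball x 1"
    and le: "\<And>d x. c d > 0 \<Longrightarrow> emeasure (dirac_comb (S d)) (ball x 1) \<le> ennreal (K d)"
    and K: "\<And>d. K d \<ge> 0" "summable (\<lambda>d. c d * K d)"
  shows "(\<lambda>d. c d * measure (dirac_comb (S d)) B) sums measure (comb_series c S) B"
    and "emeasure (comb_series c S) B = ennreal (measure (comb_series c S) B)"
proof -
  have le': "emeasure (dirac_comb (S d)) B \<le> ennreal (K d)" if "c d > 0" for d
    using emeasure_mono[OF B(2), of "dirac_comb (S d)"] le[OF that, of x] by (auto intro: order_trans)
  have fin: "emeasure (dirac_comb (S d)) B = ennreal (measure (dirac_comb (S d)) B)"
     "measure (dirac_comb (S d)) B \<le> K d" if "c d > 0" for d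
  proof -
    have "emeasure (dirac_comb (S d)) B < top" using le'[OF that] le_less_trans ennreal_less_top by blast
    then show "emeasure (dirac_comb (S d)) B = ennreal (measure (dirac_comb (S d)) B)"
      by (intro emeasure_eq_ennreal_measure) auto
    with le'[OF that] show "measure (dirac_comb (S d)) B \<le> K d" using K(1)[of d] by simp
  qed
  have e: "ennreal (c d) * emeasure (dirac_comb (S d)) B = ennreal (c d * measure (dirac_comb (S d)) B)" for d
    using fin(1)[of d] c(2)[of d] by (cases "c d = 0") (auto simp: ennreal_mult)
  have sm: "summable (\<lambda>d. c d * measure (dirac_comb (S d)) B)"
  proof (rule summable_comparison_test'[OF K(2)])
    fix d :: nat
    show "norm (c d * measure (dirac_comb (S d)) B) \<le> c d * K d"
      using fin(2)[of d] c(2)[of d] by (cases "c d = 0") (auto simp: abs_mult mult_left_mono)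
  qed
  have "emeasure (comb_series c S) B = (\<Sum>d. ennreal (c d * measure (dirac_comb (S d)) B))"
    by (simp only: emeasure_comb_series[OF c B(1)] e)
  also have "\<dots> = ennreal (\<Sum>d. c d * measure (dirac_comb (S d)) B)"
    by (rule suminf_ennreal2) (use c sm in auto)
  finally have em: "emeasure (comb_series c S) B = ennreal (\<Sum>d. c d * measure (dirac_comb (S d)) B)" .
  then have m: "measure (comb_series c S) B = (\<Sum>d. c d * measure (dirac_comb (S d)) B)"
    using c by (intro measure_eq_emeasure_eq_ennreal suminf_nonneg sm) auto
  then show "(\<lambda>d. c d * measure (dirac_comb (S d)) B) sums measure (comb_series c S) B"
    using sm by (simp add: summable_sums)
  show "emeasure (comb_series c S) B = ennreal (measure (comb_series c S) B)"
    using em m by simp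
qed

text \<open>If \<open>|m|\<close> agrees inside unit balls with a positive measure
  \<open>\<rho>\<close>, every partition of a ball sums to the \<open>\<rho>\<close>-mass of the
  ball. Used with the diffraction measure itself and with the tails of its series.\<close>

lemma loc_norm_le:
  assumes sets: "sets \<rho> = sets (borel :: (real^'n) measure)"
    and m: "\<And>B x. B \<in> sets borel \<Longrightarrow> B \<subseteq> ball x 1 \<Longrightarrow> ennreal \<bar>m B\<bar> = emeasure \<rho> B"
    and K: "\<And>x. emeasure \<rho> (ball x 1) \<le> K"
  shows "loc_norm m \<le> K"
  unfolding loc_norm_def total_variation_def
proof (intro SUP_least)
  fix x :: "real^'n" and P :: "nat \<Rightarrow> (real^'n) set"
  assume "P \<in> {P. range P \<subseteq> sets borel \<and> disjoint_family P \<and> (\<Union>i. P i) = ball x 1}"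
  then have P: "range P \<subseteq> sets borel" "disjoint_family P" "(\<Union>i. P i) = ball x 1" by auto
  have "(\<Sum>i. ennreal \<bar>m (P i)\<bar>) = (\<Sum>i. emeasure \<rho> (P i))"
    using P by (intro suminf_cong m[of _ x]) auto
  also have "\<dots> = emeasure \<rho> (\<Union>i. P i)"
    by (rule suminf_emeasure) (use P sets in auto)
  finally show "(\<Sum>i. ennreal \<bar>m (P i)\<bar>) \<le> K" using P(3) K by simp
qed

section \<open>Sieving lattice points\<close>

abbreviation (input) multiples :: "nat \<Rightarrow> (real^'n) set \<Rightarrow> (real^'n) set" where
  "multiples m L \<equiv> (\<lambda>x. real m *\<^sub>R x) ` L"

section \<open>Sublattices, cosets and the Chinese remainder theorem\<close>

lemma lattice_int_combination:
  assumes L: "lattice_basis A L" and "x \<in> L" "y \<in> L"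
  shows "of_int a *\<^sub>R x + of_int b *\<^sub>R y \<in> L"
proof -
  have L: "L = range (\<lambda>z. A *v ivec z)" using L by (auto simp: lattice_basis_def)
  obtain u v where uv: "x = A *v ivec u" "y = A *v ivec v" using assms(2,3) L by auto
  have "of_int a *\<^sub>R x + of_int b *\<^sub>R y = A *v (of_int a *\<^sub>R ivec u + of_int b *\<^sub>R ivec v)"
    by (simp add: uv matrix_vector_right_distrib matrix_vector_mult_scaleR)
  also have "of_int a *\<^sub>R ivec u + of_int b *\<^sub>R ivec v = (ivec (\<chi> i. a * u $ i + b * v $ i) :: real^'a)"
    by (simp add: vec_eq_iff)
  finally show ?thesis unfolding L by blast
qed

lemma lattice_zero:
  assumes "lattice_basis A L"
  shows "0 \<in> L"
proof -
  have "A *v ivec 0 \<in> L" using assms unfolding lattice_basis_def by blast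
  from lattice_int_combination[OF assms this this, of 0 0] show ?thesis by simp
qed

lemma lattice_add: "lattice_basis A L \<Longrightarrow> x \<in> L \<Longrightarrow> y \<in> L \<Longrightarrow> x + y \<in> L"
  using lattice_int_combination[of A L x y 1 1] by simp

lemma lattice_diff: "lattice_basis A L \<Longrightarrow> x \<in> L \<Longrightarrow> y \<in> L \<Longrightarrow> x - y \<in> L"
  using lattice_int_combination[of A L x y 1 "-1"] by simp

lemma lattice_scale_int: "lattice_basis A L \<Longrightarrow> x \<in> L \<Longrightarrow> of_int a *\<^sub>R x \<in> L"
  using lattice_int_combination[of A L x x a 0] by simp

lemma lattice_scale_nat: "lattice_basis A L \<Longrightarrow> x \<in> L \<Longrightarrow> real a *\<^sub>R x \<in> L"
  using lattice_scale_int[of A L x "int a"] by simp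

lemma lattice_basis_multiples:
  "lattice_basis A L \<Longrightarrow> m \<ge> 1 \<Longrightarrow> lattice_basis (real m *\<^sub>R A) (multiples m L)"
  by (rule lattice_basis_scaleR(1)) auto

lemma multiples_mult_subset:
  assumes "lattice_basis A L"
  shows "multiples (a * b) L \<subseteq> multiples a L"
  using lattice_scale_nat[OF assms] by (force simp flip: scaleR_scaleR)

lemma multiples_subset: "lattice_basis A L \<Longrightarrow> multiples a L \<subseteq> L"
  using multiples_mult_subset[of A L 1 a] by simp

text \<open>Bezout: with \<open>u m + v n = 1\<close>, insert \<open>y = n t\<close> into the first
  part of \<open>y = u m y + v n y\<close> and \<open>y = m s\<close> into the second.\<close>

lemma multiples_coprime_Int:
  assumes L: "lattice_basis A L" and mn: "coprime m n"
  shows "multiples m L \<inter> multiples n L = multiples (m * n) L"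
proof
  show "multiples (m * n) L \<subseteq> multiples m L \<inter> multiples n L"
    using multiples_mult_subset[OF L, of m n] multiples_mult_subset[OF L, of n m] by (simp add: mult.commute)
  show "multiples m L \<inter> multiples n L \<subseteq> multiples (m * n) L"
  proof
    fix y assume "y \<in> multiples m L \<inter> multiples n L"
    then obtain s t where st: "s \<in> L" "t \<in> L" "y = real m *\<^sub>R s" "y = real n *\<^sub>R t" by auto
    obtain u v :: int where uv: "u * int m + v * int n = 1"
      using bezout_int[of "int m" "int n"] mn by (auto simp: coprime_iff_gcd_eq_1)
    then have "real_of_int u * real m + real_of_int v * real n = 1"
      by (metis of_int_1 of_int_add of_int_mult of_int_of_nat_eq)
    then have "y = (real_of_int u * real m) *\<^sub>R y + (real_of_int v * real n) *\<^sub>R y"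
      by (metis scaleR_left_distrib scaleR_one)
    also have "(real_of_int u * real m) *\<^sub>R y = (real (m * n)) *\<^sub>R (of_int u *\<^sub>R t)"
      unfolding st(4) by (simp add: mult_ac)
    also have "(real_of_int v * real n) *\<^sub>R y = (real (m * n)) *\<^sub>R (of_int v *\<^sub>R s)"
      unfolding st(3) by (simp add: mult_ac)
    finally have "y = real (m * n) *\<^sub>R (of_int u *\<^sub>R t + of_int v *\<^sub>R s)"
      by (simp only: scaleR_right_distrib)
    then show "y \<in> multiples (m * n) L" using lattice_int_combination[OF L st(2,1)] by blast
  qed
qed

lemma cosets_Int:
  assumes L: "lattice_basis A L" and mn: "coprime m n" and ab: "a \<in> L" "b \<in> L"
  obtains c where "c \<in> L"
    "\<And>x. x - a \<in> multiples m L \<and> x - b \<in> multiples n L \<longleftrightarrow> x - c \<in> multiples (m * n) L"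
proof -
  obtain u v :: int where uv: "u * int m + v * int n = 1"
    using bezout_int[of "int m" "int n"] mn by (auto simp: coprime_iff_gcd_eq_1)
  then have uv': "real_of_int u * real m + real_of_int v * real n = 1"
    by (metis of_int_1 of_int_add of_int_mult of_int_of_nat_eq)
  \<comment> \<open>The Chinese remainder solution: since \<open>u m + v n = 1\<close>, the
    difference \<open>a - c\<close> is \<open>u m (a - b)\<close> and \<open>b - c\<close> is
    \<open>v n (b - a)\<close>.\<close>
  define c where "c = of_int (v * int n) *\<^sub>R a + of_int (u * int m) *\<^sub>R b"
  have cL: "c \<in> L" unfolding c_def by (rule lattice_int_combination[OF L ab])
  have ac: "a - c = real m *\<^sub>R (of_int u *\<^sub>R (a - b))"
  proof -
    have "a = (real_of_int u * real m) *\<^sub>R a + (real_of_int v * real n) *\<^sub>R a"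
      using uv' by (metis scaleR_left_distrib scaleR_one)
    then show ?thesis unfolding c_def by (simp add: algebra_simps)
  qed
  have bc: "b - c = real n *\<^sub>R (of_int v *\<^sub>R (b - a))"
  proof -
    have "b = (real_of_int u * real m) *\<^sub>R b + (real_of_int v * real n) *\<^sub>R b"
      using uv' by (metis scaleR_left_distrib scaleR_one)
    then show ?thesis unfolding c_def by (simp add: algebra_simps)
  qed
  have acm: "a - c \<in> multiples m L"
    unfolding ac using lattice_scale_int[OF L lattice_diff[OF L ab], of u] by blast
  have bcn: "b - c \<in> multiples n L"
    unfolding bc using lattice_scale_int[OF L lattice_diff[OF L ab(2,1)], of v] by blast
  have closed: "x + y \<in> multiples j L" "x - y \<in> multiples j L" if "x \<in> multiples j L" "y \<in> multiples j L" for x y j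
    using that lattice_add[OF L] lattice_diff[OF L]
    by (auto simp flip: scaleR_right_distrib scaleR_right_diff_distrib)
  have "x - a \<in> multiples m L \<longleftrightarrow> x - c \<in> multiples m L" for x
    using closed[of "x - a" m "a - c"] closed[of "x - c" m "a - c"] acm by auto
  moreover have "x - b \<in> multiples n L \<longleftrightarrow> x - c \<in> multiples n L" for x
    using closed[of "x - b" n "b - c"] closed[of "x - c" n "b - c"] bcn by auto
  ultimately show thesis
    using that[OF cL] multiples_coprime_Int[OF L mn] by blast
qed

text \<open>Points per unit volume, in the normalisation of \<open>finite_autocorrelation\<close>;
  \<open>L\<close> itself has density \<open>1 / |det A|\<close>.\<close>

definition ball_density :: "(real^'n) set \<Rightarrow> real \<Rightarrow> real" where
  "ball_density X R = card (X \<inter> ball 0 R) / (R ^ CARD('n) * unit_ball_vol (real CARD('n)))"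

definition has_density :: "(real^'n) set \<Rightarrow> real \<Rightarrow> bool" where
  "has_density X \<delta> \<longleftrightarrow> (ball_density X \<longlongrightarrow> \<delta>) at_top"

lemma has_density_Diff:
  assumes X: "has_density X a" and Y: "has_density Y b" and "Y \<subseteq> X" "X \<subseteq> L" and L: "lattice_basis A L"
  shows "has_density (X - Y) (a - b)"
proof -
  have "ball_density (X - Y) R = ball_density X R - ball_density Y R" for R
  proof -
    have fin: "finite (X \<inter> ball 0 R)" "finite (Y \<inter> ball 0 R)"
      by (rule finite_subset[OF _ lattice_finite_ball[OF L, of 0 R]]; use assms(3,4) in auto)+
    have "(X - Y) \<inter> ball 0 R = X \<inter> ball 0 R - Y \<inter> ball 0 R" by auto
    then have "card ((X - Y) \<inter> ball 0 R) = card (X \<inter> ball 0 R) - card (Y \<inter> ball 0 R)"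
      using fin(2) assms(3) by (simp only:) (rule card_Diff_subset, auto)
    moreover have "card (Y \<inter> ball 0 R) \<le> card (X \<inter> ball 0 R)"
      using fin assms(3) by (intro card_mono) auto
    ultimately show ?thesis by (simp add: ball_density_def of_nat_diff diff_divide_distrib)
  qed
  then have e: "ball_density (X - Y) = (\<lambda>R. ball_density X R - ball_density Y R)" by (rule ext)
  show ?thesis unfolding has_density_def e
    by (rule tendsto_diff[OF X[unfolded has_density_def] Y[unfolded has_density_def]])
qed

text \<open>Translating and rescaling turns the count into one for \<open>L\<close> in a ball of
  radius \<open>R / m\<close> with centre \<open>- a / m\<close>, and
  \<open>lattice_point_count\<close> is uniform in the centre.\<close>

lemma has_density_coset:
  fixes L :: "(real^'n) set"
  assumes L: "lattice_basis A L" and m: "m \<ge> 1"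
  shows "has_density {x. x - a \<in> multiples m L} (1 / (real m ^ CARD('n) * \<bar>det A\<bar>))"
proof -
  obtain D where D: "D > 0"
    "\<And>x r. r \<ge> 0 \<Longrightarrow> card (L \<inter> ball x r) * \<bar>det A\<bar> \<le> unit_ball_vol CARD('n) * (r + D) ^ CARD('n)"
    "\<And>x r. r \<ge> D \<Longrightarrow> unit_ball_vol CARD('n) * (r - D) ^ CARD('n) \<le> card (L \<inter> ball x r) * \<bar>det A\<bar>"
    using lattice_point_count[OF L] by metis
  note det = lattice_basis_det_pos[OF L]
  let ?v = "unit_ball_vol (real CARD('n))"
  have v: "?v > 0" by simp
  have v0: "?v \<noteq> 0" using v by linarith
  let ?X = "{x. x - a \<in> multiples m L}"
  have neg: "norm (- a - y) = norm (a + y)" for y using norm_minus_cancel[of "a + y"] by simp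
  have cX: "card (?X \<inter> ball 0 R) = card (L \<inter> ball ((- a) /\<^sub>R real m) (R / real m))" for R
  proof -
    have "?X \<inter> ball 0 R = (\<lambda>y. y + a) ` (multiples m L \<inter> ball (- a) R)"
    proof (intro equalityI subsetI)
      fix x assume "x \<in> ?X \<inter> ball 0 R"
      then have "x - a \<in> multiples m L \<inter> ball (- a) R" by (auto simp: dist_norm)
      then show "x \<in> (\<lambda>y. y + a) ` (multiples m L \<inter> ball (- a) R)" by (intro image_eqI[of _ _ "x - a"]) auto
    qed (auto simp: dist_norm add.commute neg)
    then have "card (?X \<inter> ball 0 R) = card (multiples m L \<inter> ball (- a) R)"
      by (simp add: card_image inj_on_def)
    then show ?thesis using m by (simp only: card_scaled_Int_ball)
  qed
  have lo: "((\<lambda>R. (1 / real m - D / R) ^ CARD('n) / \<bar>det A\<bar>) \<longlongrightarrow> (1 / real m - 0) ^ CARD('n) / \<bar>det A\<bar>) at_top"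
    using det by (intro tendsto_intros tendsto_divide_0[OF tendsto_const] filterlim_at_top_imp_at_infinity filterlim_ident) auto
  have up: "((\<lambda>R. (1 / real m + D / R) ^ CARD('n) / \<bar>det A\<bar>) \<longlongrightarrow> (1 / real m + 0) ^ CARD('n) / \<bar>det A\<bar>) at_top"
    using det by (intro tendsto_intros tendsto_divide_0[OF tendsto_const] filterlim_at_top_imp_at_infinity filterlim_ident) auto
  have "eventually (\<lambda>R. (1 / real m - D / R) ^ CARD('n) / \<bar>det A\<bar> \<le> ball_density ?X R \<and>
      ball_density ?X R \<le> (1 / real m + D / R) ^ CARD('n) / \<bar>det A\<bar>) at_top"
    using eventually_ge_at_top[of "max 1 (D * real m)"]
  proof eventually_elim
    case (elim R)
    have R: "R > 0" "R / real m \<ge> D" "R / real m \<ge> 0" using elim m by (auto simp: field_simps)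
    let ?c = "real (card (L \<inter> ball ((- a) /\<^sub>R real m) (R / real m)))"
    have bd: "ball_density ?X R = ?c / (R ^ CARD('n) * ?v)" unfolding ball_density_def cX ..
    have e: "(R / real m + s) / R = 1 / real m + s / R" for s using R by (simp add: field_simps)
    have e2: "(R / real m - D) / R = 1 / real m - D / R" using R by (simp add: field_simps)
    have up: "?c / (R ^ CARD('n) * ?v) \<le> (1 / real m + D / R) ^ CARD('n) / \<bar>det A\<bar>"
    proof -
      have "?c \<le> ?v * (R / real m + D) ^ CARD('n) / \<bar>det A\<bar>"
        using D(2)[OF R(3)] det by (simp add: pos_le_divide_eq)
      then have "?c / (R ^ CARD('n) * ?v) \<le> (?v * (R / real m + D) ^ CARD('n) / \<bar>det A\<bar>) / (R ^ CARD('n) * ?v)"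
        using R v by (intro divide_right_mono) auto
      also have "\<dots> = ((R / real m + D) / R) ^ CARD('n) / \<bar>det A\<bar>"
        using R v0 by (simp add: power_divide)
      finally show ?thesis unfolding e .
    qed
    have "?v * (R / real m - D) ^ CARD('n) / \<bar>det A\<bar> \<le> ?c"
      using D(3)[OF R(2)] det by (simp add: pos_divide_le_eq)
    then have "(?v * (R / real m - D) ^ CARD('n) / \<bar>det A\<bar>) / (R ^ CARD('n) * ?v) \<le> ?c / (R ^ CARD('n) * ?v)"
      using R v by (intro divide_right_mono) auto
    moreover have "(?v * (R / real m - D) ^ CARD('n) / \<bar>det A\<bar>) / (R ^ CARD('n) * ?v) = ((R / real m - D) / R) ^ CARD('n) / \<bar>det A\<bar>"
      using R v0 by (simp add: power_divide)
    ultimately have "(1 / real m - D / R) ^ CARD('n) / \<bar>det A\<bar> \<le> ?c / (R ^ CARD('n) * ?v)"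
      unfolding e2 by (simp only:)
    then show ?case using up unfolding bd by simp
  qed
  then have ev: "eventually (\<lambda>R. (1 / real m - D / R) ^ CARD('n) / \<bar>det A\<bar> \<le> ball_density ?X R) at_top"
      "eventually (\<lambda>R. ball_density ?X R \<le> (1 / real m + D / R) ^ CARD('n) / \<bar>det A\<bar>) at_top"
    by (auto elim: eventually_mono)
  have "(ball_density ?X \<longlongrightarrow> (1 / real m) ^ CARD('n) / \<bar>det A\<bar>) at_top"
    by (rule tendsto_sandwich[OF ev]) (use lo up in simp_all)
  then show ?thesis unfolding has_density_def by (simp add: power_divide)
qed

text \<open>The induction needs the start inside a coset modulo \<open>m\<close>: removing the class
  of 0 or of \<open>l\<close> modulo \<open>q^k\<close> removes, by the Chinese remainder theorem, a
  coset modulo \<open>m q^k\<close> sieved by the remaining primes. The two classes coincide if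
  \<open>l\<close> lies in \<open>q^k L\<close> and are disjoint otherwise, hence the 1 or
  2.\<close>

lemma has_density_sieve:
  fixes L :: "(real^'n) set"
  assumes L: "lattice_basis A L" and l: "l \<in> L" and S: "finite S" "\<And>p. p \<in> S \<Longrightarrow> prime p"
    and "m \<ge> 1" "\<And>p. p \<in> S \<Longrightarrow> coprime m p" "a \<in> L"
  shows "has_density {x. x - a \<in> multiples m L \<and> (\<forall>p\<in>S. x \<notin> multiples (p ^ k) L \<and> x - l \<notin> multiples (p ^ k) L)}
    ((\<Prod>p\<in>S. 1 - (if l \<in> multiples (p ^ k) L then 1 else 2) / real p ^ (CARD('n) * k)) / (real m ^ CARD('n) * \<bar>det A\<bar>))"
  using S assms(5-7)
proof (induction S arbitrary: m a)
  case empty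
  then show ?case using has_density_coset[OF L] by simp
next
  case (insert q S)
  let ?\<delta> = "\<Prod>p\<in>S. 1 - (if l \<in> multiples (p ^ k) L then 1 else 2) / real p ^ (CARD('n) * k)"
  define T where "T = {x. \<forall>p\<in>S. x \<notin> multiples (p ^ k) L \<and> x - l \<notin> multiples (p ^ k) L}"
  have q: "prime q" "q > 0" using insert.prems(1) prime_gt_0_nat by auto
  have dens: "has_density {x. x - b \<in> multiples j L \<and> x \<in> T} (?\<delta> / (real j ^ CARD('n) * \<bar>det A\<bar>))"
    if "j \<ge> 1" "\<And>p. p \<in> S \<Longrightarrow> coprime j p" "b \<in> L" for j b
    using insert.IH[OF _ that] insert.prems(1) unfolding T_def by simp
  have cop: "coprime m (q ^ k)" using insert.prems(3)[of q] by simp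
  have copS: "coprime (m * q ^ k) p" if "p \<in> S" for p
  proof -
    have "coprime q p" using that insert.prems(1) insert.hyps(2) by (intro primes_coprime) auto
    then show ?thesis using insert.prems(3)[of p] that by simp
  qed
  have mq: "m * q ^ k \<ge> 1" using insert.prems(2) q by (simp add: Suc_leI)
  have sub: "has_density {x. x - a \<in> multiples m L \<and> x - b \<in> multiples (q ^ k) L \<and> x \<in> T}
      (?\<delta> / (real (m * q ^ k) ^ CARD('n) * \<bar>det A\<bar>))" if b: "b \<in> L" for b
  proof -
    obtain c where c: "c \<in> L"
      "\<And>x. x - a \<in> multiples m L \<and> x - b \<in> multiples (q ^ k) L \<longleftrightarrow> x - c \<in> multiples (m * q ^ k) L"
      using cosets_Int[OF L cop insert.prems(4) b] by blast
    have "{x. x - a \<in> multiples m L \<and> x - b \<in> multiples (q ^ k) L \<and> x \<in> T} =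
        {x. x - c \<in> multiples (m * q ^ k) L \<and> x \<in> T}"
      using c(2) by blast
    then show ?thesis using dens[OF mq copS c(1)] by simp
  qed
  \<comment> \<open>\<open>?Y\<close> and \<open>?Z\<close> are the classes of 0 and of
    \<open>l\<close> modulo \<open>q^k\<close> within \<open>?X\<close>; writing
    \<open>x - 0\<close> lets \<open>sub\<close> produce both.\<close>
  let ?X = "{x. x - a \<in> multiples m L \<and> x \<in> T}"
  let ?Y = "{x. x - a \<in> multiples m L \<and> x - 0 \<in> multiples (q ^ k) L \<and> x \<in> T}"
  let ?Z = "{x. x - a \<in> multiples m L \<and> x - l \<in> multiples (q ^ k) L \<and> x \<in> T}"
  have X: "has_density ?X (?\<delta> / (real m ^ CARD('n) * \<bar>det A\<bar>))"
    using dens insert.prems by simp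
  have XL: "?X \<subseteq> L"
  proof
    fix x assume "x \<in> ?X"
    then have "x - a \<in> L" using multiples_subset[OF L] by blast
    from lattice_add[OF L this insert.prems(4)] show "x \<in> L" by simp
  qed
  note Y = sub[OF lattice_zero[OF L]] and Z = sub[OF l]
  have closed: "x - y \<in> multiples j L" if "x \<in> multiples j L" "y \<in> multiples j L" for x y j
    using that lattice_diff[OF L] by (auto simp flip: scaleR_right_diff_distrib)
  have closed': "x + y \<in> multiples j L" if "x \<in> multiples j L" "y \<in> multiples j L" for x y j
    using that lattice_add[OF L] by (auto simp flip: scaleR_right_distrib)
  let ?goal = "{x. x - a \<in> multiples m L \<and> (\<forall>p\<in>insert q S. x \<notin> multiples (p ^ k) L \<and> x - l \<notin> multiples (p ^ k) L)}"
  have qn: "real (m * q ^ k) ^ CARD('n) = real m ^ CARD('n) * real q ^ (CARD('n) * k)"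
    by (simp add: power_mult_distrib power_mult[symmetric] mult.commute)
  have prodS: "(\<Prod>p\<in>insert q S. 1 - (if l \<in> multiples (p ^ k) L then 1 else 2) / real p ^ (CARD('n) * k)) =
     (1 - (if l \<in> multiples (q ^ k) L then 1 else 2) / real q ^ (CARD('n) * k)) * ?\<delta>"
    using insert.hyps by simp
  have alg: "d / (M * e) - i * (d / (M * Q * e)) = (1 - i / Q) * d / (M * e)" if "Q \<noteq> 0" for d M e i Q :: real
    using that by (cases "M * e = 0") (auto simp: field_simps)
  have Q: "real q ^ (CARD('n) * k) \<noteq> 0" using q by simp
  show ?case
  proof (cases "l \<in> multiples (q ^ k) L")
    case True
    have "x - l \<in> multiples (q ^ k) L \<longleftrightarrow> x \<in> multiples (q ^ k) L" for x
      using closed[OF _ True, of x] closed'[OF _ True, of "x - l"] by auto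
    then have "?goal = ?X - ?Y" unfolding T_def by auto
    moreover have "has_density (?X - ?Y) (?\<delta> / (real m ^ CARD('n) * \<bar>det A\<bar>) - ?\<delta> / (real (m * q ^ k) ^ CARD('n) * \<bar>det A\<bar>))"
      by (rule has_density_Diff[OF X Y _ XL L]) auto
    ultimately show ?thesis
      unfolding prodS qn if_P[OF True] alg[OF Q, of _ _ _ 1, symmetric] by (simp only: mult_1)
  next
    case False
    have YZ: "?Z \<subseteq> ?X - ?Y"
    proof
      fix x assume x: "x \<in> ?Z"
      have "x \<notin> multiples (q ^ k) L"
        using closed[of x "q ^ k" "x - l"] x False by auto
      then show "x \<in> ?X - ?Y" using x by auto
    qed
    have "?goal = (?X - ?Y) - ?Z" unfolding T_def by auto
    moreover have "has_density ((?X - ?Y) - ?Z) (?\<delta> / (real m ^ CARD('n) * \<bar>det A\<bar>) - ?\<delta> / (real (m * q ^ k) ^ CARD('n) * \<bar>det A\<bar>)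
        - ?\<delta> / (real (m * q ^ k) ^ CARD('n) * \<bar>det A\<bar>))"
      by (rule has_density_Diff[OF has_density_Diff[OF X Y _ XL L] Z YZ _ L]) (use XL in auto)
    moreover have "a - b - b = a - 2 * b" for a b :: real by simp
    ultimately show ?thesis
      unfolding prodS qn if_not_P[OF False] alg[OF Q, of _ _ _ 2, symmetric] by (simp only:)
  qed
qed

text \<open>\<open>GREATEST\<close> is meaningful only for a bounded set, so the content of a
  nonzero point must first be shown finite. Then a content other than 1 has a prime factor
  \<open>p\<close>, and the point lies in \<open>p^k L\<close>. The origin has infinite content and
  fails both sides.\<close>

lemma k_free_points_iff:
  fixes L :: "(real^'n) set"
  assumes L: "lattice_basis A L" and k: "k \<ge> 1"
  shows "x \<in> k_free_points k L \<longleftrightarrow> x \<in> L \<and> (\<forall>p. prime p \<longrightarrow> x \<notin> multiples (p ^ k) L)"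
proof (cases "x = 0")
  case True
  have "x \<notin> k_free_points k L" unfolding k_free_points_def k_content_def True by (simp add: one_enat_def)
  moreover have "x \<in> multiples (2 ^ k) L" using lattice_zero[OF L] True by force
  ultimately show ?thesis using two_is_prime_nat by blast
next
  case False
  let ?P = "\<lambda>c. x \<in> multiples (c ^ k) L"
  show ?thesis
  proof (cases "x \<in> L")
    case xL: True
    obtain C where C: "C \<ge> 0" "\<And>t r. t > 0 \<Longrightarrow> r > 0 \<Longrightarrow>
       card ((\<lambda>x. t *\<^sub>R x) ` L \<inter> ball 0 r - {0}) \<le> C * (r / t) ^ CARD('n)"
      using lattice_nonzero_count[OF L] by blast
    let ?r = "norm x + 1"
    define b where "b = nat \<lceil>C * ?r ^ CARD('n)\<rceil>"
    have r: "?r > 0" using norm_ge_zero[of x] by linarith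
    \<comment> \<open>A nonzero point of \<open>c^k L\<close> in the ball of radius
      \<open>norm x + 1\<close> makes the count there at least 1, which by
      \<open>lattice_nonzero_count\<close> forces
      \<open>c \<le> (c^k)^n \<le> C (norm x + 1)^n\<close>.\<close>
    have bound: "c \<le> b" if "?P c" for c
    proof (cases "c = 0")
      case c: False
      have c1: "real (c ^ k) \<ge> real c" using c k by (simp add: self_le_power del: of_nat_power)
      have pos: "real (c ^ k) > 0" using c by simp
      have fin: "finite (multiples (c ^ k) L \<inter> ball 0 ?r - {0})"
        using lattice_finite_ball[OF lattice_basis_multiples[OF L, of "c ^ k"], of 0 ?r] c by (simp add: Suc_leI)
      have "x \<in> multiples (c ^ k) L \<inter> ball 0 ?r - {0}" using that False by simp
      then have "card (multiples (c ^ k) L \<inter> ball 0 ?r - {0}) \<ge> 1"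
        using fin by (metis One_nat_def Suc_leI card_gt_0_iff empty_iff)
      then have "1 \<le> C * (?r / real (c ^ k)) ^ CARD('n)" using C(2)[OF pos r] by linarith
      then have "real (c ^ k) ^ CARD('n) \<le> C * ?r ^ CARD('n)"
        using pos by (simp add: power_divide field_simps del: of_nat_power)
      moreover have "real c \<le> real (c ^ k) ^ CARD('n)"
        using c1 c self_le_power[of "real (c ^ k)" "CARD('n)"] by (simp del: of_nat_power)
      ultimately show ?thesis unfolding b_def by linarith
    qed simp
    have one: "?P 1" using xL by simp
    let ?G = "GREATEST c. ?P c"
    have G: "?P ?G" by (rule GreatestI_nat[where P = ?P, OF one]) (erule bound)
    have Gle: "c \<le> ?G" if "?P c" for c by (rule Greatest_le_nat[where P = ?P, OF that]) (erule bound)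
    have "?G = 1 \<longleftrightarrow> (\<forall>p. prime p \<longrightarrow> \<not> ?P p)"
    proof
      assume G1: "?G = 1"
      show "\<forall>p. prime p \<longrightarrow> \<not> ?P p"
      proof (intro allI impI notI)
        fix p :: nat assume p: "prime p" "?P p"
        from Gle[OF p(2)] have "p \<le> 1" unfolding G1 .
        then show False using prime_gt_1_nat[OF p(1)] by linarith
      qed
    next
      assume R: "\<forall>p. prime p \<longrightarrow> \<not> ?P p"
      show "?G = 1"
      proof (rule ccontr)
        assume "?G \<noteq> 1"
        then obtain p j where p: "prime p" "?G = p * j" using prime_factor_nat[of ?G] by (auto elim: dvdE)
        have "x \<in> multiples (p ^ k * j ^ k) L" using G unfolding p(2) by (simp only: power_mult_distrib)
        then have "?P p" using multiples_mult_subset[OF L] by blast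
        then show False using R p by blast
      qed
    qed
    then show ?thesis unfolding k_free_points_def k_content_def using False xL by (auto simp: one_enat_def)
  qed (auto simp: k_free_points_def)
qed

section \<open>The autocorrelation of the k-free points\<close>

definition power_tail :: "nat \<Rightarrow> nat \<Rightarrow> real" where
  "power_tail s T = (\<Sum>j. 1 / real (j + Suc T) ^ s)"

lemma power_tail_tendsto:
  assumes "s \<ge> 2"
  shows "power_tail s \<longlonglongrightarrow> 0"
proof -
  note sm = summable_inverse_power[OF assms]
  have e: "power_tail s = (\<lambda>T. (\<Sum>m. 1 / real m ^ s) - (\<Sum>m<Suc T. 1 / real m ^ s))"
    unfolding power_tail_def fun_eq_iff using suminf_split_initial_segment[OF sm, of "Suc T" for T]
    by (metis add_diff_cancel_right')
  have "(\<lambda>T. (\<Sum>m. 1 / real m ^ s) - (\<Sum>m<T. 1 / real m ^ s)) \<longlonglongrightarrow> (\<Sum>m. 1 / real m ^ s) - (\<Sum>m. 1 / real m ^ s)"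
    by (intro tendsto_intros summable_LIMSEQ sm)
  from LIMSEQ_Suc[OF this] show ?thesis unfolding e by simp
qed

lemma sum_le_power_tail:
  assumes "s \<ge> 2" "finite P" "\<And>p. p \<in> P \<Longrightarrow> p > T"
  shows "(\<Sum>p\<in>P. 1 / real p ^ s) \<le> power_tail s T"
proof -
  have "(\<Sum>p\<in>P. 1 / real p ^ s) = (\<Sum>j\<in>(\<lambda>p. p - Suc T) ` P. 1 / real (j + Suc T) ^ s)"
  proof (subst sum.reindex)
    show "inj_on (\<lambda>p. p - Suc T) P"
      using assms(3) by (auto simp: inj_on_def) (metis Suc_leI le_add_diff_inverse2)
    show "(\<Sum>p\<in>P. 1 / real p ^ s) = (\<Sum>p\<in>P. ((\<lambda>j. 1 / real (j + Suc T) ^ s) \<circ> (\<lambda>p. p - Suc T)) p)"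
    proof (intro sum.cong refl)
      fix p assume "p \<in> P"
      then have "p - Suc T + Suc T = p" using assms(3)[of p] by simp
      then show "1 / real p ^ s = ((\<lambda>j. 1 / real (j + Suc T) ^ s) \<circ> (\<lambda>p. p - Suc T)) p"
        by (simp only: o_apply)
    qed
  qed
  also have "\<dots> \<le> power_tail s T"
    unfolding power_tail_def using assms
    by (intro sum_le_suminf summable_ignore_initial_segment[OF summable_inverse_power]) auto
  finally show ?thesis .
qed

text \<open>A union bound over all \<open>p > T\<close>. Since the single counts hold at every
  scale, the result is the volume of order \<open>R^n\<close> times a tail that depends on
  \<open>T\<close> only.\<close>

lemma card_large_multiples:
  fixes L :: "(real^'n) set"
  assumes L: "lattice_basis A L" and s: "CARD('n) * k \<ge> 2" and C: "C \<ge> 0"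
      "\<And>t r. t > 0 \<Longrightarrow> r > 0 \<Longrightarrow> card ((\<lambda>x. t *\<^sub>R x) ` L \<inter> ball 0 r - {0}) \<le> C * (r / t) ^ CARD('n)"
    and R: "R > 0" and U: "finite U" "U \<subseteq> ball 0 R - {0}"
      "\<And>x. x \<in> U \<Longrightarrow> \<exists>p. p > T \<and> x \<in> multiples (p ^ k) L"
  shows "card U \<le> C * R ^ CARD('n) * power_tail (CARD('n) * k) T"
proof -
  \<comment> \<open>One witness \<open>p\<close> per point, so that only finitely many
    \<open>p\<close> enter the union bound.\<close>
  define f where "f x = (SOME p. p > T \<and> x \<in> multiples (p ^ k) L)" for x
  have f: "f x > T \<and> x \<in> multiples (f x ^ k) L" if "x \<in> U" for x
    unfolding f_def by (rule someI_ex[OF U(3)[OF that]])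
  let ?M = "\<lambda>p. multiples (p ^ k) L \<inter> ball 0 R - {0}"
  have finM: "finite (?M p)" if "p > T" for p
    using lattice_finite_ball[OF lattice_basis_multiples[OF L, of "p ^ k"], of 0 R] that by (simp add: Suc_leI)
  have "U \<subseteq> (\<Union>p\<in>f ` U. ?M p)"
  proof
    fix x assume x: "x \<in> U"
    then have "x \<in> ball 0 R" "x \<notin> {0}" using U(2) by auto
    then show "x \<in> (\<Union>p\<in>f ` U. ?M p)"
      by (intro UN_I[OF imageI[OF x]] DiffI IntI conjunct2[OF f[OF x]])
  qed
  then have "card U \<le> card (\<Union>p\<in>f ` U. ?M p)"
    by (intro card_mono finite_UN_I finite_imageI U(1) finM) (use f in auto)
  also have "\<dots> \<le> (\<Sum>p\<in>f ` U. card (?M p))" using U(1) by (intro card_UN_le) auto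
  finally have "real (card U) \<le> real (\<Sum>p\<in>f ` U. card (?M p))" by (simp only: of_nat_le_iff)
  also have "\<dots> = (\<Sum>p\<in>f ` U. real (card (?M p)))" by (rule of_nat_sum)
  also have "\<dots> \<le> (\<Sum>p\<in>f ` U. C * R ^ CARD('n) * (1 / real p ^ (CARD('n) * k)))"
  proof (rule sum_mono)
    fix p assume "p \<in> f ` U"
    then have "p > T" using f by auto
    then have "real (p ^ k) > 0" by simp
    from C(2)[OF this R] have "card (?M p) \<le> C * (R / real (p ^ k)) ^ CARD('n)" .
    also have "\<dots> = C * R ^ CARD('n) * (1 / real p ^ (CARD('n) * k))"
      by (simp add: power_divide power_mult[symmetric] mult.commute)
    finally show "card (?M p) \<le> C * R ^ CARD('n) * (1 / real p ^ (CARD('n) * k))" .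
  qed
  also have "\<dots> = C * R ^ CARD('n) * (\<Sum>p\<in>f ` U. 1 / real p ^ (CARD('n) * k))"
    by (rule sum_distrib_left[symmetric])
  also have "\<dots> \<le> C * R ^ CARD('n) * power_tail (CARD('n) * k) T"
    using C R s U(1) f by (intro mult_left_mono sum_le_power_tail) auto
  finally show ?thesis .
qed

lemma ball_density_shift:
  fixes X :: "(real^'n) set"
  assumes "has_density X \<delta>"
  shows "((\<lambda>R. card (X \<inter> ball 0 (R - a)) / (R ^ CARD('n) * unit_ball_vol (real CARD('n)))) \<longlongrightarrow> \<delta>) at_top"
proof -
  have "filterlim (\<lambda>R. - a + R) at_top at_top"
    by (rule filterlim_tendsto_add_at_top[OF tendsto_const filterlim_ident])
  then have f: "filterlim (\<lambda>R. R - a) at_top at_top" by simp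
  have 1: "((\<lambda>R. ball_density X (R - a)) \<longlongrightarrow> \<delta>) at_top"
    using filterlim_compose[OF assms[unfolded has_density_def] f] by simp
  have "((\<lambda>R. (1 - a / R) ^ CARD('n)) \<longlongrightarrow> (1 - 0) ^ CARD('n)) at_top"
    by (intro tendsto_intros tendsto_divide_0[OF tendsto_const] filterlim_at_top_imp_at_infinity filterlim_ident)
  from tendsto_mult[OF 1 this]
  have lim: "((\<lambda>R. ball_density X (R - a) * (1 - a / R) ^ CARD('n)) \<longlongrightarrow> \<delta>) at_top" by simp
  have "eventually (\<lambda>R. ball_density X (R - a) * (1 - a / R) ^ CARD('n) =
     card (X \<inter> ball 0 (R - a)) / (R ^ CARD('n) * unit_ball_vol (real CARD('n)))) at_top"
    using eventually_gt_at_top[of "max 0 a"]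
  proof eventually_elim
    case (elim R)
    then have R: "R \<noteq> 0" "R - a \<noteq> 0" by auto
    have "(1 - a / R) ^ CARD('n) = (R - a) ^ CARD('n) / R ^ CARD('n)"
      using R by (simp add: power_divide[symmetric] diff_divide_distrib)
    then show ?case using R by (simp add: ball_density_def)
  qed
  then show ?thesis using lim by (rule Lim_transform_eventually[rotated])
qed

text \<open>By \<open>xi_times_squarefree_sum\<close> this is \<open>1 / |det A|\<close> times the
  product over all \<open>p\<close> of \<open>1 - 1/p^(nk)\<close> or \<open>1 - 2/p^(nk)\<close>.
  The squarefree sum is the form that matches the comb series.\<close>

definition autocorrelation_coefficient :: "nat \<Rightarrow> (real^'n^'n) \<Rightarrow> (real^'n) set \<Rightarrow> real^'n \<Rightarrow> real" where
  "autocorrelation_coefficient k A L l = xi (real (CARD('n) * k)) / \<bar>det A\<bar> *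
     (\<Sum>d. if squarefree d \<and> prime_factors d \<subseteq> {p. l \<in> multiples (p ^ k) L}
           then \<Prod>p\<in>prime_factors d. 1 / (real p ^ (CARD('n) * k) - 2) else 0)"

text \<open>The set \<open>E T\<close> sieved by the primes up to \<open>T\<close> contains all
  admissible points. The surplus consists of points whose partner leaves the ball, of the points 0
  and \<open>l\<close>, and of points that a larger prime removes; the last share is small uniformly
  in \<open>R\<close>.\<close>

lemma pair_count_tendsto:
  fixes L :: "(real^'n) set"
  assumes L: "lattice_basis A L" and k: "k \<ge> 1" and s: "CARD('n) * k \<ge> 2" and l: "l \<in> L"
  defines "V \<equiv> k_free_points k L"
  shows "((\<lambda>R. card {x \<in> V \<inter> ball 0 R. x - l \<in> V \<inter> ball 0 R} / (R ^ CARD('n) * unit_ball_vol (real CARD('n))))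
     \<longlongrightarrow> autocorrelation_coefficient k A L l) at_top"
proof (rule tendstoI)
  fix \<epsilon> :: real assume \<epsilon>: "\<epsilon> > 0"
  let ?v = "unit_ball_vol (real CARD('n))"
  have v: "?v > 0" by simp
  then have v0: "?v \<noteq> 0" by linarith
  define W where "W R = {x \<in> V \<inter> ball 0 R. x - l \<in> V \<inter> ball 0 R}" for R
  define E where "E T = {x. x - 0 \<in> multiples 1 L \<and>
     (\<forall>p\<in>primes_upto T. x \<notin> multiples (p ^ k) L \<and> x - l \<notin> multiples (p ^ k) L)}" for T
  define \<delta> where "\<delta> T = (\<Prod>p\<in>primes_upto T. 1 - (if l \<in> multiples (p ^ k) L then 1 else 2) / real p ^ (CARD('n) * k))
      / (real 1 ^ CARD('n) * \<bar>det A\<bar>)" for T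
  note V = k_free_points_iff[OF L k]
  have E: "has_density (E T) (\<delta> T)" for T
    unfolding E_def \<delta>_def by (rule has_density_sieve[OF L l _ _ _ _ lattice_zero[OF L]]) auto
  have EL: "E T \<subseteq> L" for T unfolding E_def by auto
  have "\<delta> \<longlonglongrightarrow> xi (real (CARD('n) * k)) * (\<Sum>d. if squarefree d \<and> prime_factors d \<subseteq> {p. l \<in> multiples (p ^ k) L}
           then \<Prod>p\<in>prime_factors d. 1 / (real p ^ (CARD('n) * k) - 2) else 0) / (real 1 ^ CARD('n) * \<bar>det A\<bar>)"
    unfolding \<delta>_def
    using tendsto_divide[OF xi_times_squarefree_sum(2)[OF s, of "{p. l \<in> multiples (p ^ k) L}"] tendsto_const,
      of "real 1 ^ CARD('n) * \<bar>det A\<bar>"] lattice_basis_det_pos[OF L] by simp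
  then have \<delta>: "\<delta> \<longlonglongrightarrow> autocorrelation_coefficient k A L l"
    unfolding autocorrelation_coefficient_def by simp
  obtain C where C: "C \<ge> 0" "\<And>t r. t > 0 \<Longrightarrow> r > 0 \<Longrightarrow>
       card ((\<lambda>x. t *\<^sub>R x) ` L \<inter> ball 0 r - {0}) \<le> C * (r / t) ^ CARD('n)"
    using lattice_nonzero_count[OF L] by blast
  let ?t = "power_tail (CARD('n) * k)"
  have "(\<lambda>T. 2 * C * ?t T / ?v) \<longlonglongrightarrow> 2 * C * 0 / ?v"
    using v0 by (intro tendsto_intros power_tail_tendsto s) auto
  then have "eventually (\<lambda>T. 2 * C * ?t T / ?v < \<epsilon> / 4) sequentially"
    using \<epsilon> by (intro order_tendstoD(2)) auto
  moreover have "eventually (\<lambda>T. dist (\<delta> T) (autocorrelation_coefficient k A L l) < \<epsilon> / 4) sequentially"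
    using \<epsilon> by (intro tendstoD[OF \<delta>]) auto
  \<comment> \<open>\<open>T\<close> is fixed before \<open>R\<close> grows. The quarters of
    \<open>\<epsilon>\<close> go to the large primes, to \<open>\<delta> T\<close>, to the edge with
    the two exceptional points, and to the density of \<open>E T\<close> at radius
    \<open>R\<close>.\<close>
  ultimately obtain T where T: "2 * C * ?t T / ?v < \<epsilon> / 4" "dist (\<delta> T) (autocorrelation_coefficient k A L l) < \<epsilon> / 4"
    using eventually_happens[OF eventually_conj] trivial_limit_sequentially by blast
  define edge where "edge R = {x \<in> L \<inter> ball 0 R. x - l \<notin> ball 0 R}" for R
  have finL: "finite (L \<inter> ball 0 R)" for R by (rule lattice_finite_ball[OF L])
  have fin: "finite (W R)" "finite (E T \<inter> ball 0 R)" "finite (edge R)" for R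
    using V EL by (auto simp: W_def V_def edge_def intro!: finite_subset[OF _ finL[of R]])
  have upper: "card (W R) \<le> card (E T \<inter> ball 0 R)" for R
  proof (rule card_mono[OF fin(2)])
    show "W R \<subseteq> E T \<inter> ball 0 R"
    proof
      fix x assume "x \<in> W R"
      then have x: "x \<in> V" "x - l \<in> V" "x \<in> ball 0 R" unfolding W_def by blast+
      then show "x \<in> E T \<inter> ball 0 R" unfolding V_def V E_def by simp
    qed
  qed
  have lower: "real (card (E T \<inter> ball 0 R)) \<le> card (W R) + card (edge R) + 2 + 2 * (C * R ^ CARD('n) * ?t T)" if R: "R > 0" for R
  proof -
    define U1 where "U1 = {x \<in> L \<inter> ball 0 R - {0}. \<exists>p. p > T \<and> x \<in> multiples (p ^ k) L}"
    have finU1: "finite U1" unfolding U1_def by (rule finite_subset[OF _ finL[of R]]) auto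
    have U1: "card U1 \<le> C * R ^ CARD('n) * ?t T"
      by (rule card_large_multiples[OF L s C R finU1]) (auto simp: U1_def)
    have large: "x \<in> V \<or> x = 0 \<or> x \<in> U1" if x: "x \<in> L" "x \<in> ball 0 R" and nm: "\<And>p. p \<in> primes_upto T \<Longrightarrow> x \<notin> multiples (p ^ k) L" for x
    proof (cases "x \<in> V")
      case False
      then obtain p where p: "prime p" "x \<in> multiples (p ^ k) L" unfolding V_def V using x(1) by blast
      then have "p > T" using nm[of p] by (cases "p > T") auto
      then show ?thesis using p x unfolding U1_def by blast
    qed simp
    \<comment> \<open>The origin is excluded from \<open>U1\<close> although it lies in every
      \<open>p^k L\<close>, so the cases \<open>x = 0\<close> and \<open>x = l\<close> appear
      separately.\<close>
    have "E T \<inter> ball 0 R \<subseteq> W R \<union> edge R \<union> {0, l} \<union> U1 \<union> (\<lambda>x. x + l) ` U1"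
    proof
      fix x assume x: "x \<in> E T \<inter> ball 0 R"
      then have xL: "x \<in> L" "x - l \<in> L" using EL lattice_diff[OF L _ l] by blast+
      have xE: "x \<notin> multiples (p ^ k) L" "x - l \<notin> multiples (p ^ k) L" if "p \<in> primes_upto T" for p
        using x that unfolding E_def by blast+
      show "x \<in> W R \<union> edge R \<union> {0, l} \<union> U1 \<union> (\<lambda>x. x + l) ` U1"
      proof (cases "x - l \<in> ball 0 R")
        case True
        consider "x \<in> V" "x - l \<in> V" | "x = 0" | "x \<in> U1" | "x - l = 0" | "x - l \<in> U1"
          using large[OF xL(1) _ xE(1)] large[OF xL(2) True xE(2)] x by blast
        then show ?thesis
        proof cases
          case 1 then show ?thesis using x True unfolding W_def by blast
        next
          case 5 then show ?thesis by (metis UnI2 diff_add_cancel image_eqI)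
        qed auto
      next
        case False
        then show ?thesis using x xL unfolding edge_def by blast
      qed
    qed
    then have "card (E T \<inter> ball 0 R) \<le> card (W R \<union> edge R \<union> {0, l} \<union> U1 \<union> (\<lambda>x. x + l) ` U1)"
      using fin finU1 by (intro card_mono) auto
    also have "\<dots> \<le> card (W R) + card (edge R) + card {0, l} + card U1 + card ((\<lambda>x. x + l) ` U1)"
      by (meson card_Un_le add_le_mono order_trans order_refl)
    also have "card ((\<lambda>x. x + l) ` U1) = card U1" by (simp add: card_image inj_on_def)
    also have "card {0, l} \<le> 2" by (simp add: card_insert_if)
    finally have "real (card (E T \<inter> ball 0 R)) \<le> card (W R) + card (edge R) + 2 + 2 * card U1" by linarith
    then show ?thesis using U1 by linarith
  qed
  \<comment> \<open>Edge points lie between the radii \<open>R - norm l\<close> and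
    \<open>R\<close>, and both lattice counts have the same density in the limit. The 2 accounts for
    0 and \<open>l\<close>.\<close>
  let ?e = "\<lambda>R. (real (card (L \<inter> ball 0 R)) - real (card (L \<inter> ball 0 (R - norm l))) + 2) / (R ^ CARD('n) * ?v)"
  have edge: "real (card (edge R)) \<le> real (card (L \<inter> ball 0 R)) - real (card (L \<inter> ball 0 (R - norm l)))" for R
  proof -
    have "edge R \<subseteq> L \<inter> ball 0 R - L \<inter> ball 0 (R - norm l)"
      unfolding edge_def using norm_triangle_ineq4[of _ l] by (auto simp: not_less) (smt (verit))
    then have "card (edge R) \<le> card (L \<inter> ball 0 R - L \<inter> ball 0 (R - norm l))"
      using finL by (intro card_mono) auto
    also have "\<dots> = card (L \<inter> ball 0 R) - card (L \<inter> ball 0 (R - norm l))"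
      by (rule card_Diff_subset[OF finL]) (intro Int_mono subset_refl subset_ball, simp)
    finally have "card (edge R) \<le> card (L \<inter> ball 0 R) - card (L \<inter> ball 0 (R - norm l))" .
    moreover have "card (L \<inter> ball 0 (R - norm l)) \<le> card (L \<inter> ball 0 R)"
      by (rule card_mono[OF finL]) (intro Int_mono subset_refl subset_ball, simp)
    ultimately show ?thesis by linarith
  qed
  have Ldens: "has_density L (1 / (real 1 ^ CARD('n) * \<bar>det A\<bar>))"
    using has_density_coset[OF L, of 1 0] by simp
  have "(?e \<longlongrightarrow> 1 / (real 1 ^ CARD('n) * \<bar>det A\<bar>) - 1 / (real 1 ^ CARD('n) * \<bar>det A\<bar>) + 0) at_top"
  proof -
    have "((\<lambda>R. 2 / ?v * inverse (R ^ CARD('n))) \<longlongrightarrow> 2 / ?v * 0) at_top"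
      by (intro tendsto_intros tendsto_inverse_0_at_top filterlim_pow_at_top filterlim_ident) auto
    then have "((\<lambda>R. 2 / (R ^ CARD('n) * ?v)) \<longlongrightarrow> 0) at_top" by (simp add: field_simps)
    from tendsto_add[OF tendsto_diff[OF Ldens[unfolded has_density_def] ball_density_shift[OF Ldens, of "norm l"]] this]
    show ?thesis unfolding ball_density_def by (simp add: add_divide_distrib diff_divide_distrib)
  qed
  then have "(?e \<longlongrightarrow> 0) at_top" by simp
  then have "eventually (\<lambda>R. ?e R < \<epsilon> / 4) at_top" using \<epsilon> by (intro order_tendstoD(2)) auto
  moreover have "eventually (\<lambda>R. dist (ball_density (E T) R) (\<delta> T) < \<epsilon> / 4) at_top"
    using \<epsilon> by (intro tendstoD[OF E[unfolded has_density_def]]) auto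
  moreover note eventually_gt_at_top[of "0::real"]
  ultimately show "eventually (\<lambda>R. dist (card {x \<in> V \<inter> ball 0 R. x - l \<in> V \<inter> ball 0 R} / (R ^ CARD('n) * ?v))
      (autocorrelation_coefficient k A L l) < \<epsilon>) at_top"
  proof eventually_elim
    case (elim R)
    have pos: "R ^ CARD('n) * ?v > 0" using elim v by simp
    have 1: "card (W R) / (R ^ CARD('n) * ?v) \<le> ball_density (E T) R"
      unfolding ball_density_def using pos upper[of R] by (intro divide_right_mono) auto
    have "real (card (E T \<inter> ball 0 R)) \<le> card (W R) + (real (card (L \<inter> ball 0 R)) - real (card (L \<inter> ball 0 (R - norm l))) + 2)
       + 2 * (C * R ^ CARD('n) * ?t T)"
      using lower[OF elim(3)] edge[of R] by linarith
    then have "ball_density (E T) R \<le> (card (W R) + (real (card (L \<inter> ball 0 R)) - real (card (L \<inter> ball 0 (R - norm l))) + 2)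
       + 2 * (C * R ^ CARD('n) * ?t T)) / (R ^ CARD('n) * ?v)"
      unfolding ball_density_def using pos by (intro divide_right_mono) auto
    also have "\<dots> = card (W R) / (R ^ CARD('n) * ?v) + ?e R + 2 * (C * R ^ CARD('n) * ?t T) / (R ^ CARD('n) * ?v)"
      by (simp only: add_divide_distrib)
    also have "2 * (C * R ^ CARD('n) * ?t T) / (R ^ CARD('n) * ?v) = 2 * C * ?t T / ?v"
      using elim(3) by simp
    finally have 2: "ball_density (E T) R \<le> card (W R) / (R ^ CARD('n) * ?v) + ?e R + 2 * C * ?t T / ?v" .
    show ?case using 1 2 elim(1,2) T unfolding W_def[symmetric] dist_real_def by linarith
  qed
qed

text \<open>Distinct primes give coprime moduli \<open>p^k\<close>, so membership splits by
  \<open>multiples_coprime_Int\<close>, one prime factor at a time.\<close>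

lemma in_multiples_squarefree:
  fixes L :: "(real^'n) set"
  assumes L: "lattice_basis A L" and d: "squarefree d"
  shows "x \<in> multiples (d ^ k) L \<longleftrightarrow> x \<in> L \<and> (\<forall>p\<in>prime_factors d. x \<in> multiples (p ^ k) L)"
proof -
  have claim: "x \<in> multiples ((\<Prod>X) ^ k) L \<longleftrightarrow> x \<in> L \<and> (\<forall>p\<in>X. x \<in> multiples (p ^ k) L)"
    if "finite X" "\<And>p. p \<in> X \<Longrightarrow> prime p" for X
    using that
  proof (induction X)
    case (insert p X)
    have "coprime p (\<Prod>X)"
      using insert by (intro prod_coprime_right) (auto intro!: primes_coprime)
    then have c: "coprime (p ^ k) ((\<Prod>X) ^ k)" by simp
    have "x \<in> multiples ((\<Prod>(insert p X)) ^ k) L \<longleftrightarrow> x \<in> multiples (p ^ k * (\<Prod>X) ^ k) L"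
      using insert.hyps by (simp add: power_mult_distrib)
    also have "\<dots> \<longleftrightarrow> x \<in> multiples (p ^ k) L \<and> x \<in> multiples ((\<Prod>X) ^ k) L"
      using multiples_coprime_Int[OF L c] by blast
    finally show ?case using insert.IH insert.prems by auto
  qed simp
  from claim[where X = "prime_factors d", OF finite_set_mset in_prime_factors_imp_prime] show ?thesis by (simp add: squarefree_eq_prod_primes[OF d] del: of_nat_power)
qed

text \<open>Pairs are grouped by their difference. The finite set \<open>F\<close> is independent of
  \<open>R\<close>, so the limit can later be taken in a fixed finite sum.\<close>

lemma integral_finite_autocorrelation:
  fixes f :: "real^'n \<Rightarrow> complex" and V :: "(real^'n) set"
  assumes fin: "finite (V \<inter> ball 0 R)" and R: "R > 0" and f: "f \<in> borel_measurable borel"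
    and F: "finite F" "\<And>x y. x \<in> V \<Longrightarrow> y \<in> V \<Longrightarrow> f (x - y) \<noteq> 0 \<Longrightarrow> x - y \<in> F"
  shows "(LINT x|finite_autocorrelation V R. f x) =
    (\<Sum>l\<in>F. (card {x \<in> V \<inter> ball 0 R. x - l \<in> V \<inter> ball 0 R} / (R ^ CARD('n) * unit_ball_vol (real CARD('n)))) *\<^sub>R f l)"
proof -
  let ?P = "(V \<inter> ball 0 R) \<times> (V \<inter> ball 0 R)"
  let ?a = "1 / (R ^ CARD('n) * unit_ball_vol (real CARD('n)))"
  let ?M = "distr (count_space ?P) borel (\<lambda>(x, y). x - y)"
  let ?N = "\<lambda>l. card {x \<in> V \<inter> ball 0 R. x - l \<in> V \<inter> ball 0 R}"
  have a: "?a \<ge> 0" using R by simp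
  have m: "(\<lambda>(x, y). x - y) \<in> count_space ?P \<rightarrow>\<^sub>M borel" by simp
  have "scale_measure (ennreal ?a) ?M = density ?M (\<lambda>_. ennreal ?a)"
    by (rule measure_eqI) (auto simp: emeasure_density_const)
  then have "(LINT x|finite_autocorrelation V R. f x) = ?a *\<^sub>R (LINT x|?M. f x)"
    unfolding finite_autocorrelation_def using a f by (simp add: integral_density)
  also have "(LINT x|?M. f x) = (\<Sum>w\<in>?P. f (fst w - snd w))"
    using fin by (subst integral_distr[OF m f]) (auto simp: lebesgue_integral_count_space_finite split_beta)
  also have "\<dots> = (\<Sum>l\<in>(\<lambda>w. fst w - snd w) ` ?P. \<Sum>w\<in>{w \<in> ?P. fst w - snd w = l}. f (fst w - snd w))"
    using fin by (intro sum.image_gen) auto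
  also have "\<dots> = (\<Sum>l\<in>(\<lambda>w. fst w - snd w) ` ?P. of_nat (?N l) * f l)"
  proof (intro sum.cong refl)
    fix l
    have "bij_betw fst {w \<in> ?P. fst w - snd w = l} {x \<in> V \<inter> ball 0 R. x - l \<in> V \<inter> ball 0 R}"
      by (rule bij_betw_byWitness[where f' = "\<lambda>x. (x, x - l)"]) auto
    then have "card {w \<in> ?P. fst w - snd w = l} = ?N l" by (rule bij_betw_same_card)
    moreover have "(\<Sum>w\<in>{w \<in> ?P. fst w - snd w = l}. f (fst w - snd w)) = (\<Sum>w\<in>{w \<in> ?P. fst w - snd w = l}. f l)"
      by (rule sum.cong) auto
    ultimately show "(\<Sum>w\<in>{w \<in> ?P. fst w - snd w = l}. f (fst w - snd w)) = of_nat (?N l) * f l" by simp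
  qed
  also have "\<dots> = (\<Sum>l\<in>F. of_nat (?N l) * f l)"
  proof (rule sum.mono_neutral_cong)
    show "of_nat (?N l) * f l = 0" if l: "l \<in> F - (\<lambda>w. fst w - snd w) ` ?P" for l
    proof -
      have "{x \<in> V \<inter> ball 0 R. x - l \<in> V \<inter> ball 0 R} = {}"
      proof (rule ccontr)
        assume "\<not> ?thesis"
        then obtain x where "x \<in> V \<inter> ball 0 R" "x - l \<in> V \<inter> ball 0 R" by blast
        then have "(x, x - l) \<in> ?P" by blast
        then have "l \<in> (\<lambda>w. fst w - snd w) ` ?P" by (rule image_eqI[rotated]) simp
        then show False using l by blast
      qed
      then show ?thesis by (simp only: card.empty) simp
    qed
  qed (use F fin in auto)
  also have "?a *\<^sub>R (\<Sum>l\<in>F. of_nat (?N l) * f l) = (\<Sum>l\<in>F. (?N l / (R ^ CARD('n) * unit_ball_vol (real CARD('n)))) *\<^sub>R f l)"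
    unfolding scaleR_sum_right by (intro sum.cong refl) (simp add: scaleR_conv_of_real)
  finally show ?thesis .
qed

definition autocorrelation_weight :: "nat \<Rightarrow> (real^'n^'n) \<Rightarrow> nat \<Rightarrow> real" where
  "autocorrelation_weight k A d = xi (real (CARD('n) * k)) / \<bar>det A\<bar> *
     (if squarefree d then \<Prod>p\<in>prime_factors d. 1 / (real p ^ (CARD('n) * k) - 2) else 0)"

lemma autocorrelation_weight_nonneg_summable:
  fixes A :: "real^'n^'n"
  assumes s: "CARD('n) * k \<ge> 2"
  shows "autocorrelation_weight k A d \<ge> 0" "summable (autocorrelation_weight k A)"
proof -
  have "(\<Prod>p\<in>prime_factors d. 1 / (real p ^ (CARD('n) * k) - 2)) \<ge> 0"
    by (intro prod_nonneg local_factor_bounds(2) prime_power_ge_4 s) auto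
  then show "autocorrelation_weight k A d \<ge> 0"
    unfolding autocorrelation_weight_def using xi_nonneg[OF s] by auto
  show "summable (autocorrelation_weight k A)"
    unfolding autocorrelation_weight_def[abs_def]
    using xi_times_squarefree_sum(1)[OF s, of UNIV] by (intro summable_mult) simp
qed

lemma autocorrelation_coefficient_eq:
  fixes L :: "(real^'n) set"
  assumes L: "lattice_basis A L" and s: "CARD('n) * k \<ge> 2" and x: "x \<in> L"
  shows "(\<Sum>d. autocorrelation_weight k A d * indicator (multiples (d ^ k) L) x) = autocorrelation_coefficient k A L x"
proof -
  let ?w = "\<lambda>d. if squarefree d \<and> prime_factors d \<subseteq> {p. x \<in> multiples (p ^ k) L}
           then \<Prod>p\<in>prime_factors d. 1 / (real p ^ (CARD('n) * k) - 2) else 0"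
  have "autocorrelation_weight k A d * indicator (multiples (d ^ k) L) x = xi (real (CARD('n) * k)) / \<bar>det A\<bar> * ?w d" for d
  proof (cases "squarefree d")
    case True
    have "indicator (multiples (d ^ k) L) x = (if prime_factors d \<subseteq> {p. x \<in> multiples (p ^ k) L} then 1 else 0 :: real)"
      using in_multiples_squarefree[OF L True, of x k] x by (auto simp: indicator_def simp del: of_nat_power)
    then show ?thesis using True by (simp add: autocorrelation_weight_def del: of_nat_power)
  qed (simp add: autocorrelation_weight_def)
  then show ?thesis
    unfolding autocorrelation_coefficient_def
    using suminf_mult[OF xi_times_squarefree_sum(1)[OF s, of "{p. x \<in> multiples (p ^ k) L}"]] by (simp only:)
qed

text \<open>A compactly supported test function sees only finitely many lattice points, so vague
  convergence reduces to the coefficient limits of \<open>pair_count_tendsto\<close>.\<close>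

lemma natural_autocorrelation_k_free:
  fixes L :: "(real^'n) set"
  assumes L: "lattice_basis A L" and k: "k \<ge> 1" and s: "CARD('n) * k \<ge> 2"
    and lf: "locally_finite_borel (comb_series (autocorrelation_weight k A) (\<lambda>d. multiples (d ^ k) L))"
  shows "natural_autocorrelation (k_free_points k L)
    (comb_series (autocorrelation_weight k A) (\<lambda>d. multiples (d ^ k) L))"
  unfolding natural_autocorrelation_def vague_lim_def
proof (intro conjI allI impI lf)
  let ?V = "k_free_points k L"
  let ?c = "autocorrelation_weight k A"
  let ?\<gamma> = "comb_series ?c (\<lambda>d. multiples (d ^ k) L)"
  let ?w = "\<lambda>x. \<Sum>d. ?c d * indicator (multiples (d ^ k) L) x"
  fix f :: "real^'n \<Rightarrow> complex"
  assume f: "continuous_on UNIV f" and supp: "compact (closure {x. f x \<noteq> 0})"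
  have fm: "f \<in> borel_measurable borel" using f by (rule borel_measurable_continuous_onI)
  obtain r where r: "r > 0" "\<And>x. f x \<noteq> 0 \<Longrightarrow> norm x \<le> r"
    using compact_imp_bounded[OF supp] closure_subset[of "{x. f x \<noteq> 0}"] by (auto simp: bounded_pos subset_iff)
  define F where "F = L \<inter> ball 0 (r + 1)"
  have finF: "finite F" unfolding F_def by (rule lattice_finite_ball[OF L])
  have VL: "?V \<subseteq> L" using k_free_points_iff[OF L k] by blast
  have inF: "x - y \<in> F" if "x \<in> ?V" "y \<in> ?V" "f (x - y) \<noteq> 0" for x y
    unfolding F_def using that VL lattice_diff[OF L, of x y] r(2)[of "x - y"] by auto
  have w0: "?w x = 0" if "x \<notin> L" for x
  proof -
    have "indicator (multiples (d ^ k) L) x = (0 :: real)" for d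
      using multiples_subset[OF L, of "d ^ k"] that by (auto simp: indicator_def simp del: of_nat_power)
    then show ?thesis by simp
  qed
  have "(LINT x|?\<gamma>. f x) = (LINT x|count_space UNIV. ?w x *\<^sub>R f x)"
    unfolding comb_series_def
    by (rule integral_weighted_comb(1)[OF comb_weight_nonneg fm]) (use autocorrelation_weight_nonneg_summable[OF s] in auto)
  also have "\<dots> = (\<Sum>l\<in>F. ?w l *\<^sub>R f l)"
  proof (subst lebesgue_integral_count_space_finite_support)
    have sub: "{a \<in> UNIV. ?w a *\<^sub>R f a \<noteq> 0} \<subseteq> F"
      using w0 r(2) unfolding F_def by (force simp del: of_nat_power)
    then show "finite {a \<in> UNIV. ?w a *\<^sub>R f a \<noteq> 0}" using finF finite_subset by blast
    show "(\<Sum>a | a \<in> UNIV \<and> ?w a *\<^sub>R f a \<noteq> 0. ?w a *\<^sub>R f a) = (\<Sum>l\<in>F. ?w l *\<^sub>R f l)"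
      by (rule sum.mono_neutral_left[OF finF]) (use sub in auto)
  qed
  also have "\<dots> = (\<Sum>l\<in>F. autocorrelation_coefficient k A L l *\<^sub>R f l)"
    by (intro sum.cong refl) (simp only: F_def Int_iff autocorrelation_coefficient_eq[OF L s])
  finally have val: "(LINT x|?\<gamma>. f x) = (\<Sum>l\<in>F. autocorrelation_coefficient k A L l *\<^sub>R f l)" .
  have lim: "((\<lambda>R. \<Sum>l\<in>F. (card {x \<in> ?V \<inter> ball 0 R. x - l \<in> ?V \<inter> ball 0 R} / (R ^ CARD('n) * unit_ball_vol (real CARD('n)))) *\<^sub>R f l)
     \<longlongrightarrow> (LINT x|?\<gamma>. f x)) at_top"
    unfolding val
  proof (intro tendsto_sum tendsto_scaleR tendsto_const)
    fix l assume "l \<in> F"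
    then show "((\<lambda>R. card {x \<in> ?V \<inter> ball 0 R. x - l \<in> ?V \<inter> ball 0 R} / (R ^ CARD('n) * unit_ball_vol (real CARD('n))))
      \<longlongrightarrow> autocorrelation_coefficient k A L l) at_top"
      by (intro pair_count_tendsto[OF L k s]) (simp add: F_def)
  qed
  have ev: "eventually (\<lambda>R. (\<Sum>l\<in>F. (card {x \<in> ?V \<inter> ball 0 R. x - l \<in> ?V \<inter> ball 0 R} / (R ^ CARD('n) * unit_ball_vol (real CARD('n)))) *\<^sub>R f l)
     = (LINT x|finite_autocorrelation ?V R. f x)) at_top"
    using eventually_gt_at_top[of "0::real"]
  proof eventually_elim
    case (elim R)
    have "finite (?V \<inter> ball 0 R)"
      by (rule finite_subset[OF _ lattice_finite_ball[OF L, of 0 R]]) (use VL in auto)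
    from integral_finite_autocorrelation[OF this elim fm finF inF] show ?case by simp
  qed
  show "((\<lambda>R. LINT x|finite_autocorrelation ?V R. f x) \<longlongrightarrow> (LINT x|?\<gamma>. f x)) at_top"
    by (rule Lim_transform_eventually[OF lim ev])
qed

section \<open>The diffraction measure\<close>

text \<open>One factor \<open>1 / |det A|\<close> is the density of \<open>L\<close>, the other
  comes from Poisson summation.\<close>

definition diffraction_weight :: "nat \<Rightarrow> (real^'n^'n) \<Rightarrow> nat \<Rightarrow> real" where
  "diffraction_weight k A d = xi (real (CARD('n) * k)) / \<bar>det A\<bar>\<^sup>2 *
     (if squarefree d then \<Prod>p\<in>prime_factors d. 1 / (real p ^ (2 * CARD('n) * k) - 2 * real p ^ (CARD('n) * k)) else 0)"

abbreviation (input) fractions :: "nat \<Rightarrow> (real^'n) set \<Rightarrow> (real^'n) set" where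
  "fractions m M \<equiv> (\<lambda>x. x /\<^sub>R real m) ` M"

definition diffraction :: "nat \<Rightarrow> (real^'n^'n) \<Rightarrow> (real^'n) set \<Rightarrow> (real^'n) measure" where
  "diffraction k A L = comb_series (diffraction_weight k A) (\<lambda>d. fractions (d ^ k) (dual_lattice L))"

lemma squarefree_pos: "squarefree d \<Longrightarrow> d \<ge> (1::nat)"
  using not_squarefree_0 by (cases d) auto

lemma in_fractions_iff: "m \<ge> 1 \<Longrightarrow> y \<in> fractions m M \<longleftrightarrow> real m *\<^sub>R y \<in> M"
  by (force simp: image_iff)

lemma dual_lattice_multiples:
  assumes "m \<ge> 1"
  shows "dual_lattice (multiples m L) = fractions m (dual_lattice L)"
  by (rule set_eqI, unfold in_fractions_iff[OF assms]) (simp add: dual_lattice_def)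

lemma squarefree_power_eq_prod:
  assumes "squarefree (d::nat)"
  shows "real d ^ s = (\<Prod>p\<in>prime_factors d. real p ^ s)"
proof -
  have "real d ^ s = real (\<Prod>(prime_factors d)) ^ s" by (simp only: squarefree_eq_prod_primes[OF assms])
  then show ?thesis by (simp add: prod_power_distrib)
qed

text \<open>Used twice: it matches the two series under Poisson summation for \<open>d^k L\<close>,
  whose determinant is \<open>d^(nk) |det A|\<close>, and it makes the diffraction weights summable
  against \<open>d^(nk)\<close>, the order of density of the dual lattice divided by
  \<open>d^k\<close>.\<close>

lemma weight_relation:
  fixes A :: "real^'n^'n"
  assumes s: "CARD('n) * k \<ge> 2" and A: "det A \<noteq> 0"
  shows "diffraction_weight k A d * real d ^ (CARD('n) * k) = autocorrelation_weight k A d / \<bar>det A\<bar>"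
proof (cases "squarefree d")
  case True
  let ?s = "CARD('n) * k"
  have "(\<Prod>p\<in>prime_factors d. 1 / (real p ^ (2 * CARD('n) * k) - 2 * real p ^ ?s)) * real d ^ ?s =
     (\<Prod>p\<in>prime_factors d. 1 / (real p ^ ?s - 2))"
    unfolding squarefree_power_eq_prod[OF True] prod.distrib[symmetric]
  proof (intro prod.cong refl)
    fix p assume "p \<in> prime_factors d"
    then have P: "real p ^ ?s \<ge> 4" by (intro prime_power_ge_4 s) auto
    have e: "real p ^ (2 * CARD('n) * k) = real p ^ ?s * real p ^ ?s"
    proof -
      have "2 * CARD('n) * k = ?s + ?s" by simp
      then show ?thesis by (simp only: power_add)
    qed
    have "1 / (P * P - 2 * P) * P = 1 / (P - 2)" if "P \<ge> 4" for P :: real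
    proof -
      have "P * P - 2 * P = P * (P - 2)" by (simp add: algebra_simps)
      then show ?thesis using that by simp
    qed
    from this[OF P] show "1 / (real p ^ (2 * CARD('n) * k) - 2 * real p ^ ?s) * real p ^ ?s = 1 / (real p ^ ?s - 2)"
      unfolding e .
  qed
  then show ?thesis using True A
    by (simp add: diffraction_weight_def autocorrelation_weight_def power2_eq_square mult.assoc)
qed (simp add: diffraction_weight_def autocorrelation_weight_def)

lemma diffraction_weight_nonneg_summable:
  fixes A :: "real^'n^'n"
  assumes s: "CARD('n) * k \<ge> 2"
  shows "diffraction_weight k A d \<ge> 0" "summable (diffraction_weight k A)"
    "diffraction_weight k A d > 0 \<Longrightarrow> squarefree d"
proof -
  have e: "2 * CARD('n) * k = 2 * (CARD('n) * k)" by simp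
  have "(\<Prod>p\<in>prime_factors d. 1 / (real p ^ (2 * CARD('n) * k) - 2 * real p ^ (CARD('n) * k))) \<ge> 0"
  proof (intro prod_nonneg)
    fix p assume "p \<in> prime_factors d"
    then have "real p ^ (CARD('n) * k) \<ge> 4" by (intro prime_power_ge_4 s) auto
    from local_factor_bounds(4)[OF this]
    show "0 \<le> 1 / (real p ^ (2 * CARD('n) * k) - 2 * real p ^ (CARD('n) * k))"
      unfolding e by (simp only: mult_2 power_add)
  qed
  then show "diffraction_weight k A d \<ge> 0"
    unfolding diffraction_weight_def using xi_nonneg[OF s] by auto
  show "summable (diffraction_weight k A)"
    unfolding diffraction_weight_def[abs_def] e
    using xi_times_squarefree_sum_dual(1)[OF s, of "{}"] by (intro summable_mult) simp
  show "diffraction_weight k A d > 0 \<Longrightarrow> squarefree d"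
    unfolding diffraction_weight_def by (auto split: if_splits)
qed

text \<open>Rationality of \<open>y\<close> provides a positive multiplier into the dual lattice, so
  \<open>LEAST\<close> is attained; division with remainder shows that the least one divides all
  others.\<close>

lemma denominator_dvd_iff:
  fixes L :: "(real^'n) set"
  assumes M: "lattice_basis B (dual_lattice L)" and y: "y \<in> rational_multiples (dual_lattice L)"
  shows "denominator L y \<ge> 1" "real m *\<^sub>R y \<in> dual_lattice L \<longleftrightarrow> denominator L y dvd m"
proof -
  let ?q = "denominator L y"
  obtain r w where w: "w \<in> dual_lattice L" "y = real_of_rat r *\<^sub>R w"
    using y unfolding rational_multiples_def by blast
  obtain a b :: int where ab: "r = Fract a b" "b > 0" by (cases r) auto
  have "real (nat b) *\<^sub>R y = of_int a *\<^sub>R w"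
    using ab by (simp add: w(2) of_rat_rat)
  then have "real (nat b) *\<^sub>R y \<in> dual_lattice L" using lattice_scale_int[OF M w(1), of a] by simp
  then have ex: "nat b \<ge> 1 \<and> real (nat b) *\<^sub>R y \<in> dual_lattice L" using ab by auto
  have q: "?q \<ge> 1 \<and> real ?q *\<^sub>R y \<in> dual_lattice L"
    unfolding denominator_def by (rule LeastI[where P = "\<lambda>a. a \<ge> 1 \<and> real a *\<^sub>R y \<in> dual_lattice L", OF ex])
  have least: "?q \<le> j" if "j \<ge> 1" "real j *\<^sub>R y \<in> dual_lattice L" for j
    unfolding denominator_def using that by (intro Least_le) simp
  show "?q \<ge> 1" using q by simp
  show "real m *\<^sub>R y \<in> dual_lattice L \<longleftrightarrow> ?q dvd m"
  proof
    assume m: "real m *\<^sub>R y \<in> dual_lattice L"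
    have "real m = real (m div ?q) * real ?q + real (m mod ?q)"
      by (metis div_mult_mod_eq of_nat_add of_nat_mult)
    then have "real (m mod ?q) *\<^sub>R y = real m *\<^sub>R y - real (m div ?q) *\<^sub>R (real ?q *\<^sub>R y)"
      by (simp add: scaleR_left_distrib)
    also have "\<dots> \<in> dual_lattice L"
      using lattice_diff[OF M m lattice_scale_nat[OF M conjunct2[OF q]]] .
    finally have "real (m mod ?q) *\<^sub>R y \<in> dual_lattice L" .
    moreover have "m mod ?q < ?q" using q by simp
    ultimately have "m mod ?q = 0" using least[of "m mod ?q"] by linarith
    then show "?q dvd m" by (simp add: dvd_eq_mod_eq_0)
  next
    assume "?q dvd m"
    then obtain j where "m = ?q * j" by (auto elim: dvdE)
    then have "real m *\<^sub>R y = real j *\<^sub>R (real ?q *\<^sub>R y)" by (simp add: mult.commute)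
    then show "real m *\<^sub>R y \<in> dual_lattice L"
      using lattice_scale_nat[OF M conjunct2[OF q], of j] by (simp only:)
  qed
qed

lemma multiplicity_squarefree_power:
  assumes "squarefree (d::nat)" "prime p"
  shows "multiplicity p (d ^ k) \<le> k" "p dvd d \<Longrightarrow> multiplicity p (d ^ k) = k"
proof -
  have d: "d \<noteq> 0" using squarefree_pos[OF assms(1)] by simp
  have m: "multiplicity p (d ^ k) = k * multiplicity p d"
    using assms d by (intro prime_elem_multiplicity_power_distrib) auto
  have le: "multiplicity p d \<le> 1" using assms d squarefree_factorial_semiring'' by blast
  then show "multiplicity p (d ^ k) \<le> k" unfolding m by (cases "multiplicity p d") auto
  assume "p dvd d"
  then have "multiplicity p d > 0" 
    using prime_multiplicity_gt_zero_iff[OF prime_imp_prime_elem[OF assms(2)] d] by blast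
  then show "multiplicity p (d ^ k) = k" using le unfolding m by simp
qed

text \<open>Exponents in \<open>q\<close> are at most \<open>k\<close>, and at the primes of
  \<open>d\<close> the exponent in \<open>d^k\<close> is exactly \<open>k\<close>, so only the
  supports matter.\<close>

lemma power_free_dvd_squarefree_power:
  assumes d: "squarefree (d::nat)" and q: "power_free (k + 1) q" "q \<ge> 1"
  shows "q dvd d ^ k \<longleftrightarrow> prime_factors q \<subseteq> prime_factors d"
proof
  have d0: "d \<noteq> 0" "q \<noteq> 0" using squarefree_pos[OF d] q by auto
  show "prime_factors q \<subseteq> prime_factors d" if dvd: "q dvd d ^ k"
  proof
    fix p assume p: "p \<in> prime_factors q"
    then have pp: "prime p" "p dvd q" by auto
    then have "p dvd d ^ k" using dvd dvd_trans by blast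
    then have "p dvd d" using pp(1) prime_dvd_power by blast
    then show "p \<in> prime_factors d" using pp d0 by (simp add: in_prime_factors_iff)
  qed
  show "q dvd d ^ k" if sub: "prime_factors q \<subseteq> prime_factors d"
  proof (rule multiplicity_le_imp_dvd)
    show "q \<noteq> 0" by fact
    fix p :: nat assume p: "prime p"
    show "multiplicity p q \<le> multiplicity p (d ^ k)"
    proof (cases "p dvd q")
      case True
      then have "p \<in> prime_factors q" using p d0 by (simp add: in_prime_factors_iff)
      then have "p dvd d" using sub by auto
      then have "multiplicity p (d ^ k) = k" by (rule multiplicity_squarefree_power(2)[OF d p])
      moreover have "\<not> p ^ (k + 1) dvd q" using q(1) p unfolding power_free_def by blast
      then have "multiplicity p q < k + 1" using d0 p
        by (meson multiplicity_dvd' not_less prime_elem_not_unit prime_imp_prime_elem)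
      ultimately show ?thesis by simp
    qed (simp add: not_dvd_imp_multiplicity_0)
  qed
qed

section \<open>Partial sums, intensities and support of the diffraction\<close>

lemma tempered_finite_combination:
  fixes m :: "nat \<Rightarrow> (real^'n) measure"
  assumes "finite I" "\<And>i. i \<in> I \<Longrightarrow> poly_growth (m i) (C i)"
  shows "tempered_distribution (\<lambda>f. c * (\<Sum>i\<in>I. w i * distribution_of (m i) f))"
  unfolding tempered_distribution_def
proof (intro conjI allI impI exI)
  fix f g :: "real^'n \<Rightarrow> complex" and a b :: complex
  assume fg: "schwartz f" "schwartz g"
  have "distribution_of (m i) (\<lambda>x. a * f x + b * g x) = a * distribution_of (m i) f + b * distribution_of (m i) g"
    if "i \<in> I" for i
    using poly_growth_tempered(2)[OF assms(2)[OF that]] fg unfolding tempered_distribution_def by blast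
  then have "(\<Sum>i\<in>I. w i * distribution_of (m i) (\<lambda>x. a * f x + b * g x)) =
     (\<Sum>i\<in>I. a * (w i * distribution_of (m i) f) + b * (w i * distribution_of (m i) g))"
    by (intro sum.cong refl) (simp add: algebra_simps)
  then show "c * (\<Sum>i\<in>I. w i * distribution_of (m i) (\<lambda>x. a * f x + b * g x)) =
     a * (c * (\<Sum>i\<in>I. w i * distribution_of (m i) f)) + b * (c * (\<Sum>i\<in>I. w i * distribution_of (m i) g))"
    by (simp add: sum.distrib sum_distrib_left algebra_simps)
next
  fix f :: "real^'n \<Rightarrow> complex" assume f: "schwartz f"
  have "norm (\<Sum>i\<in>I. w i * distribution_of (m i) f) \<le>
      (\<Sum>i\<in>I. norm (w i) * (C i * inverse_squares_sum * schwartz_norm (CARD('n) + 2) f))"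
    unfolding distribution_of_def
  proof (rule sum_norm_le)
    fix i assume i: "i \<in> I"
    show "norm (w i * (LINT x|m i. f x)) \<le> norm (w i) * (C i * inverse_squares_sum * schwartz_norm (CARD('n) + 2) f)"
      unfolding norm_mult by (intro mult_left_mono poly_growth_schwartz(2)[OF assms(2)[OF i] f] norm_ge_zero)
  qed
  then have "norm c * norm (\<Sum>i\<in>I. w i * distribution_of (m i) f) \<le>
     norm c * (\<Sum>i\<in>I. norm (w i) * (C i * inverse_squares_sum * schwartz_norm (CARD('n) + 2) f))"
    by (intro mult_left_mono) auto
  then show "norm (c * (\<Sum>i\<in>I. w i * distribution_of (m i) f)) \<le>
     (norm c * (\<Sum>i\<in>I. norm (w i) * (C i * inverse_squares_sum))) * schwartz_norm (CARD('n) + 2) f"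
    by (simp only: norm_mult sum_distrib_right mult.assoc)
qed

text \<open>Passes from partial sums over \<open>d < Suc N\<close> to the indexing of the theorem;
  the weight is 0 off the squarefree numbers, in particular at \<open>d = 0\<close>. Both real and
  complex values are covered, for measures and for distributions.\<close>

lemma sum_weights:
  fixes h :: "nat \<Rightarrow> 'b::real_algebra_1"
  shows "(\<Sum>d<Suc N. of_real (diffraction_weight k (A :: real^'n^'n) d) * h d) =
    of_real (xi (real (CARD('n) * k)) / \<bar>det A\<bar>\<^sup>2) * (\<Sum>d | d \<in> {1..N} \<and> squarefree d.
       of_real (\<Prod>p\<in>prime_factors d. 1 / (real p ^ (2 * CARD('n) * k) - 2 * real p ^ (CARD('n) * k))) * h d)"
proof -
  have "(\<Sum>d<Suc N. of_real (diffraction_weight k A d) * h d) =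
     (\<Sum>d | d \<in> {1..N} \<and> squarefree d. of_real (diffraction_weight k A d) * h d)"
  proof (rule sum.mono_neutral_right)
    show "{d. d \<in> {1..N} \<and> squarefree d} \<subseteq> {..<Suc N}" by auto
    show "\<forall>d\<in>{..<Suc N} - {d. d \<in> {1..N} \<and> squarefree d}. of_real (diffraction_weight k A d) * h d = 0"
      using squarefree_pos by (auto simp: diffraction_weight_def)
  qed simp
  also have "\<dots> = (\<Sum>d | d \<in> {1..N} \<and> squarefree d. of_real (xi (real (CARD('n) * k)) / \<bar>det A\<bar>\<^sup>2) *
       (of_real (\<Prod>p\<in>prime_factors d. 1 / (real p ^ (2 * CARD('n) * k) - 2 * real p ^ (CARD('n) * k))) * h d))"
    by (intro sum.cong refl) (simp only: diffraction_weight_def mem_Collect_eq if_True of_real_mult mult.assoc)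
  finally show ?thesis by (simp only: sum_distrib_left)
qed

text \<open>The point \<open>y\<close> lies in the comb of index \<open>d\<close> exactly if its
  denominator divides \<open>d^k\<close>, that is, if all primes of the denominator divide
  \<open>d\<close>; the mass is thus the squarefree sum of
  \<open>xi_times_squarefree_sum_dual\<close>.\<close>

lemma measure_diffraction_singleton:
  fixes A :: "real^'n^'n"
  assumes L: "lattice_basis A L" and s: "CARD('n) * k \<ge> 2"
    and y: "y \<in> rational_multiples (dual_lattice L)" and q: "power_free (k + 1) (denominator L y)"
  shows "measure (diffraction k A L) {y} = 1 / (zeta (real (CARD('n) * k)))\<^sup>2 *
      (\<Prod>p\<in>prime_factors (denominator L y). 1 / (real p ^ (CARD('n) * k) - 1)\<^sup>2) / \<bar>det A\<bar>\<^sup>2"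
proof -
  let ?c = "diffraction_weight k A" and ?S = "\<lambda>d. fractions (d ^ k) (dual_lattice L)"
  let ?Q = "prime_factors (denominator L y)"
  note B = lattice_basis_dual[OF L]
  note c = diffraction_weight_nonneg_summable[OF s, of A]
  let ?w = "\<lambda>d. if squarefree d \<and> ?Q \<subseteq> prime_factors d
             then \<Prod>p\<in>prime_factors d. 1 / (real p ^ (2 * (CARD('n) * k)) - 2 * real p ^ (CARD('n) * k)) else 0"
  have "?c d * indicator (?S d) y = xi (real (CARD('n) * k)) / \<bar>det A\<bar>\<^sup>2 * ?w d" for d
  proof (cases "squarefree d")
    case True
    have "d ^ k \<ge> 1" using squarefree_pos[OF True] by simp
    then have "y \<in> ?S d \<longleftrightarrow> real (d ^ k) *\<^sub>R y \<in> dual_lattice L" by (rule in_fractions_iff)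
    also have "\<dots> \<longleftrightarrow> denominator L y dvd d ^ k" by (rule denominator_dvd_iff(2)[OF B y])
    also have "\<dots> \<longleftrightarrow> ?Q \<subseteq> prime_factors d"
      by (rule power_free_dvd_squarefree_power[OF True q denominator_dvd_iff(1)[OF B y]])
    finally show ?thesis using True
      by (simp add: diffraction_weight_def indicator_def mult.assoc del: of_nat_power)
  qed (simp add: diffraction_weight_def)
  then have "(\<Sum>d. ?c d * indicator (?S d) y) = xi (real (CARD('n) * k)) / \<bar>det A\<bar>\<^sup>2 * suminf ?w"
    using suminf_mult[OF xi_times_squarefree_sum_dual(1)[OF s, of ?Q]] by (simp only: finite_set_mset in_prime_factors_imp_prime)
  also have "\<dots> = (xi (real (CARD('n) * k)) * suminf ?w) / \<bar>det A\<bar>\<^sup>2" by simp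
  also have "xi (real (CARD('n) * k)) * suminf ?w = 1 / (zeta (real (CARD('n) * k)))\<^sup>2 *
      (\<Prod>p\<in>?Q. 1 / (real p ^ (CARD('n) * k) - 1)\<^sup>2)"
    by (rule xi_times_squarefree_sum_dual(2)[OF s]) auto
  finally have val: "(\<Sum>d. ?c d * indicator (?S d) y) = 1 / (zeta (real (CARD('n) * k)))\<^sup>2 *
      (\<Prod>p\<in>?Q. 1 / (real p ^ (CARD('n) * k) - 1)\<^sup>2) / \<bar>det A\<bar>\<^sup>2" .
  have "measure (diffraction k A L) {y} = (\<Sum>d. ?c d * indicator (?S d) y)"
    unfolding diffraction_def comb_series_def measure_def emeasure_weighted_comb_singleton
    by (rule enn2real_ennreal) (rule comb_weight_nonneg[OF c(2,1)])
  then show ?thesis using val by simp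
qed

text \<open>All mass sits on the countable union \<open>U\<close> of the combs with squarefree
  index. A point of \<open>U\<close> has a denominator dividing some \<open>d^k\<close>, in which no
  prime has an exponent above \<open>k\<close>.\<close>

lemma AE_diffraction:
  fixes A :: "real^'n^'n"
  assumes L: "lattice_basis A L" and s: "CARD('n) * k \<ge> 2"
  shows "AE y in diffraction k A L. y \<in> rational_multiples (dual_lattice L) \<and> power_free (k + 1) (denominator L y)"
proof -
  let ?S = "\<lambda>d. fractions (d ^ k) (dual_lattice L)"
  note B = lattice_basis_dual[OF L]
  note c = diffraction_weight_nonneg_summable[OF s, of A]
  define U where "U = (\<Union>d\<in>{d. squarefree d}. ?S d)"
  have "countable U" unfolding U_def using lattice_basis_countable[OF B] by auto
  then have "U \<in> sets borel" by (rule sets.countable[rotated]) auto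
  then have N: "- U \<in> sets borel" by auto
  have z: "ennreal (diffraction_weight k A d) * emeasure (dirac_comb (?S d)) (- U) = 0" for d
  proof (cases "squarefree d")
    case True
    then have "- U \<inter> ?S d = {}" unfolding U_def by blast
    then have "emeasure (dirac_comb (?S d)) (- U) = 0" unfolding emeasure_dirac_comb[OF N] by (simp only: emeasure_empty)
    then show ?thesis by simp
  qed (simp add: diffraction_weight_def)
  have "emeasure (diffraction k A L) (- U) = 0"
    unfolding diffraction_def emeasure_comb_series[OF c(2,1) N] z by simp
  then have null: "- U \<in> null_sets (diffraction k A L)"
    using N by (intro null_setsI) (auto simp: diffraction_def comb_series_def)
  show ?thesis
  proof (rule AE_I'[OF null], intro subsetI ComplI)
    fix y assume y: "y \<in> {y \<in> space (diffraction k A L). \<not> (y \<in> rational_multiples (dual_lattice L) \<and>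
      power_free (k + 1) (denominator L y))}" and "y \<in> U"
    then obtain d where d: "squarefree d" "y \<in> ?S d" unfolding U_def by blast
    have dk: "d ^ k \<ge> 1" using squarefree_pos[OF d(1)] by simp
    have my: "real (d ^ k) *\<^sub>R y \<in> dual_lattice L" using d(2) in_fractions_iff[OF dk] by blast
    have cancel: "y = real_of_rat (1 / of_nat m) *\<^sub>R (real m *\<^sub>R y)" if "m \<ge> 1" for m
      using that by (simp add: of_rat_divide)
    have yQ: "y \<in> rational_multiples (dual_lattice L)"
      unfolding rational_multiples_def mem_Collect_eq
    proof (intro exI conjI)
      show "y = real_of_rat (1 / of_nat (d ^ k)) *\<^sub>R (real (d ^ k) *\<^sub>R y)"
        using cancel[OF dk] .
    qed (rule my)
    have dvd: "denominator L y dvd d ^ k" using my denominator_dvd_iff(2)[OF B yQ] by blast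
    have "power_free (k + 1) (denominator L y)"
      unfolding power_free_def
    proof (intro allI impI notI)
      fix p :: nat assume p: "prime p" "p ^ (k + 1) dvd denominator L y"
      then have "p ^ (k + 1) dvd d ^ k" using dvd dvd_trans by blast
      then have "k + 1 \<le> multiplicity p (d ^ k)"
        using p(1) squarefree_pos[OF d(1)] by (intro multiplicity_geI) auto
      then show False using multiplicity_squarefree_power(1)[OF d(1) p(1), of k] by linarith
    qed
    then show False using y yQ by blast
  qed
qed

theorem theorem8:
  fixes L :: "(real^'n) set" and k :: nat
  assumes "is_lattice L"
    and "k \<ge> 1"
    and "CARD('n) = 1 \<Longrightarrow> k \<ge> 2"
  shows "\<exists>\<gamma> \<mu>.
    natural_autocorrelation (k_free_points k L) \<gamma> \<and>
    is_fourier_transform \<gamma> \<mu> \<and>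
    pure_point \<mu> \<and>
    translation_bounded \<mu> \<and>
    (AE y in \<mu>. y \<in> rational_multiples (dual_lattice L) \<and> power_free (k + 1) (denominator L y)) \<and>
    (\<forall>y \<in> rational_multiples (dual_lattice L). power_free (k + 1) (denominator L y) \<longrightarrow>
       measure \<mu> {y} =
         1 / (zeta (real (CARD('n) * k)))\<^sup>2 *
         (\<Prod>p\<in>prime_factors (denominator L y). 1 / (real p ^ (CARD('n) * k) - 1)\<^sup>2) /
         (lattice_det L)\<^sup>2) \<and>
    weak_star_lim
      (\<lambda>N f. complex_of_real (xi (real (CARD('n) * k)) / (lattice_det L)\<^sup>2) *
         (\<Sum>d | d \<in> {1..N} \<and> squarefree d.
            complex_of_real (\<Prod>p\<in>prime_factors d.
              1 / (real p ^ (2 * CARD('n) * k) - 2 * real p ^ (CARD('n) * k))) *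
            distribution_of (dirac_comb ((\<lambda>x. x /\<^sub>R real (d ^ k)) ` dual_lattice L)) f))
      (distribution_of \<mu>) \<and>
    (\<lambda>N. loc_norm (\<lambda>B. measure \<mu> B -
         xi (real (CARD('n) * k)) / (lattice_det L)\<^sup>2 *
         (\<Sum>d | d \<in> {1..N} \<and> squarefree d.
            (\<Prod>p\<in>prime_factors d.
              1 / (real p ^ (2 * CARD('n) * k) - 2 * real p ^ (CARD('n) * k))) *
            measure (dirac_comb ((\<lambda>x. x /\<^sub>R real (d ^ k)) ` dual_lattice L)) B)))
      \<longlonglongrightarrow> 0"
proof -
  \<comment> \<open>The same choice as in \<open>lattice_det\<close>, so that its value is
    \<open>|det A|\<close> by unfolding.\<close>
  define A where "A = (SOME A. lattice_basis A L)"
  have L: "lattice_basis A L"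
    unfolding A_def using assms(1) unfolding is_lattice_def by (rule someI_ex)
  have det: "lattice_det L = \<bar>det A\<bar>" unfolding lattice_det_def A_def ..
  have detA: "\<bar>det A\<bar> > 0" by (rule lattice_basis_det_pos[OF L])
  \<comment> \<open>The case distinction on the dimension is exactly the condition
    \<open>nk \<ge> 2\<close>.\<close>
  have s: "CARD('n) * k \<ge> 2"
  proof (cases "CARD('n) = 1")
    case False
    have "CARD('n) > 0" by simp
    with False have "CARD('n) \<ge> 2" by linarith
    then have "2 * 1 \<le> CARD('n) * k" using assms(2) by (rule mult_le_mono)
    then show ?thesis by simp
  qed (use assms(3) in simp)
  define c where "c = diffraction_weight k A"
  define S where "S d = fractions (d ^ k) (dual_lattice L)" for d
  define \<mu> where "\<mu> = comb_series c S"
  define a where "a = autocorrelation_weight k A"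
  define M where "M d = multiples (d ^ k) L" for d
  define \<gamma> where "\<gamma> = comb_series a M"
  note c = diffraction_weight_nonneg_summable(2,1)[OF s, of A, folded c_def]
  have c_sf: "squarefree d" if "c d > 0" for d
    using diffraction_weight_nonneg_summable(3)[OF s] that unfolding c_def by blast
  note a = autocorrelation_weight_nonneg_summable(2,1)[OF s, of A, folded a_def]
  have a_sf: "squarefree d" if "a d > 0" for d
    using that unfolding a_def autocorrelation_weight_def by (auto split: if_splits)
  have rel: "c d * real d ^ (CARD('n) * k) = a d / \<bar>det A\<bar>" for d
    using weight_relation[OF s, of A d] detA unfolding c_def a_def by simp
  note B = lattice_basis_dual[OF L]
  obtain C where C: "C \<ge> 0"
    "\<And>t. 0 < t \<Longrightarrow> t \<le> 1 \<Longrightarrow> poly_growth (dirac_comb ((\<lambda>x. t *\<^sub>R x) ` dual_lattice L)) (C / t ^ CARD('n))"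
    "\<And>t x. 0 < t \<Longrightarrow> t \<le> 1 \<Longrightarrow> card ((\<lambda>x. t *\<^sub>R x) ` dual_lattice L \<inter> ball x 1) \<le> C / t ^ CARD('n)"
    using poly_growth_scaled_comb[OF B] by blast
  obtain C' where C': "C' \<ge> 0" "\<And>t. t \<ge> 1 \<Longrightarrow> poly_growth (dirac_comb ((\<lambda>x. t *\<^sub>R x) ` L)) C'"
    using poly_growth_scaled_comb[OF L] by blast
  \<comment> \<open>The bound for the dual lattice divided by \<open>d^k\<close>, both as growth
    constant and as count in a unit ball. By \<open>rel\<close>, the series of
    \<open>c d * K d\<close> is a multiple of that of \<open>a d\<close>.\<close>
  define K where "K d = C * real d ^ (CARD('n) * k)" for d
  have K0: "K d \<ge> 0" for d using C(1) by (simp add: K_def)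
  have Ksum: "summable (\<lambda>d. c d * K d)"
  proof -
    have "c d * K d = C / \<bar>det A\<bar> * a d" for d
      using rel[of d] by (simp add: K_def mult.left_commute)
    then show ?thesis using summable_mult[OF a(1)] by simp
  qed
  have inv: "0 < inverse (real (d ^ k))" "inverse (real (d ^ k)) \<le> 1"
     "C / inverse (real (d ^ k)) ^ CARD('n) = K d" if "squarefree d" for d
  proof -
    have d: "real d \<ge> 1" using squarefree_pos[OF that] by simp
    then have "real d ^ k \<ge> 1" by (rule one_le_power)
    from this d show "0 < inverse (real (d ^ k))" "inverse (real (d ^ k)) \<le> 1" by (auto simp: inverse_le_1_iff)
    show "C / inverse (real (d ^ k)) ^ CARD('n) = K d"
      by (simp add: K_def power_inverse divide_inverse power_mult[symmetric] mult.commute)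
  qed
  have S_growth: "poly_growth (dirac_comb (S d)) (K d)" if "squarefree d" for d
    using C(2)[OF inv(1,2)[OF that]] unfolding inv(3)[OF that] S_def .
  have S_ball: "emeasure (dirac_comb (S d)) (ball x 1) \<le> ennreal (K d)" if "squarefree d" for d x
  proof -
    have card: "card (S d \<inter> ball x 1) \<le> K d"
      using C(3)[OF inv(1,2)[OF that], of x] unfolding inv(3)[OF that] S_def .
    have "lattice_basis (inverse (real (d ^ k)) *\<^sub>R transpose (matrix_inv A)) (S d)"
      unfolding S_def by (rule lattice_basis_scaleR(1)[OF B]) (use inv(1)[OF that] in linarith)
    then have "finite (S d \<inter> ball x 1)" by (rule lattice_finite_ball)
    then show ?thesis using card
      by (simp add: emeasure_dirac_comb Int_commute ennreal_of_nat_eq_real_of_nat ennreal_leI)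
  qed
  have M_growth: "poly_growth (dirac_comb (M d)) C'" if "squarefree d" for d
  proof -
    have "real d \<ge> 1" using squarefree_pos[OF that] by simp
    then have "real d ^ k \<ge> 1" by (rule one_le_power)
    then have "real (d ^ k) \<ge> 1" by simp
    from C'(2)[OF this] show ?thesis unfolding M_def .
  qed
  have \<mu>_growth: "poly_growth \<mu> (\<Sum>d. c d * K d)"
    unfolding \<mu>_def by (rule poly_growth_comb_series[OF c S_growth[OF c_sf] K0 Ksum])
  have \<gamma>_growth: "poly_growth \<gamma> (\<Sum>d. a d * C')"
    unfolding \<gamma>_def by (rule poly_growth_comb_series[OF a M_growth[OF a_sf] C'(1) summable_mult2[OF a(1)]])

  have sums_\<mu>: "(\<lambda>d. c d *\<^sub>R (LINT x|dirac_comb (S d). f x)) sums (LINT x|\<mu>. f x)" if f: "schwartz f" for f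
    unfolding \<mu>_def
    by (rule integral_comb_series[OF c S_growth[OF c_sf] K0 Ksum schwartz_borel[OF f] schwartz_decay[OF f]])

  have "natural_autocorrelation (k_free_points k L) \<gamma>"
    using natural_autocorrelation_k_free[OF L assms(2) s] poly_growth_tempered(1)[OF \<gamma>_growth]
    unfolding \<gamma>_def a_def M_def[abs_def] by blast
  moreover have "is_fourier_transform \<gamma> \<mu>"
    unfolding is_fourier_transform_def
  proof (intro conjI allI impI poly_growth_tempered(3)[OF \<gamma>_growth] poly_growth_tempered(3)[OF \<mu>_growth])
    fix f :: "real^'n \<Rightarrow> complex" assume f: "schwartz f"
    obtain D where D: "\<And>y. norm (fourier f y) \<le> D / (1 + norm y) ^ (CARD('n) + 2)"
      using fourier_decay[OF f] by blast
    have "(\<lambda>d. a d *\<^sub>R (LINT x|dirac_comb (M d). fourier f x)) sums (LINT x|\<gamma>. fourier f x)"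
      unfolding \<gamma>_def
      by (rule integral_comb_series[OF a M_growth[OF a_sf] C'(1) summable_mult2[OF a(1)] fourier_borel[OF f] D])
    \<comment> \<open>Poisson summation for \<open>d^k L\<close> yields the dual lattice divided by
      \<open>d^k\<close> and the factor \<open>1 / (d^(nk) |det A|)\<close>, which
      \<open>rel\<close> uses to turn \<open>a d\<close> into \<open>c d\<close>. Off the squarefree
      numbers both weights are 0.\<close>
    moreover have "a d *\<^sub>R (LINT x|dirac_comb (M d). fourier f x) = c d *\<^sub>R (LINT x|dirac_comb (S d). f x)" for d
    proof (cases "squarefree d")
      case True
      have d: "d ^ k \<ge> 1" "d > 0" using squarefree_pos[OF True] by auto
      have "(LINT x|dirac_comb (M d). fourier f x) =
          (LINT y|dirac_comb (S d). f y) / \<bar>det (real (d ^ k) *\<^sub>R A)\<bar>"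
        using poisson_summation_lattice[OF lattice_basis_multiples[OF L d(1)] f]
        unfolding M_def S_def dual_lattice_multiples[OF d(1)] .
      moreover have "\<bar>det (real (d ^ k) *\<^sub>R A)\<bar> = real d ^ (CARD('n) * k) * \<bar>det A\<bar>"
        using lattice_basis_scaleR(2)[OF L, of "real (d ^ k)"] d(2)
        by (simp add: power_mult[symmetric] mult.commute)
      moreover have "c d = a d / (real d ^ (CARD('n) * k) * \<bar>det A\<bar>)"
      proof -
        have "c d = c d * real d ^ (CARD('n) * k) / real d ^ (CARD('n) * k)" using d(2) by simp
        then show ?thesis unfolding rel by (simp only: divide_divide_eq_left mult.commute)
      qed
      ultimately show ?thesis by (simp add: scaleR_conv_of_real)
    qed (simp add: a_def c_def autocorrelation_weight_def diffraction_weight_def)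
    ultimately have "(LINT x|\<gamma>. fourier f x) = (LINT x|\<mu>. f x)"
      using sums_\<mu>[OF f] sums_unique2 by (simp only:) 
    then show "distribution_of \<mu> f = fourier_distribution (distribution_of \<gamma>) f"
      by (simp add: distribution_of_def fourier_distribution_def)
  qed
  moreover have "pure_point \<mu>"
    unfolding \<mu>_def comb_series_def by (rule pure_point_weighted_comb)
  moreover have "translation_bounded \<mu>"
    unfolding translation_bounded_def
  proof (intro conjI poly_growth_tempered(1)[OF \<mu>_growth])
    have "loc_norm (measure \<mu>) \<le> ennreal (\<Sum>d. c d * K d)"
    proof (rule loc_norm_le[of \<mu>])
      show "sets \<mu> = sets borel" by (simp add: \<mu>_def comb_series_def)
      show "ennreal \<bar>measure \<mu> B\<bar> = emeasure \<mu> B" if "B \<in> sets borel" "B \<subseteq> ball x 1" for B x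
        using measure_comb_series(2)[OF c that S_ball[OF c_sf] K0 Ksum] unfolding \<mu>_def by simp
      show "emeasure \<mu> (ball x 1) \<le> ennreal (\<Sum>d. c d * K d)" for x
        unfolding \<mu>_def by (rule emeasure_comb_series_le[OF c _ S_ball[OF c_sf] K0 Ksum]) simp
    qed
    then show "loc_norm (measure \<mu>) < \<infinity>" by (simp add: le_less_trans)
  qed
  moreover have "AE y in \<mu>. y \<in> rational_multiples (dual_lattice L) \<and> power_free (k + 1) (denominator L y)"
    using AE_diffraction[OF L s] unfolding \<mu>_def c_def S_def[abs_def] diffraction_def .
  moreover have "\<forall>y \<in> rational_multiples (dual_lattice L). power_free (k + 1) (denominator L y) \<longrightarrow>
       measure \<mu> {y} =
         1 / (zeta (real (CARD('n) * k)))\<^sup>2 *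
         (\<Prod>p\<in>prime_factors (denominator L y). 1 / (real p ^ (CARD('n) * k) - 1)\<^sup>2) /
         (lattice_det L)\<^sup>2"
    using measure_diffraction_singleton[OF L s] unfolding \<mu>_def c_def S_def[abs_def] diffraction_def det by blast
  moreover have "weak_star_lim
      (\<lambda>N f. complex_of_real (xi (real (CARD('n) * k)) / (lattice_det L)\<^sup>2) *
         (\<Sum>d | d \<in> {1..N} \<and> squarefree d.
            complex_of_real (\<Prod>p\<in>prime_factors d.
              1 / (real p ^ (2 * CARD('n) * k) - 2 * real p ^ (CARD('n) * k))) *
            distribution_of (dirac_comb ((\<lambda>x. x /\<^sub>R real (d ^ k)) ` dual_lattice L)) f))
      (distribution_of \<mu>)"
    unfolding weak_star_lim_def S_def[symmetric] det
  proof (intro conjI allI impI poly_growth_tempered(2)[OF \<mu>_growth])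
    fix N :: nat
    show "tempered_distribution (\<lambda>f. complex_of_real (xi (real (CARD('n) * k)) / \<bar>det A\<bar>\<^sup>2) *
         (\<Sum>d | d \<in> {1..N} \<and> squarefree d.
            complex_of_real (\<Prod>p\<in>prime_factors d.
              1 / (real p ^ (2 * CARD('n) * k) - 2 * real p ^ (CARD('n) * k))) *
            distribution_of (dirac_comb (S d)) f))"
      by (rule tempered_finite_combination[of _ _ K]) (auto intro: S_growth)
  next
    fix f :: "real^'n \<Rightarrow> complex" assume f: "schwartz f"
    \<comment> \<open>The \<open>N\<close>-th partial sum includes \<open>d = N\<close>, hence the
      shift to \<open>Suc N\<close>.\<close>
    from LIMSEQ_Suc[OF sums_\<mu>[OF f, unfolded sums_def]]
    show "(\<lambda>N. complex_of_real (xi (real (CARD('n) * k)) / \<bar>det A\<bar>\<^sup>2) *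
         (\<Sum>d | d \<in> {1..N} \<and> squarefree d.
            complex_of_real (\<Prod>p\<in>prime_factors d.
              1 / (real p ^ (2 * CARD('n) * k) - 2 * real p ^ (CARD('n) * k))) *
            distribution_of (dirac_comb (S d)) f)) \<longlonglongrightarrow> distribution_of \<mu> f"
      unfolding sum_weights[symmetric] c_def[symmetric] distribution_of_def scaleR_conv_of_real .
  qed
  moreover have "(\<lambda>N. loc_norm (\<lambda>B. measure \<mu> B -
         xi (real (CARD('n) * k)) / (lattice_det L)\<^sup>2 *
         (\<Sum>d | d \<in> {1..N} \<and> squarefree d.
            (\<Prod>p\<in>prime_factors d.
              1 / (real p ^ (2 * CARD('n) * k) - 2 * real p ^ (CARD('n) * k))) *
            measure (dirac_comb ((\<lambda>x. x /\<^sub>R real (d ^ k)) ` dual_lattice L)) B)))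
      \<longlonglongrightarrow> 0"
  proof -
    have weights: "xi (real (CARD('n) * k)) / \<bar>det A\<bar>\<^sup>2 *
         (\<Sum>d | d \<in> {1..N} \<and> squarefree d.
            (\<Prod>p\<in>prime_factors d.
              1 / (real p ^ (2 * CARD('n) * k) - 2 * real p ^ (CARD('n) * k))) *
            measure (dirac_comb (S d)) B) = (\<Sum>d<Suc N. c d * measure (dirac_comb (S d)) B)" for N B
      using sum_weights[of k A "\<lambda>d. measure (dirac_comb (S d)) B" N] unfolding c_def of_real_eq_id id_apply by simp
    \<comment> \<open>The tail coefficients. Their comb series is a positive measure that equals the
      error on Borel sets inside unit balls, so \<open>loc_norm_le\<close> bounds the local norm by
      the tail of the series of \<open>c d * K d\<close>.\<close>
    define cN where "cN N d = (if d < Suc N then 0 else c d)" for N d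
    have cN0: "cN N d \<ge> 0" for N d using c(2) by (simp add: cN_def)
    have cN_sf: "squarefree d" if "cN N d > 0" for N d
      using that c_sf unfolding cN_def by (auto split: if_splits)
    have cN_le: "cN N d \<le> c d" for N d using c(2) by (simp add: cN_def)
    have cNs: "summable (cN N)" for N
      by (rule summable_comparison_test'[OF c(1)]) (use cN0 cN_le in auto)
    have tail: "(\<lambda>d. cN N d * h d) sums ((\<Sum>d. c d * h d) - (\<Sum>d<Suc N. c d * h d))"
      if "summable (\<lambda>d. c d * h d)" for N and h :: "nat \<Rightarrow> real"
    proof -
      have "(\<lambda>d. if d \<in> {..<Suc N} then c d * h d else 0) sums (\<Sum>d<Suc N. c d * h d)"
        by (rule sums_If_finite_set) simp
      from sums_diff[OF summable_sums[OF that] this]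
      show ?thesis by (rule back_subst[of "\<lambda>g. g sums _"]) (auto simp: cN_def)
    qed
    have bound: "loc_norm (\<lambda>B. measure \<mu> B - (\<Sum>d<Suc N. c d * measure (dirac_comb (S d)) B))
        \<le> ennreal ((\<Sum>d. c d * K d) - (\<Sum>d<Suc N. c d * K d))" for N
    proof (rule loc_norm_le[of "comb_series (cN N) S"])
      note KN = tail[OF Ksum, of N]
      show "sets (comb_series (cN N) S) = sets borel" by (simp add: comb_series_def)
      fix B x assume Bx: "B \<in> sets borel" "B \<subseteq> ball (x :: real^'n) 1"
      have m1: "(\<lambda>d. c d * measure (dirac_comb (S d)) B) sums measure \<mu> B"
        unfolding \<mu>_def by (rule measure_comb_series(1)[OF c Bx S_ball[OF c_sf] K0 Ksum])
      have m2: "(\<lambda>d. cN N d * measure (dirac_comb (S d)) B) sums measure (comb_series (cN N) S) B"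
        by (rule measure_comb_series(1)[OF cNs cN0 Bx S_ball[OF cN_sf] K0 sums_summable[OF KN]])
      have em: "emeasure (comb_series (cN N) S) B = ennreal (measure (comb_series (cN N) S) B)"
        by (rule measure_comb_series(2)[OF cNs cN0 Bx S_ball[OF cN_sf] K0 sums_summable[OF KN]])
      have "measure \<mu> B - (\<Sum>d<Suc N. c d * measure (dirac_comb (S d)) B) = measure (comb_series (cN N) S) B"
        using sums_unique2[OF tail[OF sums_summable[OF m1], of N, folded sums_unique[OF m1]] m2] .
      then show "ennreal \<bar>measure \<mu> B - (\<Sum>d<Suc N. c d * measure (dirac_comb (S d)) B)\<bar> = emeasure (comb_series (cN N) S) B"
        using em by simp
    next
      fix x :: "real^'n"
      note KN = tail[OF Ksum, of N]
      show "emeasure (comb_series (cN N) S) (ball x 1) \<le> ennreal ((\<Sum>d. c d * K d) - (\<Sum>d<Suc N. c d * K d))"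
        unfolding sums_unique[OF KN]
        by (rule emeasure_comb_series_le[OF cNs cN0 _ S_ball[OF cN_sf] K0 sums_summable[OF KN]]) simp
    qed
    have "(\<lambda>N. (\<Sum>d. c d * K d) - (\<Sum>d<Suc N. c d * K d)) \<longlonglongrightarrow> (\<Sum>d. c d * K d) - (\<Sum>d. c d * K d)"
      by (intro tendsto_intros LIMSEQ_Suc[OF summable_LIMSEQ[OF Ksum]])
    then have "(\<lambda>N. ennreal ((\<Sum>d. c d * K d) - (\<Sum>d<Suc N. c d * K d))) \<longlonglongrightarrow> ennreal 0"
      by (intro tendsto_ennrealI) simp
    then have lim: "(\<lambda>N. ennreal ((\<Sum>d. c d * K d) - (\<Sum>d<Suc N. c d * K d))) \<longlonglongrightarrow> 0" by simp
    show ?thesis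
      unfolding S_def[symmetric] det weights
      by (rule tendsto_sandwich[OF _ _ tendsto_const lim]) (use bound in \<open>auto intro!: always_eventually\<close>)
  qed
  ultimately show ?thesis by blast
qed

end
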